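(* Let $X$ be a non-empty dense-in-itself metric space. Then the Hilbert system $\mathrm{KD4G}_1t$ is strongly complete over $X$ for $\mathcal L_{[d]}^{\langle dt\rangle}$-formulas, and sound if $\mathrm G_1$ is valid in $X$.
   Context: A metric space is regarded as a topological space with its metric topology; a space is dense in itself if no singleton subset is open. For $S\subseteq X$, $\langle d\rangle S=\{x\in X: S\cap O\setminus\{x\}\neq\emptyset\text{ for every open neighbourhood }O\text{ of }x\}$. LANGUAGE. $\mathsf{Var}$ is a fixed set of propositional variables (atoms). $\mathcal L_{[d]}^{\langle dt\rangle}$-formulas: atoms; $\top$; $\neg\varphi$; $\varphi\wedge\psi$; $[d]\varphi$; and $\langle dt\rangle\Delta$ for each non-empty finite set $\Delta$ of formulas. Abbreviations: $\vee,\to,\leftrightarrow$ as usual, $\langle d\rangle\varphi=\neg[d]\neg\varphi$, $\Box^*\varphi=\varphi\wedge[d]\varphi$. SEMANTICS. An assignment into $X$ is a map $h:\mathsf{Var}\to\wp(X)$. Truth $(X,h),x\models\varphi$ at $x\in X$: atoms $p$ are true iff $x\in h(p)$; $\top$ and Booleans as usual; $[d]\varphi$ is true at $x$ iff some open neighbourhood $O$ of $x$ has $\varphi$ true at every $y\in O\setminus\{x\}$; $\langle dt\rangle\Delta$ is true at $x$ iff there is $S\subseteq X$ with $x\in S\subseteq\bigcap_{\delta\in\Delta}\langle d\rangle([\![\delta]\!]\cap S)$, where $[\![\delta]\!]=\{y\in X:(X,h),y\models\delta\}$. A formula is valid in $X$ if true at every point under every assignment; a scheme is valid if all its instances are. A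 set $\Gamma$ of formulas is satisfiable in $X$ if there are one assignment $h$ and one point $x\in X$ with $(X,h),x\models\gamma$ for all $\gamma\in\Gamma$. SYSTEM. $\mathrm G_1$ is the scheme of all formulas $[d](\Box^*Q_0\vee\Box^*Q_1)\to([d]\neg Q_0\vee[d]\neg Q_1)$, where $Q_0=\varphi_0\wedge\neg\varphi_1$, $Q_1=\varphi_1\wedge\neg\varphi_0$, and $\varphi_0,\varphi_1$ are arbitrary formulas. $\mathrm{KD4G}_1t$: axioms are all instances of propositional tautologies; $[d](\varphi\to\psi)\to([d]\varphi\to[d]\psi)$; $\langle d\rangle\top$; $[d]\varphi\to[d][d]\varphi$; $\mathrm G_1$; (Fix) $\langle dt\rangle\Gamma\to\langle d\rangle(\gamma\wedge\langle dt\rangle\Gamma)$ for each $\gamma\in\Gamma$; (Ind) $\Box^*(\varphi\to\bigwedge_{\gamma\in\Gamma}\langle d\rangle(\gamma\wedge\varphi))\to(\varphi\to\langle dt\rangle\Gamma)$. Rules: modus ponens; from $\varphi$ infer $[d]\varphi$. A Hilbert system $H$ is sound over $X$ if all its theorems are valid in $X$. A formula is $H$-consistent if its negation is not a theorem of $H$; a set is $H$-consistent if the conjunction of each of its finite subsets is. $H$ is strongly complete over $X$ if every countable $H$-consistent set of formulas of its language is satisfiable in $X$. *)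

theory Defs
  imports "HOL-Analysis.Analysis" "HOL-Library.FSet" "HOL-Library.Countable_Set"
begin

datatype 'v fm =
    Atom 'v
  | Top
  | Neg "'v fm"
  | And "'v fm" "'v fm"
  | Box "'v fm"          \<comment> \<open>\<open>[d]\<phi>\<close>\<close>
  | Tangle "'v fm fset"  \<comment> \<open>\<open>\<langle>dt\<rangle>\<Delta>\<close>\<close>

text \<open>
  The datatype also contains \<open>Tangle {||}\<close>, which is not a formula of the language; the set of
  formulas proper is \<open>formulas\<close>.
\<close>

inductive_set formulas :: "'v fm set" where
  Atom: "Atom p \<in> formulas"
| Top: "Top \<in> formulas"
| Neg: "\<phi> \<in> formulas \<Longrightarrow> Neg \<phi> \<in> formulas"
| And: "\<phi> \<in> formulas \<Longrightarrow> \<psi> \<in> formulas \<Longrightarrow> And \<phi> \<psi> \<in> formulas"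
| Box: "\<phi> \<in> formulas \<Longrightarrow> Box \<phi> \<in> formulas"
| Tangle: "\<Delta> \<noteq> {||} \<Longrightarrow> (\<And>\<delta>. \<delta> \<in> fset \<Delta> \<Longrightarrow> \<delta> \<in> formulas) \<Longrightarrow> Tangle \<Delta> \<in> formulas"

definition Or :: "'v fm \<Rightarrow> 'v fm \<Rightarrow> 'v fm" where
  "Or \<phi> \<psi> = Neg (And (Neg \<phi>) (Neg \<psi>))"

definition Imp :: "'v fm \<Rightarrow> 'v fm \<Rightarrow> 'v fm" where
  "Imp \<phi> \<psi> = Neg (And \<phi> (Neg \<psi>))"

definition Dia :: "'v fm \<Rightarrow> 'v fm" where
  "Dia \<phi> = Neg (Box (Neg \<phi>))"

definition BoxStar :: "'v fm \<Rightarrow> 'v fm" where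
  "BoxStar \<phi> = And \<phi> (Box \<phi>)"

primrec Conj :: "'v fm list \<Rightarrow> 'v fm" where
  "Conj [] = Top"
| "Conj (\<phi> # \<phi>s) = And \<phi> (Conj \<phi>s)"

definition derived :: "'a::topological_space set \<Rightarrow> 'a set" where
  "derived S = {x. x islimpt S}"

text \<open>
  \<open>truth_set h \<phi>\<close> is the set of all points at which \<open>\<phi>\<close> is true under the assignment \<open>h\<close>.  In the
  last equation, \<open>D\<close> ranges over the truth sets of the members of \<open>\<Delta>\<close>; the form with \<open>\<delta> \<in> \<Delta>\<close>
  is the lemma \<open>truth_set_Tangle\<close>.
\<close>

primrec truth_set :: "('v \<Rightarrow> 'a::topological_space set) \<Rightarrow> 'v fm \<Rightarrow> 'a set" where
  "truth_set h (Atom p) = h p"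
| "truth_set h Top = UNIV"
| "truth_set h (Neg \<phi>) = - truth_set h \<phi>"
| "truth_set h (And \<phi> \<psi>) = truth_set h \<phi> \<inter> truth_set h \<psi>"
| "truth_set h (Box \<phi>) = {x. \<exists>U. open U \<and> x \<in> U \<and> (\<forall>y \<in> U - {x}. y \<in> truth_set h \<phi>)}"
| "truth_set h (Tangle \<Delta>) =
     {x. \<exists>S. x \<in> S \<and> S \<subseteq> (\<Inter>D \<in> fset (truth_set h |`| \<Delta>). derived (D \<inter> S))}"

lemma truth_set_Tangle:
  "truth_set h (Tangle \<Delta>) =
     {x. \<exists>S. x \<in> S \<and> S \<subseteq> (\<Inter>\<delta> \<in> fset \<Delta>. derived (truth_set h \<delta> \<inter> S))}"
  by simp

text \<open>
  The space \<open>X\<close> is given as a type: \<open>TYPE('a)\<close> stands for the space on the whole (non-empty) type.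
  The class \<open>perfect_space\<close> says that no singleton is open, i.e. that the space is dense in itself.
\<close>

definition valid_in :: "'a::topological_space itself \<Rightarrow> 'v fm \<Rightarrow> bool" where
  "valid_in X \<phi> \<longleftrightarrow> (\<forall>(h :: 'v \<Rightarrow> 'a set) x. x \<in> truth_set h \<phi>)"

definition scheme_valid_in :: "'a::topological_space itself \<Rightarrow> 'v fm set \<Rightarrow> bool" where
  "scheme_valid_in X \<Sigma> \<longleftrightarrow> (\<forall>\<phi> \<in> \<Sigma>. valid_in X \<phi>)"

definition satisfiable_in :: "'a::topological_space itself \<Rightarrow> 'v fm set \<Rightarrow> bool" where
  "satisfiable_in X \<Gamma> \<longleftrightarrow> (\<exists>(h :: 'v \<Rightarrow> 'a set) x. \<forall>\<gamma> \<in> \<Gamma>. x \<in> truth_set h \<gamma>)"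

datatype pform = PVar nat | PTop | PNeg pform | PAnd pform pform

primrec peval :: "(nat \<Rightarrow> bool) \<Rightarrow> pform \<Rightarrow> bool" where
  "peval v (PVar n) = v n"
| "peval v PTop = True"
| "peval v (PNeg \<alpha>) = (\<not> peval v \<alpha>)"
| "peval v (PAnd \<alpha> \<beta>) = (peval v \<alpha> \<and> peval v \<beta>)"

primrec psubst :: "(nat \<Rightarrow> 'v fm) \<Rightarrow> pform \<Rightarrow> 'v fm" where
  "psubst \<sigma> (PVar n) = \<sigma> n"
| "psubst \<sigma> PTop = Top"
| "psubst \<sigma> (PNeg \<alpha>) = Neg (psubst \<sigma> \<alpha>)"
| "psubst \<sigma> (PAnd \<alpha> \<beta>) = And (psubst \<sigma> \<alpha>) (psubst \<sigma> \<beta>)"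

definition taut_instances :: "'v fm set" where
  "taut_instances = {psubst \<sigma> \<alpha> | \<sigma> \<alpha>. (\<forall>v. peval v \<alpha>) \<and> (\<forall>n. \<sigma> n \<in> formulas)}"

definition G1_instance :: "'v fm \<Rightarrow> 'v fm \<Rightarrow> 'v fm" where
  "G1_instance \<phi>0 \<phi>1 =
     (let Q0 = And \<phi>0 (Neg \<phi>1); Q1 = And \<phi>1 (Neg \<phi>0)
      in Imp (Box (Or (BoxStar Q0) (BoxStar Q1))) (Or (Box (Neg Q0)) (Box (Neg Q1))))"

definition G1 :: "'v fm set" where
  "G1 = {G1_instance \<phi>0 \<phi>1 | \<phi>0 \<phi>1. \<phi>0 \<in> formulas \<and> \<phi>1 \<in> formulas}"

text \<open>
  In \<open>Ind\<close>, the conjunction over the finite set \<open>\<Gamma>\<close> is formed along a list enumerating \<open>\<Gamma>\<close>; every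
  enumeration gives an axiom.
\<close>

inductive_set KD4G1t :: "'v fm set" where
  Taut: "\<phi> \<in> taut_instances \<Longrightarrow> \<phi> \<in> KD4G1t"
| K: "\<phi> \<in> formulas \<Longrightarrow> \<psi> \<in> formulas \<Longrightarrow>
    Imp (Box (Imp \<phi> \<psi>)) (Imp (Box \<phi>) (Box \<psi>)) \<in> KD4G1t"
| D: "Dia Top \<in> KD4G1t"
| Four: "\<phi> \<in> formulas \<Longrightarrow> Imp (Box \<phi>) (Box (Box \<phi>)) \<in> KD4G1t"
| G1: "\<phi> \<in> G1 \<Longrightarrow> \<phi> \<in> KD4G1t"
| Fix: "Tangle \<Gamma> \<in> formulas \<Longrightarrow> \<gamma> \<in> fset \<Gamma> \<Longrightarrow>
    Imp (Tangle \<Gamma>) (Dia (And \<gamma> (Tangle \<Gamma>))) \<in> KD4G1t"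
| Ind: "Tangle \<Gamma> \<in> formulas \<Longrightarrow> \<phi> \<in> formulas \<Longrightarrow> set \<gamma>s = fset \<Gamma> \<Longrightarrow>
    Imp (BoxStar (Imp \<phi> (Conj (map (\<lambda>\<gamma>. Dia (And \<gamma> \<phi>)) \<gamma>s)))) (Imp \<phi> (Tangle \<Gamma>)) \<in> KD4G1t"
| MP: "\<phi> \<in> KD4G1t \<Longrightarrow> Imp \<phi> \<psi> \<in> KD4G1t \<Longrightarrow> \<psi> \<in> KD4G1t"
| Gen: "\<phi> \<in> KD4G1t \<Longrightarrow> Box \<phi> \<in> KD4G1t"

text \<open>
  A Hilbert system \<open>H\<close> is represented by its set of theorems.  For finite subsets of \<open>\<Gamma>\<close>,
  conjunctions along all enumerating lists are considered.
\<close>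

definition sound_over :: "'a::topological_space itself \<Rightarrow> 'v fm set \<Rightarrow> bool" where
  "sound_over X H \<longleftrightarrow> (\<forall>\<phi> \<in> H. valid_in X \<phi>)"

definition consistent_fm :: "'v fm set \<Rightarrow> 'v fm \<Rightarrow> bool" where
  "consistent_fm H \<phi> \<longleftrightarrow> Neg \<phi> \<notin> H"

definition consistent :: "'v fm set \<Rightarrow> 'v fm set \<Rightarrow> bool" where
  "consistent H \<Gamma> \<longleftrightarrow> (\<forall>\<gamma>s. set \<gamma>s \<subseteq> \<Gamma> \<longrightarrow> consistent_fm H (Conj \<gamma>s))"

text \<open>\<open>L\<close> is the language of the Hilbert system \<open>H\<close>.\<close>

definition strongly_complete_over ::
    "'a::topological_space itself \<Rightarrow> 'v fm set \<Rightarrow> 'v fm set \<Rightarrow> bool" where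
  "strongly_complete_over X L H \<longleftrightarrow>
     (\<forall>\<Gamma>. \<Gamma> \<subseteq> L \<and> countable \<Gamma> \<and> consistent H \<Gamma> \<longrightarrow> satisfiable_in X \<Gamma>)"

end

theory Submission
  imports Defs
begin

text \<open>
  Soundness is a direct verification of the axioms.  For strong completeness, the points of the space
  are labelled by maximal consistent sets in such a way that, for every formula of a finite set
  \<open>\<Phi>\<close> closed under subformulas, truth at a point coincides with membership in its label.

  Let \<open>Up \<Phi> w\<close> be the set of \<open>\<Phi>\<close>-types of the canonical successors of \<open>w\<close>.  Labelling works if the
  types accumulating at each point form exactly \<open>Up\<close> of its label, and if no tangle missing from a
  label is witnessed by the labels accumulating there.  Call a set \<open>U\<close> of types a core if every open
  set has a correct labelling whose types lie in \<open>U\<close> and all accumulate at every boundary point.  The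
  axiom Ind provides, in a definable class of points with \<open>Up \<Phi> w = U\<close> each of which sees another one,
  a cluster refuting all tangles absent from \<open>U\<close>; spreading it densely over an open set by means of a
  McKinsey-Tarski dissection makes \<open>U\<close> a core.  A point \<open>w\<close> for which \<open>Up \<Phi> w\<close> is not a core is placed
  at the centre of infinitely many concentric shells filled according to smaller cores.  Neighbouring
  shells fit together if their cores are comparable, and G1 says precisely that the cores seen by
  \<open>w\<close> are connected by chains of comparable ones.  Letting \<open>\<Phi>\<close> grow along the shells around a single
  point satisfies a countable consistent set at that point.
\<close>

section \<open>Maximal consistent sets\<close>

text \<open>The axiom Ind only excludes witnessing sets that a formula defines, while the semantics
  of a tangle quantifies over all sets. Truth of tangles is therefore proved for a labelling of the
  space and not read off from the canonical model. The labels are full maximal consistent sets, so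
  that every axiom may be applied at every label; correctness is demanded only for a finite
  \<open>\<Phi>\<close>. Finiteness serves twice: classes described through \<open>Up \<Phi>\<close>
  are definable, hence accessible to Ind and G1, and a point is a limit of a union of types only if
  it is a limit of one of them. As \<open>Up \<Phi> w\<close> can only shrink when passing to
  successors, the whole argument is an induction on its cardinality. The obstacle is the border
  between two shells, which is not empty in a connected space. A border point sees the types of both
  sides, so its label must see exactly the union of two cores. If one core contains the other, the
  point \<open>b\<close> belonging to the larger one is such a label; for incomparable cores there
  need not be any.\<close>

lemma formulas_simps [simp]:
  "Neg \<phi> \<in> formulas \<longleftrightarrow> \<phi> \<in> formulas"
  "And \<phi> \<psi> \<in> formulas \<longleftrightarrow> \<phi> \<in> formulas \<and> \<psi> \<in> formulas"
  "Box \<phi> \<in> formulas \<longleftrightarrow> \<phi> \<in> formulas"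
  "Tangle \<Delta> \<in> formulas \<longleftrightarrow> \<Delta> \<noteq> {||} \<and> (\<forall>\<delta> \<in> fset \<Delta>. \<delta> \<in> formulas)"
  "Atom p \<in> formulas" "Top \<in> formulas"
  by (auto intro: formulas.intros elim: formulas.cases)

lemma formulas_derived_simps [simp]:
  "Imp \<phi> \<psi> \<in> formulas \<longleftrightarrow> \<phi> \<in> formulas \<and> \<psi> \<in> formulas"
  "Or \<phi> \<psi> \<in> formulas \<longleftrightarrow> \<phi> \<in> formulas \<and> \<psi> \<in> formulas"
  "Dia \<phi> \<in> formulas \<longleftrightarrow> \<phi> \<in> formulas"
  "BoxStar \<phi> \<in> formulas \<longleftrightarrow> \<phi> \<in> formulas"
  by (auto simp: Imp_def Or_def Dia_def BoxStar_def)

lemma Conj_formulas [simp]: "Conj l \<in> formulas \<longleftrightarrow> set l \<subseteq> formulas"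
  by (induction l) auto

text \<open>A Boolean valuation, represented by the set of formulas that it makes true; atoms, boxes
  and tangles are valued freely. Propositional derivations thereby become simplification problems
  about membership.\<close>

definition prop_val :: "'v fm set \<Rightarrow> bool" where
  "prop_val V \<longleftrightarrow> Top \<in> V \<and> (\<forall>\<phi>. Neg \<phi> \<in> V \<longleftrightarrow> \<phi> \<notin> V) \<and>
    (\<forall>\<phi> \<psi>. And \<phi> \<psi> \<in> V \<longleftrightarrow> \<phi> \<in> V \<and> \<psi> \<in> V)"

lemma prop_val_simps:
  assumes "prop_val V"
  shows "Top \<in> V" "Neg \<phi> \<in> V \<longleftrightarrow> \<phi> \<notin> V" "And \<phi> \<psi> \<in> V \<longleftrightarrow> \<phi> \<in> V \<and> \<psi> \<in> V"
    "Imp \<phi> \<psi> \<in> V \<longleftrightarrow> (\<phi> \<in> V \<longrightarrow> \<psi> \<in> V)" "Or \<phi> \<psi> \<in> V \<longleftrightarrow> \<phi> \<in> V \<or> \<psi> \<in> V"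
    "Conj l \<in> V \<longleftrightarrow> set l \<subseteq> V"
proof -
  show *: "Top \<in> V" "Neg \<phi> \<in> V \<longleftrightarrow> \<phi> \<notin> V" "And \<phi> \<psi> \<in> V \<longleftrightarrow> \<phi> \<in> V \<and> \<psi> \<in> V" for \<phi> \<psi>
    using assms by (auto simp: prop_val_def)
  show "Imp \<phi> \<psi> \<in> V \<longleftrightarrow> (\<phi> \<in> V \<longrightarrow> \<psi> \<in> V)" "Or \<phi> \<psi> \<in> V \<longleftrightarrow> \<phi> \<in> V \<or> \<psi> \<in> V"
    by (auto simp: * Imp_def Or_def)
  show "Conj l \<in> V \<longleftrightarrow> set l \<subseteq> V"
    by (induction l) (auto simp: *)
qed

primrec prop_atoms :: "'v fm \<Rightarrow> 'v fm set" where
  "prop_atoms (Atom p) = {Atom p}"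
| "prop_atoms Top = {}"
| "prop_atoms (Neg \<phi>) = prop_atoms \<phi>"
| "prop_atoms (And \<phi> \<psi>) = prop_atoms \<phi> \<union> prop_atoms \<psi>"
| "prop_atoms (Box \<phi>) = {Box \<phi>}"
| "prop_atoms (Tangle \<Delta>) = {Tangle \<Delta>}"

primrec skeleton :: "('v fm \<Rightarrow> nat) \<Rightarrow> 'v fm \<Rightarrow> pform" where
  "skeleton g (Atom p) = PVar (g (Atom p))"
| "skeleton g Top = PTop"
| "skeleton g (Neg \<phi>) = PNeg (skeleton g \<phi>)"
| "skeleton g (And \<phi> \<psi>) = PAnd (skeleton g \<phi>) (skeleton g \<psi>)"
| "skeleton g (Box \<phi>) = PVar (g (Box \<phi>))"
| "skeleton g (Tangle \<Delta>) = PVar (g (Tangle \<Delta>))"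

lemma psubst_skeleton: "(\<And>a. a \<in> prop_atoms \<phi> \<Longrightarrow> \<sigma> (g a) = a) \<Longrightarrow> psubst \<sigma> (skeleton g \<phi>) = \<phi>"
  by (induction \<phi>) auto

lemma finite_prop_atoms: "finite (prop_atoms \<phi>)"
  by (induction \<phi>) auto

lemma prop_atoms_formulas: "\<phi> \<in> formulas \<Longrightarrow> prop_atoms \<phi> \<subseteq> formulas"
  by (induction \<phi>) auto

text \<open>The outermost atoms, boxes and tangles become the variables of a
  \<open>skeleton\<close>. Only finitely many occur in one formula, so natural numbers suffice to
  name them whatever the type of variables, and a valuation of the skeleton pulls back to a
  \<open>prop_val\<close> set.\<close>

lemma taut_theorem:
  assumes "\<phi> \<in> formulas" and "\<And>V. prop_val V \<Longrightarrow> \<phi> \<in> V"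
  shows "\<phi> \<in> KD4G1t"
proof -
  obtain g :: "'a fm \<Rightarrow> nat" where g: "inj_on g (prop_atoms \<phi>)"
    using finite_imp_inj_to_nat_seg[OF finite_prop_atoms] by metis
  \<comment> \<open>Numbers that name nothing in \<open>\<phi>\<close> are sent to
    \<open>Top\<close>, because an instance must substitute formulas for all variables.\<close>
  define \<sigma> where "\<sigma> n = (if n \<in> g ` prop_atoms \<phi> then inv_into (prop_atoms \<phi>) g n else Top)" for n
  have "psubst \<sigma> (skeleton g \<phi>) = \<phi>"
    by (rule psubst_skeleton) (auto simp: \<sigma>_def g)
  moreover have "peval v (skeleton g \<phi>)" for v
  proof -
    have "prop_val {\<psi>. peval v (skeleton g \<psi>)}"
      by (auto simp: prop_val_def)
    from assms(2)[OF this] show ?thesis by simp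
  qed
  moreover have "\<sigma> n \<in> formulas" for n
    using prop_atoms_formulas[OF assms(1)] inv_into_into[of n g "prop_atoms \<phi>"]
    by (auto simp: \<sigma>_def)
  ultimately have "\<phi> \<in> taut_instances"
    unfolding taut_instances_def by (auto intro!: exI[of _ \<sigma>] exI[of _ "skeleton g \<phi>"])
  then show ?thesis by (rule KD4G1t.Taut)
qed

lemma G1_instance_formulas [simp]:
  "G1_instance \<phi> \<psi> \<in> formulas \<longleftrightarrow> \<phi> \<in> formulas \<and> \<psi> \<in> formulas"
  by (auto simp: G1_instance_def Let_def)

lemma psubst_formulas: "(\<And>n. \<sigma> n \<in> formulas) \<Longrightarrow> psubst \<sigma> \<alpha> \<in> formulas"
  by (induction \<alpha>) auto

lemma theorem_formulas: "\<phi> \<in> KD4G1t \<Longrightarrow> \<phi> \<in> formulas"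
  by (induction rule: KD4G1t.induct)
    (auto simp: taut_instances_def G1_def psubst_formulas)

lemma theorem_consequence:
  assumes "set l \<subseteq> KD4G1t" "\<phi> \<in> formulas" "\<And>V. prop_val V \<Longrightarrow> set l \<subseteq> V \<Longrightarrow> \<phi> \<in> V"
  shows "\<phi> \<in> KD4G1t"
  using assms
proof (induction l arbitrary: \<phi>)
  case Nil
  then show ?case by (auto intro: taut_theorem)
next
  case (Cons \<psi> l)
  have "Imp \<psi> \<phi> \<in> KD4G1t"
    by (rule Cons.IH) (use Cons.prems in \<open>auto simp: theorem_formulas prop_val_simps\<close>)
  then show ?case using Cons.prems by (auto intro: KD4G1t.MP)
qed

section \<open>Maximal consistent sets and Lindenbaum's lemma\<close>

definition mcs :: "'v fm set \<Rightarrow> bool" where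
  "mcs w \<longleftrightarrow> w \<subseteq> formulas \<and> consistent KD4G1t w \<and> (\<forall>\<phi> \<in> formulas. \<phi> \<in> w \<or> Neg \<phi> \<in> w)"

lemma mcs_no_refutation: "mcs w \<Longrightarrow> set l \<subseteq> w \<Longrightarrow> Neg (Conj l) \<notin> KD4G1t"
  by (auto simp: mcs_def consistent_def consistent_fm_def)

lemma mcs_formulas: "mcs w \<Longrightarrow> \<phi> \<in> w \<Longrightarrow> \<phi> \<in> formulas"
  by (auto simp: mcs_def)

lemma mcs_Neg: "mcs w \<Longrightarrow> \<phi> \<in> formulas \<Longrightarrow> Neg \<phi> \<in> w \<longleftrightarrow> \<phi> \<notin> w"
proof
  assume *: "mcs w" "\<phi> \<in> formulas" "Neg \<phi> \<in> w"
  show "\<phi> \<notin> w"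
  proof
    assume "\<phi> \<in> w"
    with * mcs_no_refutation[of w "[\<phi>, Neg \<phi>]"] have "Neg (Conj [\<phi>, Neg \<phi>]) \<notin> KD4G1t" by simp
    moreover have "Neg (Conj [\<phi>, Neg \<phi>]) \<in> KD4G1t"
      by (rule taut_theorem) (use * in \<open>auto simp: prop_val_simps\<close>)
    ultimately show False by simp
  qed
qed (auto simp: mcs_def)

lemma mcs_consequence:
  assumes "mcs w" "set l \<subseteq> w \<union> KD4G1t" "\<phi> \<in> formulas"
    and "\<And>V. prop_val V \<Longrightarrow> set l \<subseteq> V \<Longrightarrow> \<phi> \<in> V"
  shows "\<phi> \<in> w"
proof (rule ccontr)
  assume "\<phi> \<notin> w"
  then have n: "Neg \<phi> \<in> w" using assms mcs_Neg by blast
  \<comment> \<open>Consistency of \<open>w\<close> speaks only about lists of its own members, so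
    the premises that are theorems are split off and discharged separately.\<close>
  let ?a = "filter (\<lambda>\<psi>. \<psi> \<in> w) l" and ?b = "filter (\<lambda>\<psi>. \<psi> \<in> KD4G1t) l"
  have "Neg (Conj (Neg \<phi> # ?a)) \<in> KD4G1t"
  proof (rule theorem_consequence[of ?b])
    show "set ?b \<subseteq> KD4G1t" by auto
    show "Neg (Conj (Neg \<phi> # ?a)) \<in> formulas" using assms(3) mcs_formulas[OF assms(1)] by auto
    fix V :: "'a fm set" assume V: "prop_val V" "set ?b \<subseteq> V"
    have "\<phi> \<in> V" if "set ?a \<subseteq> V" using assms(2) V(2) that by (intro assms(4)[OF V(1)]) auto
    then show "Neg (Conj (Neg \<phi> # ?a)) \<in> V" by (auto simp: prop_val_simps[OF V(1)])
  qed
  moreover have "set (Neg \<phi> # ?a) \<subseteq> w" using n by auto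
  ultimately show False using mcs_no_refutation[OF assms(1)] by blast
qed

lemma mcs_theorem: "mcs w \<Longrightarrow> \<phi> \<in> KD4G1t \<Longrightarrow> \<phi> \<in> w"
  by (rule mcs_consequence[of _ "[\<phi>]"]) (auto simp: theorem_formulas)

lemma mcs_Top: "mcs w \<Longrightarrow> Top \<in> w"
  by (rule mcs_consequence[of _ "[]"]) (auto simp: prop_val_simps)

lemma mcs_And:
  assumes "mcs w" "\<phi> \<in> formulas" "\<psi> \<in> formulas"
  shows "And \<phi> \<psi> \<in> w \<longleftrightarrow> \<phi> \<in> w \<and> \<psi> \<in> w"
proof (intro iffI conjI)
  assume "And \<phi> \<psi> \<in> w"
  then have "set [And \<phi> \<psi>] \<subseteq> w \<union> KD4G1t" by simp
  note * = mcs_consequence[OF assms(1) this]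
  show "\<phi> \<in> w" "\<psi> \<in> w"
    by (rule *; simp add: assms prop_val_simps(3))+
next
  assume "\<phi> \<in> w \<and> \<psi> \<in> w"
  then show "And \<phi> \<psi> \<in> w"
    by (intro mcs_consequence[OF assms(1), of "[\<phi>, \<psi>]"]) (simp_all add: assms prop_val_simps(3))
qed

lemma mcs_Imp:
  assumes "mcs w" "\<phi> \<in> formulas" "\<psi> \<in> formulas"
  shows "Imp \<phi> \<psi> \<in> w \<longleftrightarrow> (\<phi> \<in> w \<longrightarrow> \<psi> \<in> w)"
  using assms by (simp add: Imp_def mcs_Neg mcs_And)

lemma mcs_Or:
  assumes "mcs w" "\<phi> \<in> formulas" "\<psi> \<in> formulas"
  shows "Or \<phi> \<psi> \<in> w \<longleftrightarrow> \<phi> \<in> w \<or> \<psi> \<in> w"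
  using assms by (simp add: Or_def mcs_Neg mcs_And)

lemma mcs_Conj: "mcs w \<Longrightarrow> set l \<subseteq> formulas \<Longrightarrow> Conj l \<in> w \<longleftrightarrow> set l \<subseteq> w"
  by (induction l) (auto simp: mcs_Top mcs_And)

lemma mcs_MP: "mcs w \<Longrightarrow> Imp \<phi> \<psi> \<in> KD4G1t \<Longrightarrow> \<phi> \<in> w \<Longrightarrow> \<psi> \<in> w"
  using mcs_theorem[of w "Imp \<phi> \<psi>"] theorem_formulas[of "Imp \<phi> \<psi>"] mcs_Imp by fastforce

lemma consistent_split:
  assumes "consistent KD4G1t w" "w \<subseteq> formulas" "\<phi> \<in> formulas"
  shows "consistent KD4G1t (insert \<phi> w) \<or> consistent KD4G1t (insert (Neg \<phi>) w)"
proof (rule ccontr)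
  assume "\<not> ?thesis"
  then obtain l m where l: "set l \<subseteq> insert \<phi> w" "Neg (Conj l) \<in> KD4G1t"
    and m: "set m \<subseteq> insert (Neg \<phi>) w" "Neg (Conj m) \<in> KD4G1t"
    by (auto simp: consistent_def consistent_fm_def)
  let ?k = "filter (\<lambda>\<psi>. \<psi> \<in> w) (l @ m)"
  have "Neg (Conj ?k) \<in> KD4G1t"
  proof (rule theorem_consequence[of "[Neg (Conj l), Neg (Conj m)]"])
    fix V :: "'a fm set" assume V: "prop_val V" "set [Neg (Conj l), Neg (Conj m)] \<subseteq> V"
    then have "\<not> set l \<subseteq> V" "\<not> set m \<subseteq> V" by (simp_all add: prop_val_simps)
    moreover have "set l \<subseteq> insert \<phi> V" "set m \<subseteq> insert (Neg \<phi>) V" if "set ?k \<subseteq> V"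
      using that l(1) m(1) by auto
    ultimately have "\<not> set ?k \<subseteq> V" using prop_val_simps(2)[OF V(1), of \<phi>] by blast
    then show "Neg (Conj ?k) \<in> V" by (simp add: prop_val_simps[OF V(1)] del: set_filter)
  qed (use l m assms in auto)
  moreover have "set ?k \<subseteq> w" by auto
  ultimately show False using assms(1) by (auto simp: consistent_def consistent_fm_def)
qed

text \<open>Zorn's lemma replaces the usual enumeration of formulas, as there may be uncountably
  many variables.\<close>

lemma lindenbaum:
  assumes "\<Gamma> \<subseteq> formulas" "consistent KD4G1t \<Gamma>"
  obtains w where "mcs w" "\<Gamma> \<subseteq> w"
proof -
  let ?A = "{w. \<Gamma> \<subseteq> w \<and> w \<subseteq> formulas \<and> consistent KD4G1t w}"
  have "\<exists>M\<in>?A. \<forall>X\<in>?A. M \<subseteq> X \<longrightarrow> X = M"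
  proof (rule subset_Zorn_nonempty)
    show "?A \<noteq> {}" using assms by auto
    fix \<C> assume ne: "\<C> \<noteq> {}" and ch: "subset.chain ?A \<C>"
    have "consistent KD4G1t (\<Union>\<C>)"
      unfolding consistent_def
    proof (intro allI impI)
      fix l assume "set l \<subseteq> \<Union>\<C>"
      then obtain X where "X \<in> \<C>" "set l \<subseteq> X"
        using finite_subset_Union_chain[OF _ _ ne ch, of "set l"] by auto
      moreover have "consistent KD4G1t X" using \<open>X \<in> \<C>\<close> ch by (auto simp: subset.chain_def)
      ultimately show "consistent_fm KD4G1t (Conj l)" by (auto simp: consistent_def)
    qed
    then show "\<Union>\<C> \<in> ?A" using ne ch by (auto simp: subset.chain_def)
  qed
  then obtain w where "w \<in> ?A" and max0: "\<forall>X\<in>?A. w \<subseteq> X \<longrightarrow> X = w" by (rule bexE)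
  then have w: "\<Gamma> \<subseteq> w" "w \<subseteq> formulas" "consistent KD4G1t w" by auto
  have max: "X = w" if "X \<subseteq> formulas" "consistent KD4G1t X" "w \<subseteq> X" for X
    using max0 that w(1) by simp
  have "\<phi> \<in> w \<or> Neg \<phi> \<in> w" if "\<phi> \<in> formulas" for \<phi>
    using consistent_split[OF w(3,2) that] max[of "insert \<phi> w"] max[of "insert (Neg \<phi>) w"] w that
    by auto
  then have "mcs w" using w by (auto simp: mcs_def)
  with w that show ?thesis by blast
qed

section \<open>The canonical accessibility relation, transitive and serial but not assumed
  reflexive\<close>

definition succs :: "'v fm set \<Rightarrow> 'v fm set set" where
  "succs w = {u. mcs u \<and> (\<forall>\<phi>. Box \<phi> \<in> w \<longrightarrow> \<phi> \<in> u)}"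

lemma succs_mcs: "u \<in> succs w \<Longrightarrow> mcs u"
  by (simp add: succs_def)

lemma Box_Conj_consequence:
  assumes "mcs w" "\<And>\<psi>. \<psi> \<in> set m \<Longrightarrow> Box \<psi> \<in> w" "Imp (Conj m) \<phi> \<in> KD4G1t" "\<phi> \<in> formulas"
  shows "Box \<phi> \<in> w"
  using assms(2-)
proof (induction m arbitrary: \<phi>)
  case Nil
  have "\<phi> \<in> KD4G1t"
    by (rule theorem_consequence[of "[Imp Top \<phi>]"]) (use Nil in \<open>auto simp: prop_val_simps\<close>)
  then show ?case using mcs_theorem[OF assms(1)] KD4G1t.Gen by blast
next
  case (Cons \<psi> m)
  have f: "Conj m \<in> formulas" "\<psi> \<in> formulas" using theorem_formulas[OF Cons.prems(2)] by auto
  have "Imp (Conj m) (Imp \<psi> \<phi>) \<in> KD4G1t"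
    by (rule theorem_consequence[of "[Imp (Conj (\<psi> # m)) \<phi>]"])
      (use Cons.prems f in \<open>auto simp: prop_val_simps\<close>)
  then have "Box (Imp \<psi> \<phi>) \<in> w" using Cons f by auto
  moreover have "Imp (Box (Imp \<psi> \<phi>)) (Imp (Box \<psi>) (Box \<phi>)) \<in> KD4G1t"
    using f Cons.prems by (auto intro: KD4G1t.K)
  ultimately have "Imp (Box \<psi>) (Box \<phi>) \<in> w" using mcs_MP[OF assms(1)] by blast
  then show ?case using Cons.prems f assms(1) by (auto simp: mcs_Imp)
qed

text \<open>The existence lemma: if \<open>Neg \<phi>\<close> contradicted what is boxed in
  \<open>w\<close>, normality would put \<open>Box \<phi>\<close> into \<open>w\<close>.\<close>

lemma mcs_Box:
  assumes "mcs w" "\<phi> \<in> formulas"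
  shows "Box \<phi> \<in> w \<longleftrightarrow> (\<forall>u\<in>succs w. \<phi> \<in> u)"
proof
  show "Box \<phi> \<in> w \<Longrightarrow> \<forall>u\<in>succs w. \<phi> \<in> u" by (auto simp: succs_def)
  assume all: "\<forall>u\<in>succs w. \<phi> \<in> u"
  show "Box \<phi> \<in> w"
  proof (rule ccontr)
    assume n: "Box \<phi> \<notin> w"
    let ?Y = "insert (Neg \<phi>) {\<psi>. Box \<psi> \<in> w}"
    have Yf: "?Y \<subseteq> formulas" using assms mcs_formulas[OF assms(1)] by fastforce
    have "consistent KD4G1t ?Y"
      unfolding consistent_def consistent_fm_def
    proof (intro allI impI notI)
      fix l assume l: "set l \<subseteq> ?Y" "Neg (Conj l) \<in> KD4G1t"
      let ?m = "filter (\<lambda>\<psi>. Box \<psi> \<in> w) l"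
      have "Imp (Conj ?m) \<phi> \<in> KD4G1t"
      proof (rule theorem_consequence[of "[Neg (Conj l)]"])
        fix V :: "'a fm set" assume V: "prop_val V" "set [Neg (Conj l)] \<subseteq> V"
        then have "\<not> set l \<subseteq> V" by (simp add: prop_val_simps)
        moreover have "set l \<subseteq> insert (Neg \<phi>) V" if "set ?m \<subseteq> V" using that l(1) by auto
        ultimately show "Imp (Conj ?m) \<phi> \<in> V"
          using prop_val_simps(2,4,6)[OF V(1)] by blast
      next
        show "set [Neg (Conj l)] \<subseteq> KD4G1t" using l(2) by simp
        have "set ?m \<subseteq> formulas" using l(1) Yf by auto
        then show "Imp (Conj ?m) \<phi> \<in> formulas" using assms(2) by (simp del: set_filter)
      qed
      from Box_Conj_consequence[OF assms(1) _ this assms(2)] have "Box \<phi> \<in> w" by simp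
      with n show False by simp
    qed
    then obtain u where "mcs u" "?Y \<subseteq> u" using lindenbaum[OF Yf] by blast
    then have "u \<in> succs w" "\<phi> \<notin> u" using assms by (auto simp: succs_def mcs_Neg)
    with all show False by simp
  qed
qed

lemma mcs_Dia:
  assumes "mcs w" "\<phi> \<in> formulas"
  shows "Dia \<phi> \<in> w \<longleftrightarrow> (\<exists>u\<in>succs w. \<phi> \<in> u)"
proof -
  have "Dia \<phi> \<in> w \<longleftrightarrow> (\<exists>u\<in>succs w. Neg \<phi> \<notin> u)"
    unfolding Dia_def using assms by (subst mcs_Neg) (simp_all add: mcs_Box)
  then show ?thesis using assms by (auto simp: mcs_Neg succs_mcs)
qed

lemma mcs_BoxStar:
  assumes "mcs w" "\<phi> \<in> formulas"
  shows "BoxStar \<phi> \<in> w \<longleftrightarrow> (\<forall>u\<in>insert w (succs w). \<phi> \<in> u)"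
  using assms by (auto simp: BoxStar_def mcs_And mcs_Box)

lemma succs_trans:
  assumes "mcs w" "u \<in> succs w" "v \<in> succs u"
  shows "v \<in> succs w"
  unfolding succs_def
proof (safe)
  show "mcs v" using assms by (simp add: succs_mcs)
  fix \<phi> assume "Box \<phi> \<in> w"
  moreover then have "\<phi> \<in> formulas" using mcs_formulas[OF assms(1)] by fastforce
  ultimately have "Box (Box \<phi>) \<in> w" using mcs_MP[OF assms(1)] KD4G1t.Four by blast
  then show "\<phi> \<in> v" using assms by (auto simp: succs_def)
qed

lemma succs_nonempty: "mcs w \<Longrightarrow> succs w \<noteq> {}"
  using mcs_theorem[OF _ KD4G1t.D] mcs_Dia[of w Top] by auto

text \<open>Ind and G1 are schemes over formulas, so they apply to a class of maximal consistent
  sets only if one formula cuts it out. The values of \<open>P\<close> at other sets are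
  irrelevant.\<close>

definition definable :: "('v fm set \<Rightarrow> bool) \<Rightarrow> bool" where
  "definable P \<longleftrightarrow> (\<exists>\<theta>\<in>formulas. \<forall>w. mcs w \<longrightarrow> (\<theta> \<in> w \<longleftrightarrow> P w))"

lemma definable_formula: "\<phi> \<in> formulas \<Longrightarrow> definable (\<lambda>w. \<phi> \<in> w)"
  by (auto simp: definable_def)

lemma definable_not: "definable P \<Longrightarrow> definable (\<lambda>w. \<not> P w)"
  unfolding definable_def by (metis formulas_simps(1) mcs_Neg)

lemma definable_conj: "definable P \<Longrightarrow> definable Q \<Longrightarrow> definable (\<lambda>w. P w \<and> Q w)"
  unfolding definable_def by (metis formulas_simps(2) mcs_And)

lemma definable_const: "definable (\<lambda>w. c)"
proof (cases c)
  case True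
  then show ?thesis unfolding definable_def by (auto intro!: bexI[of _ Top] simp: mcs_Top)
next
  case False
  then show ?thesis unfolding definable_def
    by (auto intro!: bexI[of _ "Neg Top"] simp: mcs_Top mcs_Neg)
qed

lemma definable_all: "finite I \<Longrightarrow> (\<And>i. i \<in> I \<Longrightarrow> definable (P i)) \<Longrightarrow> definable (\<lambda>w. \<forall>i\<in>I. P i w)"
  by (induction I rule: finite_induct) (auto intro: definable_const definable_conj)

lemma definable_ex: "finite I \<Longrightarrow> (\<And>i. i \<in> I \<Longrightarrow> definable (P i)) \<Longrightarrow> definable (\<lambda>w. \<exists>i\<in>I. P i w)"
  using definable_not[OF definable_all[of I "\<lambda>i w. \<not> P i w"]] definable_not by auto

lemma definable_succs: "definable P \<Longrightarrow> definable (\<lambda>w. \<exists>u\<in>succs w. P u)"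
  unfolding definable_def by (metis formulas_derived_simps(3) mcs_Dia succs_mcs)

lemma definable_iff_const: "definable P \<Longrightarrow> definable (\<lambda>w. P w \<longleftrightarrow> c)"
  by (cases c) (auto intro: definable_not)

text \<open>With finitely many possible values, to say which of them occur among the successors is a
  finite Boolean combination of diamonds. Iterating this makes \<open>Up\<close> and then
  \<open>Up2\<close> definable.\<close>

lemma definable_image_eq:
  assumes "finite A" "\<And>a. definable (\<lambda>w. f w = a)" "\<And>w. mcs w \<Longrightarrow> f w \<in> A"
  shows "definable (\<lambda>w. f ` succs w = Y)"
proof -
  let ?P = "\<lambda>w. Y \<subseteq> A \<and> (\<forall>a\<in>A. (\<exists>u\<in>succs w. f u = a) \<longleftrightarrow> a \<in> Y)"
  have "definable ?P"
    by (intro definable_conj definable_const definable_all assms definable_iff_const definable_succs)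
  moreover have "f ` succs w = Y \<longleftrightarrow> ?P w" for w
  proof -
    have "f ` succs w \<subseteq> A" using assms(3)[OF succs_mcs] by blast
    then have "f ` succs w = Y \<longleftrightarrow> Y \<subseteq> A \<and> (\<forall>a\<in>A. a \<in> f ` succs w \<longleftrightarrow> a \<in> Y)" by blast
    moreover have "a \<in> f ` succs w \<longleftrightarrow> (\<exists>u\<in>succs w. f u = a)" for a by auto
    ultimately show ?thesis by simp
  qed
  ultimately show ?thesis by simp
qed

lemma definable_of_finite:
  assumes "finite A" "\<And>a. definable (\<lambda>w. f w = a)" "\<And>w. mcs w \<Longrightarrow> f w \<in> A"
  shows "definable (\<lambda>w. Q (f w))"
proof -
  have "definable (\<lambda>w. \<exists>a\<in>{a\<in>A. Q a}. f w = a)"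
    by (intro definable_ex) (use assms in auto)
  then show ?thesis using assms(3) unfolding definable_def by (simp cong: conj_cong)
qed

section \<open>The axioms Fix, Ind and G1 at maximal consistent sets\<close>

lemma mcs_Fix:
  assumes "mcs w" "Tangle \<Gamma> \<in> w" "\<gamma> \<in> fset \<Gamma>"
  obtains u where "u \<in> succs w" "\<gamma> \<in> u" "Tangle \<Gamma> \<in> u"
proof -
  have f: "Tangle \<Gamma> \<in> formulas" using assms mcs_formulas by blast
  then have g: "\<gamma> \<in> formulas" using assms by auto
  have "Dia (And \<gamma> (Tangle \<Gamma>)) \<in> w"
    using KD4G1t.Fix[OF f assms(3)] mcs_MP assms by blast
  then obtain u where "u \<in> succs w" "And \<gamma> (Tangle \<Gamma>) \<in> u" 
    using mcs_Dia[OF assms(1), of "And \<gamma> (Tangle \<Gamma>)"] f g by auto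
  then show ?thesis using that f g mcs_And succs_mcs by blast
qed

text \<open>Used mostly in contraposition: if a tangle is absent from \<open>w\<close>, some point
  of \<open>P\<close> that is \<open>w\<close> or a successor of \<open>w\<close> sees no point of
  \<open>P\<close> containing a certain member of the tangle.\<close>

lemma mcs_Ind:
  assumes "definable P" "Tangle \<Gamma> \<in> formulas" "mcs w" "P w"
    and step: "\<And>v \<gamma>. v \<in> insert w (succs w) \<Longrightarrow> P v \<Longrightarrow> \<gamma> \<in> fset \<Gamma> \<Longrightarrow> \<exists>u\<in>succs v. \<gamma> \<in> u \<and> P u"
  shows "Tangle \<Gamma> \<in> w"
proof -
  obtain \<theta> where \<theta>: "\<theta> \<in> formulas" "\<And>v. mcs v \<Longrightarrow> \<theta> \<in> v \<longleftrightarrow> P v"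
    using assms(1) by (auto simp: definable_def)
  obtain l where l: "set l = fset \<Gamma>" using finite_list[OF finite_fset[of \<Gamma>]] by (rule exE)
  let ?c = "Conj (map (\<lambda>\<gamma>. Dia (And \<gamma> \<theta>)) l)"
  have cf: "set (map (\<lambda>\<gamma>. Dia (And \<gamma> \<theta>)) l) \<subseteq> formulas" "?c \<in> formulas" using l assms(2) \<theta> by auto
  have "Imp \<theta> ?c \<in> v" if v: "v \<in> insert w (succs w)" for v
  proof -
    have mv: "mcs v" using v assms(3) succs_mcs by auto
    have "Dia (And \<gamma> \<theta>) \<in> v" if "P v" "\<gamma> \<in> fset \<Gamma>" for \<gamma>
    proof -
      have g: "\<gamma> \<in> formulas" using assms(2) that by auto
      from step[OF v that] obtain u where u: "u \<in> succs v" "\<gamma> \<in> u" "P u" by blast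
      then have "And \<gamma> \<theta> \<in> u" using g \<theta> mcs_And succs_mcs by blast
      then show ?thesis using mcs_Dia[of v "And \<gamma> \<theta>"] mv g \<theta> u by auto
    qed
    then show ?thesis using mcs_Imp[OF mv \<theta>(1) cf(2)] mcs_Conj[OF mv cf(1)] \<theta>(2)[OF mv] l by auto
  qed
  then have "BoxStar (Imp \<theta> ?c) \<in> w" using mcs_BoxStar[of w "Imp \<theta> ?c"] assms(3) \<theta>(1) cf(2) by simp
  then have "Imp \<theta> (Tangle \<Gamma>) \<in> w"
    using KD4G1t.Ind[OF assms(2) \<theta>(1) l] mcs_MP[OF assms(3)] by blast
  then show ?thesis using mcs_Imp[OF assms(3) \<theta>(1) assms(2)] \<theta>(2) assms(3,4) by blast
qed

text \<open>Seeing the tangle is itself a definable property that reproduces itself as Ind requires.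
  The lemma guarantees that a tangle absent from a label is absent from all types accumulating
  there.\<close>

lemma mcs_Tangle_down:
  assumes "mcs w" "u \<in> succs w" "Tangle \<Gamma> \<in> u"
  shows "Tangle \<Gamma> \<in> w"
proof (rule mcs_Ind[where P = "\<lambda>v. \<exists>u\<in>succs v. Tangle \<Gamma> \<in> u"])
  show f: "Tangle \<Gamma> \<in> formulas" using assms mcs_formulas succs_mcs by blast
  then show "definable (\<lambda>v. \<exists>u\<in>succs v. Tangle \<Gamma> \<in> u)" by (intro definable_succs definable_formula)
  show "mcs w" "\<exists>u\<in>succs w. Tangle \<Gamma> \<in> u" using assms by auto
  fix v \<gamma> assume v: "v \<in> insert w (succs w)" "\<exists>u\<in>succs v. Tangle \<Gamma> \<in> u" "\<gamma> \<in> fset \<Gamma>"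
  then obtain x where x: "x \<in> succs v" "Tangle \<Gamma> \<in> x" by blast
  have mv: "mcs v" using v assms succs_mcs by auto
  \<comment> \<open>Fix is needed twice: \<open>y\<close> provides the member
    \<open>\<gamma>\<close>, and \<open>z\<close> shows that \<open>y\<close> again sees the
    tangle.\<close>
  obtain y where y: "y \<in> succs x" "\<gamma> \<in> y" "Tangle \<Gamma> \<in> y"
    using mcs_Fix[OF succs_mcs[OF x(1)] x(2) v(3)] by blast
  obtain z where z: "z \<in> succs y" "Tangle \<Gamma> \<in> z"
    using mcs_Fix[OF succs_mcs[OF y(1)] y(3) v(3)] by blast
  show "\<exists>u\<in>succs v. \<gamma> \<in> u \<and> (\<exists>u\<in>succs u. Tangle \<Gamma> \<in> u)"
    using succs_trans[OF mv x(1) y(1)] y z by blast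
qed

text \<open>For \<open>\<phi>0 = \<theta>\<close> and \<open>\<phi>1 = Neg \<theta>\<close>, the
  formulas \<open>Q0\<close> and \<open>Q1\<close> amount to \<open>\<theta>\<close> and its
  negation. G1 then says that the graph of accessibility on \<open>succs w\<close> is connected as
  far as formulas can tell: a definable property that is not constant there changes along some
  edge.\<close>

lemma mcs_G1:
  assumes "definable P" "mcs w" "a \<in> succs w" "b \<in> succs w" "P a" "\<not> P b"
  obtains u v where "u \<in> succs w" "v \<in> succs u" "P u \<noteq> P v"
proof -
  obtain \<theta> where \<theta>: "\<theta> \<in> formulas" "\<And>v. mcs v \<Longrightarrow> \<theta> \<in> v \<longleftrightarrow> P v"
    using assms(1) by (auto simp: definable_def)
  let ?p = "And \<theta> (Neg (Neg \<theta>))" and ?q = "And (Neg \<theta>) (Neg \<theta>)"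
  have p: "?p \<in> v \<longleftrightarrow> P v" "?q \<in> v \<longleftrightarrow> \<not> P v" if "mcs v" for v
    using \<theta> that by (auto simp: mcs_And mcs_Neg)
  have f: "?p \<in> formulas" "?q \<in> formulas" using \<theta> by auto
  have "G1_instance \<theta> (Neg \<theta>) \<in> KD4G1t" 
    using \<theta>(1) formulas_simps(1) unfolding G1_def by (intro KD4G1t.G1) (unfold G1_def, blast)
  then have imp: "Box (Or (BoxStar ?p) (BoxStar ?q)) \<in> w \<Longrightarrow> Or (Box (Neg ?p)) (Box (Neg ?q)) \<in> w"
    using mcs_MP[OF assms(2)] by (auto simp: G1_instance_def Let_def)
  have "Box (Or (BoxStar ?p) (BoxStar ?q)) \<notin> w"
  proof
    assume "Box (Or (BoxStar ?p) (BoxStar ?q)) \<in> w"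
    then have "Box (Neg ?p) \<in> w \<or> Box (Neg ?q) \<in> w"
      using mcs_Or[OF assms(2), of "Box (Neg ?p)" "Box (Neg ?q)"] imp f by simp
    then have "Neg ?p \<in> a \<or> Neg ?q \<in> b" using assms by (auto simp: succs_def)
    moreover have ma: "mcs a" and mb: "mcs b" using assms succs_mcs by auto
    ultimately show False using mcs_Neg[OF ma f(1)] mcs_Neg[OF mb f(2)] p[OF ma] p[OF mb] assms by blast
  qed
  then obtain u where u: "u \<in> succs w" "Or (BoxStar ?p) (BoxStar ?q) \<notin> u"
    using mcs_Box[OF assms(2), of "Or (BoxStar ?p) (BoxStar ?q)"] f by auto
  have mu: "mcs u" using u succs_mcs by auto
  have "BoxStar ?p \<notin> u" "BoxStar ?q \<notin> u"
    using u mcs_Or[OF mu, of "BoxStar ?p" "BoxStar ?q"] f by auto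
  then obtain x y where xy: "x \<in> insert u (succs u)" "?p \<notin> x" "y \<in> insert u (succs u)" "?q \<notin> y"
    using mcs_BoxStar[OF mu] f by meson
  then have "\<not> P x" "P y" using p succs_mcs mu by blast+
  then show ?thesis using that[OF u(1)] xy by (cases "P u") auto
qed

section \<open>Dissecting metric spaces\<close>

lemma separated_net:
  fixes H :: "'a::metric_space set"
  assumes "0 < e"
  obtains C where "C \<subseteq> H" "\<And>x y. x \<in> C \<Longrightarrow> y \<in> C \<Longrightarrow> x \<noteq> y \<Longrightarrow> e \<le> dist x y"
    "\<And>z. z \<in> H \<Longrightarrow> \<exists>x\<in>C. dist z x < e"
proof -
  let ?A = "{C. C \<subseteq> H \<and> (\<forall>x\<in>C. \<forall>y\<in>C. x \<noteq> y \<longrightarrow> e \<le> dist x y)}"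
  have "\<exists>M\<in>?A. \<forall>X\<in>?A. M \<subseteq> X \<longrightarrow> X = M"
  proof (rule subset_Zorn_nonempty)
    have "{} \<in> ?A" by simp
    then show "?A \<noteq> {}" by (metis empty_iff)
    fix \<C> assume ne: "\<C> \<noteq> {}" and ch: "subset.chain ?A \<C>"
    have "e \<le> dist x y" if "x \<in> \<Union>\<C>" "y \<in> \<Union>\<C>" "x \<noteq> y" for x y
    proof -
      have "finite {x, y}" "{x, y} \<subseteq> \<Union>\<C>" using that by auto
      then obtain X where "X \<in> \<C>" "{x, y} \<subseteq> X"
        using finite_subset_Union_chain[OF _ _ ne ch, of "{x, y}"] by auto
      then show ?thesis using ch that(3) by (auto simp: subset.chain_def)
    qed
    then show "\<Union>\<C> \<in> ?A" using ch by (auto simp: subset.chain_def)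
  qed
  then obtain C where "C \<in> ?A" and max: "\<forall>X\<in>?A. C \<subseteq> X \<longrightarrow> X = C" by (rule bexE)
  then have C: "C \<subseteq> H" "\<And>x y. x \<in> C \<Longrightarrow> y \<in> C \<Longrightarrow> x \<noteq> y \<Longrightarrow> e \<le> dist x y" by auto
  have "\<exists>x\<in>C. dist z x < e" if z: "z \<in> H" for z
  proof (rule ccontr)
    assume "\<not> ?thesis"
    then have far: "e \<le> dist z x" "e \<le> dist x z" if "x \<in> C" for x
      using that by (auto simp: not_less dist_commute)
    then have "insert z C \<in> ?A" using C z by auto
    from mp[OF bspec[OF max this] subset_insertI] have "z \<in> C" by (rule subst) (rule insertI1)
    then show False using far[of z] assms by simp
  qed
  with C show ?thesis by (rule that)
qed

text \<open>If the ball about \<open>z\<close> met two of the sets, their centres would be joined by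
  four segments of length at most \<open>e / 4\<close>, two of them strictly shorter.\<close>

lemma separated_locally_finite:
  fixes C :: "'a::metric_space set"
  assumes "\<And>x y. x \<in> C \<Longrightarrow> y \<in> C \<Longrightarrow> x \<noteq> y \<Longrightarrow> e \<le> dist x y"
    and "\<And>x. x \<in> C \<Longrightarrow> F x \<subseteq> cball x (e / 4)"
  shows "\<exists>x. \<forall>y\<in>C. y \<noteq> x \<longrightarrow> F y \<inter> ball z (e / 4) = {}"
proof (rule ccontr)
  assume "\<not> ?thesis"
  then have ex: "\<exists>y\<in>C. y \<noteq> x \<and> F y \<inter> ball z (e / 4) \<noteq> {}" for x by blast
  then obtain a p where a: "a \<in> C" "p \<in> F a" "p \<in> ball z (e / 4)" by blast
  obtain b q where b: "b \<in> C" "b \<noteq> a" "q \<in> F b" "q \<in> ball z (e / 4)" using ex[of a] by blast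
  have "dist a p \<le> e / 4" "dist b q \<le> e / 4" using a b assms(2) by force+
  moreover have "dist z p < e / 4" "dist z q < e / 4" using a b by auto
  moreover have "dist a b \<le> dist a p + (dist z p + (dist z q + dist b q))"
    by (smt (verit) dist_commute dist_triangle)
  ultimately show False using assms(1)[OF a(1) b(1)] b(2) by simp
qed

text \<open>One round of the dissection: disjoint cells, balls or single points as \<open>b\<close>
  prescribes, are cut out of \<open>H\<close> around a net. The remainder stays open, so that the
  next round can start, and a point of the closure leaves the closure only by falling into the
  interior of a cell.\<close>

lemma dissection_step:
  fixes H :: "'a::metric_space set"
  assumes "open H" "0 < e"
  shows "\<exists>C F. C \<subseteq> H \<and>
    (\<forall>x\<in>C. closed (F x) \<and> x \<in> F x \<and> F x \<subseteq> H \<and> (if b then x \<in> interior (F x) else F x = {x})) \<and>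
    (\<forall>x\<in>C. \<forall>y\<in>C. x \<noteq> y \<longrightarrow> F x \<inter> F y = {}) \<and>
    open (H - (\<Union>x\<in>C. F x)) \<and>
    (\<forall>z\<in>closure H. (\<forall>x\<in>C. z \<notin> interior (F x)) \<longrightarrow> z \<in> closure (H - (\<Union>x\<in>C. F x))) \<and>
    (\<forall>z\<in>closure H. \<exists>x\<in>C. dist z x < e)"
proof -
  have e2: "0 < e / 2" using assms by simp
  obtain C where C: "C \<subseteq> H" "\<And>x y. x \<in> C \<Longrightarrow> y \<in> C \<Longrightarrow> x \<noteq> y \<Longrightarrow> e / 2 \<le> dist x y"
    "\<And>z. z \<in> H \<Longrightarrow> \<exists>x\<in>C. dist z x < e / 2"
    using separated_net[OF e2] by metis
  \<comment> \<open>The net is \<open>e / 2\<close>-separated, so local finiteness asks for radii at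
    most \<open>e / 8\<close>, which \<open>e / 9\<close> respects.\<close>
  have "\<exists>r. 0 < r \<and> r \<le> e / 9 \<and> cball x r \<subseteq> H" if x: "x \<in> C" for x
  proof -
    obtain s where "0 < s" "cball x s \<subseteq> H"
      using assms(1) C(1) x by (meson open_contains_cball subsetD)
    then show ?thesis using assms(2) by (intro exI[of _ "min s (e / 9)"]) auto
  qed
  then obtain r where r: "\<And>x. x \<in> C \<Longrightarrow> 0 < r x \<and> r x \<le> e / 9 \<and> cball x (r x) \<subseteq> H" by metis
  define F where "F x = (if b then cball x (r x) else {x})" for x
  have F: "closed (F x)" "x \<in> F x" "F x \<subseteq> H" "if b then x \<in> interior (F x) else F x = {x}"
    "F x \<subseteq> cball x (e / 2 / 4)" if x: "x \<in> C" for x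
  proof -
    show "F x \<subseteq> cball x (e / 2 / 4)" using r[OF x] assms(2) by (auto simp: F_def)
    have "x \<in> interior (cball x (r x))"
      using r[OF x] by (intro interiorI[of "ball x (r x)"]) auto
    then show "closed (F x)" "x \<in> F x" "F x \<subseteq> H" "if b then x \<in> interior (F x) else F x = {x}"
      using r[OF x] C(1) x by (auto simp: F_def)
  qed
  note lf = separated_locally_finite[of C "e / 2" F, OF C(2) F(5)]
  have disj: "F x \<inter> F y = {}" if "x \<in> C" "y \<in> C" "x \<noteq> y" for x y
  proof (rule ccontr)
    assume "F x \<inter> F y \<noteq> {}"
    then obtain p where "p \<in> F x" "p \<in> F y" by blast
    then have "dist x p \<le> e / 2 / 4" "dist y p \<le> e / 2 / 4" using F(5) that by force+
    then show False using C(2)[OF that] dist_triangle2[of x y p] assms(2) by simp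
  qed
  have cl: "closed (\<Union>x\<in>C. F x)"
    unfolding closed_def open_contains_ball
  proof (intro ballI)
    fix z assume z: "z \<in> - (\<Union>x\<in>C. F x)"
    obtain x where x: "\<forall>y\<in>C. y \<noteq> x \<longrightarrow> F y \<inter> ball z (e / 2 / 4) = {}" using lf by blast
    show "\<exists>\<epsilon>>0. ball z \<epsilon> \<subseteq> - (\<Union>x\<in>C. F x)"
    proof (cases "x \<in> C")
      case True
      then have "open (- F x)" "z \<in> - F x" using F(1) z by auto
      then obtain d where "0 < d" "ball z d \<subseteq> - F x" by (meson open_contains_ball)
      moreover have "y \<notin> ball z (min d (e / 2 / 4))" if "a \<in> C" "y \<in> F a" for a y
        using \<open>ball z d \<subseteq> - F x\<close> x that by (cases "a = x") (auto simp: disjoint_iff)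
      ultimately show ?thesis using assms(2) by (intro exI[of _ "min d (e / 2 / 4)"]) auto
    next
      case False
      then show ?thesis using x assms(2) by (intro exI[of _ "e / 2 / 4"]) auto
    qed
  qed
  have "z \<in> closure (H - (\<Union>x\<in>C. F x))"
    if z: "z \<in> closure H" "\<forall>x\<in>C. z \<notin> interior (F x)" for z
    unfolding closure_iff_nhds_not_empty
  proof safe
    fix A N assume N: "N \<subseteq> A" "open N" "z \<in> N" and e: "(H - (\<Union>x\<in>C. F x)) \<inter> A = {}"
    obtain x where x: "\<forall>y\<in>C. y \<noteq> x \<longrightarrow> F y \<inter> ball z (e / 2 / 4) = {}" using lf by blast
    let ?N = "N \<inter> ball z (e / 2 / 4)"
    have N': "open ?N" "z \<in> ?N" using N assms(2) by auto
    have meet: "A \<inter> H \<noteq> {}" if "open A" "z \<in> A" for A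
      using open_Int_closure_eq_empty[OF that(1), of H] that(2) z(1) by blast
    \<comment> \<open>Near \<open>z\<close> only the cell of \<open>x\<close> can interfere. It
      cannot swallow \<open>?N \<inter> H\<close> if \<open>z\<close> lies in \<open>H\<close>, as
      \<open>z\<close> would be interior to it; otherwise it is a closed set missing
      \<open>z\<close>.\<close>
    have "\<exists>p\<in>?N. p \<in> H \<and> (x \<in> C \<longrightarrow> p \<notin> F x)"
    proof (cases "x \<in> C")
      case False
      then show ?thesis using meet[OF N'] by blast
    next
      case True
      show ?thesis
      proof (cases "z \<in> H")
        case zH: True
        then have "\<not> ?N \<inter> H \<subseteq> F x"
          
          using z(2) True N'(2) interior_maximal[OF _ open_Int[OF N'(1) assms(1)], of "F x"] by blast
        then show ?thesis by auto
      next
        case False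
        then have "z \<in> ?N \<inter> - F x" "open (?N \<inter> - F x)" using F True N' by auto
        then have "?N \<inter> - F x \<inter> H \<noteq> {}" using meet by blast
        then show ?thesis by auto
      qed
    qed
    then obtain p where "p \<in> ?N" "p \<in> H" "x \<in> C \<longrightarrow> p \<notin> F x" by blast
    moreover then have "p \<notin> F y" if "y \<in> C" for y using x that by (cases "y = x") (auto simp: disjoint_iff)
    ultimately show False using e N(1) by auto
  qed
  moreover have "\<exists>x\<in>C. dist z x < e" if z: "z \<in> closure H" for z
  proof -
    obtain y where y: "y \<in> H" "dist y z < e / 2" using z e2 closure_approachable by blast
    obtain x where "x \<in> C" "dist y x < e / 2" using C(3) y by blast
    then show ?thesis using y dist_triangle3[of z x y] by (intro bexI[of _ x]) auto
  qed
  ultimately show ?thesis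
    using C(1) F disj assms(1) cl open_Diff by (intro exI[of _ C] exI[of _ F]) auto
qed

text \<open>The rounds get finer, and a point outside all cell interiors remains in the closure of
  what is left after every round. So each later round has a centre close to it, and rounds taken
  from any infinite set \<open>N\<close> suffice.\<close>

lemma dissection:
  fixes G :: "'a::metric_space set" and b :: "nat \<Rightarrow> bool"
  assumes "open G"
  obtains C F where
    "\<And>n x. x \<in> C n \<Longrightarrow> x \<in> F n x \<and> F n x \<subseteq> G"
    "\<And>n x. x \<in> C n \<Longrightarrow> b n \<Longrightarrow> x \<in> interior (F n x)"
    "\<And>n x. x \<in> C n \<Longrightarrow> \<not> b n \<Longrightarrow> F n x = {x}"
    "\<And>n x m y. x \<in> C n \<Longrightarrow> y \<in> C m \<Longrightarrow> F n x \<inter> F m y \<noteq> {} \<Longrightarrow> n = m \<and> x = y"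
    "\<And>z N. z \<in> closure G \<Longrightarrow> (\<And>n x. x \<in> C n \<Longrightarrow> z \<notin> interior (F n x)) \<Longrightarrow> infinite N \<Longrightarrow>
      z islimpt (\<Union>n\<in>N. C n)"
proof -
  define S where "S H e b C F \<longleftrightarrow> C \<subseteq> H \<and>
    (\<forall>x\<in>C. closed (F x) \<and> x \<in> F x \<and> F x \<subseteq> H \<and> (if b then x \<in> interior (F x) else F x = {x})) \<and>
    (\<forall>x\<in>C. \<forall>y\<in>C. x \<noteq> y \<longrightarrow> F x \<inter> F y = {}) \<and>
    open (H - (\<Union>x\<in>C. F x)) \<and>
    (\<forall>z\<in>closure H. (\<forall>x\<in>C. z \<notin> interior (F x)) \<longrightarrow> z \<in> closure (H - (\<Union>x\<in>C. F x))) \<and>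
    (\<forall>z\<in>closure H. \<exists>x\<in>C. dist z x < e)"
    for H :: "'a set" and e :: real and b :: bool and C :: "'a set" and F :: "'a \<Rightarrow> 'a set"
  have "\<exists>C F. open H \<and> 0 < e \<longrightarrow> S H e b C F" for H e b
  proof (cases "open H \<and> 0 < e")
    case True
    then have "open H" "0 < e" by auto
    from dissection_step[OF this, of b] show ?thesis
      unfolding S_def by (elim exE) (intro exI impI, assumption)
  qed blast
  then obtain c f where cf: "\<And>H e b. open H \<Longrightarrow> 0 < e \<Longrightarrow> S H e b (c H e b) (f H e b)"
    by metis
  define e where "e n = inverse (real (Suc n))" for n
  define H where "H = rec_nat G (\<lambda>n H. H - (\<Union>x\<in>c H (e n) (b n). f H (e n) (b n) x))"
  define C where "C n = c (H n) (e n) (b n)" for n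
  define F where "F n = f (H n) (e n) (b n)" for n
  have H0: "H 0 = G" and HS: "H (Suc n) = H n - (\<Union>x\<in>C n. F n x)" for n
    by (simp_all add: H_def C_def F_def)
  have e: "0 < e n" for n by (simp add: e_def)
  have S: "open (H n) \<and> S (H n) (e n) (b n) (C n) (F n)" for n
  proof (induction n)
    case 0
    show ?case using cf[OF assms e] by (simp add: C_def F_def H0 assms)
  next
    case (Suc n)
    then have "open (H (Suc n))" by (simp add: HS S_def)
    then show ?case using cf[OF _ e] by (simp add: C_def F_def)
  qed
  have dec: "H m \<subseteq> H n" if "n \<le> m" for n m
    using that by (induction rule: dec_induct) (auto simp: HS)
  have FH: "F n x \<subseteq> H n" "x \<in> F n x" if "x \<in> C n" for n x
    using S[of n] that by (auto simp: S_def)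
  have lt: "F n x \<inter> F m y = {}" if "x \<in> C n" "y \<in> C m" "n < m" for n m x y
  proof -
    have "F m y \<subseteq> H (Suc n)" using FH(1)[OF that(2)] dec[of "Suc n" m] that(3) by auto
    then show ?thesis using that(1) by (auto simp: HS)
  qed
  have disj: "n = m \<and> x = y" if "x \<in> C n" "y \<in> C m" "F n x \<inter> F m y \<noteq> {}" for n m x y
  proof -
    have "n = m" using that lt[of x n y m] lt[of y m x n] by (cases n m rule: linorder_cases) auto
    then show ?thesis using that S[of n] unfolding S_def by blast
  qed
  have lim: "z islimpt (\<Union>n\<in>N. C n)"
    if z: "z \<in> closure G" "\<And>n x. x \<in> C n \<Longrightarrow> z \<notin> interior (F n x)" and N: "infinite N" for z N
    unfolding islimpt_approachable
  proof (intro allI impI)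
    fix d :: real assume "0 < d"
    have clH: "z \<in> closure (H n)" for n
    proof (induction n)
      case 0
      show ?case using z by (simp add: H0)
    next
      case (Suc n)
      then show ?case using S[of n] z(2) unfolding S_def HS by blast
    qed
    obtain k where k: "inverse (real (Suc k)) < d" using reals_Archimedean[OF \<open>0 < d\<close>] by blast
    have near: "\<exists>x\<in>C n. dist z x < d" if "k \<le> n" for n
    proof -
      have "e n \<le> inverse (real (Suc k))" using that by (simp add: e_def field_simps)
      moreover obtain x where "x \<in> C n" "dist z x < e n" using S[of n] clH[of n] unfolding S_def by blast
      ultimately show ?thesis using k by (intro bexI[of _ x]) auto
    qed
    obtain n where n: "n \<in> N" "k < n" using N infinite_nat_iff_unbounded by blast
    obtain m where m: "m \<in> N" "n < m" using N infinite_nat_iff_unbounded by blast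
    obtain x where x: "x \<in> C n" "dist z x < d" using near[of n] n by auto
    obtain y where y: "y \<in> C m" "dist z y < d" using near[of m] m n by auto
    \<comment> \<open>One of the centres could be \<open>z\<close> itself. Two different rounds are
      used because their cells, hence their centres, are disjoint.\<close>
    have "x \<noteq> z \<or> y \<noteq> z" using lt[OF x(1) y(1) m(2)] FH(2) x(1) y(1) by blast
    then show "\<exists>x'\<in>\<Union>n\<in>N. C n. x' \<noteq> z \<and> dist x' z < d"
      using x y n m by (auto simp: dist_commute)
  qed
  show ?thesis
  proof (rule that[of C F])
    show "x \<in> F n x \<and> F n x \<subseteq> G" if "x \<in> C n" for n x
      using FH[OF that] dec[of 0 n] by (auto simp: H0)
    show "x \<in> interior (F n x)" if "x \<in> C n" "b n" for n x using S[of n] that by (auto simp: S_def)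
    show "F n x = {x}" if "x \<in> C n" "\<not> b n" for n x using S[of n] that by (auto simp: S_def)
  qed (use disj lim in auto)
qed

section \<open>Nested neighbourhoods shrinking to a point\<close>

lemma perfect_near_point:
  fixes y :: "'a::{metric_space, perfect_space}"
  assumes "open V" "y \<in> V"
  obtains p where "p \<in> V" "p \<noteq> y"
  using islimpt_UNIV[of y] assms unfolding islimpt_def by blast

text \<open>The closure of an open ball is taken because it is regular closed, which a closed ball
  of a metric space need not be. This lets every border point be approached from inside. The radius
  stays below the distance to a second point of \<open>V\<close>, so that the shell
  \<open>V - F\<close> is not empty.\<close>

lemma shell_step:
  fixes y :: "'a::{metric_space, perfect_space}"
  assumes "open V" "y \<in> V" "0 < e"
  shows "\<exists>F. closed F \<and> F = closure (interior F) \<and> y \<in> interior F \<and> F \<subseteq> V \<and> F \<subseteq> cball y e \<and> V - F \<noteq> {}"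
proof -
  obtain p where p: "p \<in> V" "p \<noteq> y" using perfect_near_point[OF assms(1,2)] by blast
  obtain s where s: "0 < s" "cball y s \<subseteq> V" using assms by (meson open_contains_cball)
  define r where "r = min s (min e (dist y p / 2))"
  have r: "0 < r" "r \<le> s" "r \<le> e" "r < dist y p" using s p assms(3) by (auto simp: r_def min_def)
  let ?F = "closure (ball y r)"
  have sub: "?F \<subseteq> cball y r" by (rule closure_minimal) auto
  have int: "ball y r \<subseteq> interior ?F" by (intro interior_maximal closure_subset) auto
  have "?F = closure (interior ?F)"
  proof
    show "?F \<subseteq> closure (interior ?F)" using closure_mono[OF int] .
    show "closure (interior ?F) \<subseteq> ?F" by (rule closure_minimal[OF interior_subset]) simp
  qed
  moreover have "y \<in> interior ?F" using int r by auto
  moreover have "?F \<subseteq> V" "?F \<subseteq> cball y e" 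
    using sub s(2) r(2,3) by (fastforce simp: subset_iff)+
  moreover have "p \<in> V - ?F" using p sub r(4) by auto
  ultimately show ?thesis by blast
qed

lemma nested_neighbourhoods:
  fixes y :: "'a::{metric_space, perfect_space}"
  assumes "open G" "y \<in> G"
  obtains V F :: "nat \<Rightarrow> 'a set" where
    "V 0 = G" "\<And>k. open (V k)" "\<And>k. y \<in> V k" "\<And>k. closed (F k)" "\<And>k. F k \<subseteq> V k"
    "\<And>k. V (Suc k) = interior (F k)" "\<And>k. F k = closure (V (Suc k))" "\<And>k. V k - F k \<noteq> {}"
    "\<And>N. open N \<Longrightarrow> y \<in> N \<Longrightarrow> \<exists>k. \<forall>j\<ge>k. V j \<subseteq> N"
proof -
  have "\<forall>V e. \<exists>F. open V \<and> y \<in> V \<and> 0 < e \<longrightarrow> closed F \<and> F = closure (interior F) \<and>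
    y \<in> interior F \<and> F \<subseteq> V \<and> F \<subseteq> cball y e \<and> V - F \<noteq> {}"
    using shell_step by metis
  then obtain f where f: "\<And>V e. open V \<Longrightarrow> y \<in> V \<Longrightarrow> 0 < e \<Longrightarrow> closed (f V e) \<and>
     f V e = closure (interior (f V e)) \<and> y \<in> interior (f V e) \<and> f V e \<subseteq> V \<and> f V e \<subseteq> cball y e \<and>
     V - f V e \<noteq> {}"
    by metis
  define e where "e n = inverse (real (Suc n))" for n
  have e: "0 < e n" for n by (simp add: e_def)
  define V where "V = rec_nat G (\<lambda>n V. interior (f V (e n)))"
  define F where "F n = f (V n) (e n)" for n
  have V0: "V 0 = G" and VS: "V (Suc n) = interior (F n)" for n
    by (simp_all add: V_def F_def)
  have V: "open (V n) \<and> y \<in> V n" for n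
  proof (induction n)
    case (Suc n)
    then show ?case using f[of "V n" "e n"] e by (simp add: VS F_def)
  qed (simp add: V0 assms)
  have F: "closed (F n)" "F n = closure (interior (F n))" "F n \<subseteq> V n" "F n \<subseteq> cball y (e n)"
    "V n - F n \<noteq> {}" for n
    using f[of "V n" "e n"] V[of n] e by (auto simp: F_def)
  have dec: "V m \<subseteq> V n" if "n \<le> m" for n m
    using that
  proof (induction rule: dec_induct)
    case (step m)
    then show ?case using interior_subset[of "F m"] F(3)[of m] by (auto simp: VS)
  qed simp
  have shrink: "\<exists>k. \<forall>j\<ge>k. V j \<subseteq> N" if N: "open N" "y \<in> N" for N
  proof -
    obtain d where d: "0 < d" "ball y d \<subseteq> N" using openE[OF N] by blast
    obtain k where k: "inverse (real (Suc k)) < d" using reals_Archimedean[OF d(1)] by blast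
    have "V (Suc k) \<subseteq> ball y d"
      using interior_subset[of "F k"] F(4)[of k] k by (force simp: VS e_def)
    then show ?thesis using dec d(2) by (intro exI[of _ "Suc k"]) (meson order_trans)
  qed
  show ?thesis
  proof (rule that[of V F])
    show "F k = closure (V (Suc k))" for k using F(2)[of k] by (simp only: VS)
  qed (use V0 V F(1,3,5) VS shrink in blast)+
qed

section \<open>Labellings and cores\<close>

lemma islimpt_cong_open:
  assumes "open N" "z \<in> N" "A \<inter> N - {z} = B \<inter> N - {z}"
  shows "z islimpt A \<longleftrightarrow> z islimpt B"
proof -
  have "z islimpt B" if AB: "A \<inter> N - {z} = B \<inter> N - {z}" and lim: "z islimpt A" for A B
  proof (rule islimptI)
    fix T assume "z \<in> T" "open T"
    then obtain y where "y \<in> A" "y \<in> T \<inter> N" "y \<noteq> z"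
      using islimptE[OF lim, of "T \<inter> N"] assms(1,2) by blast
    then show "\<exists>y\<in>B. y \<in> T \<and> y \<noteq> z" using AB by blast
  qed
  from this[OF assms(3)] this[OF assms(3)[symmetric]] show ?thesis by blast
qed

lemma islimpt_finite_UN: "finite I \<Longrightarrow> z islimpt (\<Union>i\<in>I. A i) \<longleftrightarrow> (\<exists>i\<in>I. z islimpt A i)"
  by (induction I rule: finite_induct) (auto simp: islimpt_Un islimpt_EMPTY)

lemma truth_set_Box_islimpt: "x \<in> truth_set h (Box \<phi>) \<longleftrightarrow> \<not> x islimpt (- truth_set h \<phi>)"
  by (auto simp: islimpt_def)

lemma truth_set_Tangle_islimpt:
  "x \<in> truth_set h (Tangle \<Delta>) \<longleftrightarrow>
    (\<exists>S. x \<in> S \<and> (\<forall>y\<in>S. \<forall>\<delta>\<in>fset \<Delta>. y islimpt (truth_set h \<delta> \<inter> S)))"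
  unfolding truth_set_Tangle derived_def by auto

text \<open>Every witnessing set is contained in the truth set of the tangle.\<close>

lemma truth_set_Tangle_unfold:
  assumes "x \<in> truth_set h (Tangle \<Delta>)" "\<delta> \<in> fset \<Delta>"
  shows "x islimpt (truth_set h \<delta> \<inter> truth_set h (Tangle \<Delta>))"
proof -
  obtain S where S: "x \<in> S" "\<And>y \<delta>. y \<in> S \<Longrightarrow> \<delta> \<in> fset \<Delta> \<Longrightarrow> y islimpt (truth_set h \<delta> \<inter> S)"
    using assms(1) unfolding truth_set_Tangle_islimpt by blast
  then have "y \<in> truth_set h (Tangle \<Delta>)" if "y \<in> S" for y
    unfolding truth_set_Tangle_islimpt using that by (intro exI[of _ S]) simp
  then have "truth_set h \<delta> \<inter> S \<subseteq> truth_set h \<delta> \<inter> truth_set h (Tangle \<Delta>)" by (intro Int_mono) auto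
  then show ?thesis using S(2)[OF S(1) assms(2)] by (rule islimpt_subset[rotated])
qed

text \<open>Labellings are assembled from pieces on open sets; locality lets the correctness of a
  piece survive. A tangle witness is simply cut down to \<open>G\<close>.\<close>

lemma truth_set_local:
  assumes "open G" "\<And>p. h p \<inter> G = h' p \<inter> G"
  shows "truth_set h \<phi> \<inter> G = truth_set h' \<phi> \<inter> G"
proof (induction \<phi>)
  case (Box \<phi>)
  have eq: "x islimpt (- truth_set h \<phi>) \<longleftrightarrow> x islimpt (- truth_set h' \<phi>)" if "x \<in> G" for x
    by (rule islimpt_cong_open[OF assms(1) that]) (use Box in blast)
  show ?case
  proof (rule set_eqI)
    fix x
    show "x \<in> truth_set h (Box \<phi>) \<inter> G \<longleftrightarrow> x \<in> truth_set h' (Box \<phi>) \<inter> G"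
      by (cases "x \<in> G") (simp_all add: truth_set_Box_islimpt eq del: truth_set.simps)
  qed
next
  case (Tangle \<Delta>)
  have "x \<in> truth_set g' (Tangle \<Delta>)"
    if eq: "\<And>\<delta>. \<delta> \<in> fset \<Delta> \<Longrightarrow> truth_set g \<delta> \<inter> G = truth_set g' \<delta> \<inter> G"
      and x: "x \<in> truth_set g (Tangle \<Delta>)" "x \<in> G" for g g' x
  proof -
    obtain S where S: "x \<in> S" "\<And>y \<delta>. y \<in> S \<Longrightarrow> \<delta> \<in> fset \<Delta> \<Longrightarrow> y islimpt (truth_set g \<delta> \<inter> S)"
      using x(1) unfolding truth_set_Tangle_islimpt by blast
    have "y islimpt (truth_set g' \<delta> \<inter> (S \<inter> G))" if y: "y \<in> S \<inter> G" "\<delta> \<in> fset \<Delta>" for y \<delta>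
    proof -
      have "y islimpt (truth_set g \<delta> \<inter> S) \<longleftrightarrow> y islimpt (truth_set g' \<delta> \<inter> (S \<inter> G))"
        by (rule islimpt_cong_open[OF assms(1)]) (use y eq[OF y(2)] in blast)+
      then show ?thesis using S(2) y by blast
    qed
    then show ?thesis unfolding truth_set_Tangle_islimpt using S(1) x(2) by blast
  qed
  from this[of h h'] this[of h' h] Tangle show ?case by blast
qed (use assms(2) in auto)

section \<open>Correct labellings for a finite subformula-closed set\<close>

primrec parts :: "'v fm \<Rightarrow> 'v fm set" where
  "parts (Atom p) = {}"
| "parts Top = {}"
| "parts (Neg \<phi>) = {\<phi>}"
| "parts (And \<phi> \<psi>) = {\<phi>, \<psi>}"
| "parts (Box \<phi>) = {\<phi>}"
| "parts (Tangle \<Delta>) = fset \<Delta>"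

definition fclosed :: "'v fm set \<Rightarrow> bool" where
  "fclosed \<Phi> \<longleftrightarrow> finite \<Phi> \<and> \<Phi> \<subseteq> formulas \<and> (\<forall>\<phi>\<in>\<Phi>. parts \<phi> \<subseteq> \<Phi>)"

lemma fclosedD:
  assumes "fclosed \<Phi>"
  shows "finite \<Phi>" "\<phi> \<in> \<Phi> \<Longrightarrow> \<phi> \<in> formulas" "Neg \<phi> \<in> \<Phi> \<Longrightarrow> \<phi> \<in> \<Phi>"
    "And \<phi> \<psi> \<in> \<Phi> \<Longrightarrow> \<phi> \<in> \<Phi>" "And \<phi> \<psi> \<in> \<Phi> \<Longrightarrow> \<psi> \<in> \<Phi>" "Box \<phi> \<in> \<Phi> \<Longrightarrow> \<phi> \<in> \<Phi>"
    "Tangle \<Delta> \<in> \<Phi> \<Longrightarrow> \<delta> \<in> fset \<Delta> \<Longrightarrow> \<delta> \<in> \<Phi>" "Tangle \<Delta> \<in> \<Phi> \<Longrightarrow> \<exists>\<delta>. \<delta> \<in> fset \<Delta>"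
proof -
  have p: "\<eta> \<in> \<Phi>" if "\<phi> \<in> \<Phi>" "\<eta> \<in> parts \<phi>" for \<phi> \<eta>
    using assms that unfolding fclosed_def by blast
  show "finite \<Phi>" "\<phi> \<in> \<Phi> \<Longrightarrow> \<phi> \<in> formulas" using assms unfolding fclosed_def by blast+
  then show "Tangle \<Delta> \<in> \<Phi> \<Longrightarrow> \<exists>\<delta>. \<delta> \<in> fset \<Delta>"
    using assms formulas_simps(4)[of \<Delta>] unfolding fclosed_def by (metis ex_fin_conv subset_iff)
  show "Neg \<phi> \<in> \<Phi> \<Longrightarrow> \<phi> \<in> \<Phi>" "And \<phi> \<psi> \<in> \<Phi> \<Longrightarrow> \<phi> \<in> \<Phi>" "And \<phi> \<psi> \<in> \<Phi> \<Longrightarrow> \<psi> \<in> \<Phi>"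
    "Box \<phi> \<in> \<Phi> \<Longrightarrow> \<phi> \<in> \<Phi>" "Tangle \<Delta> \<in> \<Phi> \<Longrightarrow> \<delta> \<in> fset \<Delta> \<Longrightarrow> \<delta> \<in> \<Phi>"
    by (erule p, simp)+
qed

definition asg :: "('a \<Rightarrow> 'v fm set) \<Rightarrow> 'v \<Rightarrow> 'a set" where
  "asg \<rho> p = {x. Atom p \<in> \<rho> x}"

text \<open>The truth lemma on \<open>G\<close>. The labelling is total, but for open
  \<open>G\<close> its values elsewhere do not matter (\<open>good_cong\<close>).\<close>

definition good :: "'v fm set \<Rightarrow> ('a::topological_space \<Rightarrow> 'v fm set) \<Rightarrow> 'a set \<Rightarrow> bool" where
  "good \<Phi> \<rho> G \<longleftrightarrow> (\<forall>\<phi>\<in>\<Phi>. \<forall>x\<in>G. x \<in> truth_set (asg \<rho>) \<phi> \<longleftrightarrow> \<phi> \<in> \<rho> x)"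

lemma good_cong:
  assumes "open G" "\<And>x. x \<in> G \<Longrightarrow> \<rho> x = \<rho>' x" "good \<Phi> \<rho> G"
  shows "good \<Phi> \<rho>' G"
proof -
  have "asg \<rho> p \<inter> G = asg \<rho>' p \<inter> G" for p using assms(2) by (auto simp: asg_def)
  note truth_set_local[of G "asg \<rho>" "asg \<rho>'", OF assms(1) this]
  then have "x \<in> truth_set (asg \<rho>) \<phi> \<longleftrightarrow> x \<in> truth_set (asg \<rho>') \<phi>" if "x \<in> G" for x \<phi>
    using that by blast
  then show ?thesis using assms(2,3) unfolding good_def by simp
qed

lemma good_subset: "good \<Phi> \<rho> G \<Longrightarrow> \<Phi>' \<subseteq> \<Phi> \<Longrightarrow> G' \<subseteq> G \<Longrightarrow> good \<Phi>' \<rho> G'"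
  by (auto simp: good_def)

definition Up :: "'v fm set \<Rightarrow> 'v fm set \<Rightarrow> 'v fm set set" where
  "Up \<Phi> w = (\<lambda>u. u \<inter> \<Phi>) ` succs w"

lemma Up_I: "u \<in> succs w \<Longrightarrow> u \<inter> \<Phi> \<in> Up \<Phi> w"
  by (auto simp: Up_def)

lemma Up_mono: "mcs w \<Longrightarrow> u \<in> succs w \<Longrightarrow> Up \<Phi> u \<subseteq> Up \<Phi> w"
  by (auto simp: Up_def dest: succs_trans)

lemma Up_Pow: "Up \<Phi> w \<subseteq> Pow \<Phi>"
  by (auto simp: Up_def)

lemma finite_Up: "fclosed \<Phi> \<Longrightarrow> finite (Up \<Phi> w)"
  using finite_subset[OF Up_Pow] fclosedD(1) by blast

text \<open>The point \<open>z\<close> may lie outside \<open>G\<close>: this describes how a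
  labelled piece looks from its boundary, where other pieces are attached. The label of
  \<open>z\<close> itself is not seen.\<close>

definition exact :: "'v fm set \<Rightarrow> ('a::topological_space \<Rightarrow> 'v fm set) \<Rightarrow> 'a set \<Rightarrow> 'a \<Rightarrow> 'v fm set set \<Rightarrow> bool" where
  "exact \<Phi> \<rho> G z U \<longleftrightarrow> (\<forall>s. z islimpt {x \<in> G. \<rho> x \<inter> \<Phi> = s} \<longleftrightarrow> s \<in> U)"

lemma exact_cong:
  assumes "open N" "z \<in> N" "\<And>x. x \<in> N \<Longrightarrow> x \<noteq> z \<Longrightarrow> x \<in> G \<longleftrightarrow> x \<in> G'"
    "\<And>x. x \<in> N \<Longrightarrow> x \<noteq> z \<Longrightarrow> x \<in> G \<Longrightarrow> \<rho> x = \<rho>' x" "exact \<Phi> \<rho> G z U"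
  shows "exact \<Phi> \<rho>' G' z U"
proof -
  have "z islimpt {x \<in> G. \<rho> x \<inter> \<Phi> = s} \<longleftrightarrow> z islimpt {x \<in> G'. \<rho>' x \<inter> \<Phi> = s}" for s
    by (rule islimpt_cong_open[OF assms(1,2)]) (use assms(3,4) in auto)
  then show ?thesis using assms(5) by (auto simp: exact_def)
qed

text \<open>There are finitely many types, so the points of \<open>G\<close> satisfying
  \<open>Q\<close> form a finite union and a limit point of it is a limit point of one part.\<close>

lemma exact_islimpt:
  assumes "finite \<Phi>" "exact \<Phi> \<rho> G z U"
  shows "z islimpt {x \<in> G. Q (\<rho> x \<inter> \<Phi>)} \<longleftrightarrow> (\<exists>s\<in>U. Q s)"
proof -
  have "{x \<in> G. Q (\<rho> x \<inter> \<Phi>)} = (\<Union>s\<in>{s \<in> Pow \<Phi>. Q s}. {x \<in> G. \<rho> x \<inter> \<Phi> = s})" by auto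
  then have "z islimpt {x \<in> G. Q (\<rho> x \<inter> \<Phi>)} \<longleftrightarrow> (\<exists>s\<in>{s \<in> Pow \<Phi>. Q s}. s \<in> U)"
    using assms by (simp add: islimpt_finite_UN exact_def)
  moreover have "s \<subseteq> \<Phi>" if "s \<in> U" for s
  proof -
    have "z islimpt {x \<in> G. \<rho> x \<inter> \<Phi> = s}" using assms(2) that by (simp add: exact_def)
    then have "{x \<in> G. \<rho> x \<inter> \<Phi> = s} \<noteq> {}" by (metis islimpt_EMPTY)
    then show ?thesis by auto
  qed
  ultimately show ?thesis by blast
qed

lemma exact_nhd:
  assumes "finite \<Phi>" "exact \<Phi> \<rho> G z U"
  obtains N where "open N" "z \<in> N" "\<And>x. x \<in> G \<Longrightarrow> x \<in> N \<Longrightarrow> x \<noteq> z \<Longrightarrow> \<rho> x \<inter> \<Phi> \<in> U"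
proof -
  have "\<not> z islimpt {x \<in> G. \<rho> x \<inter> \<Phi> \<notin> U}"
    using exact_islimpt[OF assms, of "\<lambda>s. s \<notin> U"] by blast
  then show ?thesis unfolding islimpt_def using that by blast
qed

lemma exact_restrict:
  assumes "finite \<Phi>'" "\<Phi> \<subseteq> \<Phi>'" "exact \<Phi>' \<rho> G z U"
  shows "exact \<Phi> \<rho> G z ((\<lambda>t. t \<inter> \<Phi>) ` U)"
  unfolding exact_def
proof
  fix s
  have "\<rho> x \<inter> \<Phi>' \<inter> \<Phi> = \<rho> x \<inter> \<Phi>" for x using assms(2) by auto
  then show "z islimpt {x \<in> G. \<rho> x \<inter> \<Phi> = s} \<longleftrightarrow> s \<in> (\<lambda>t. t \<inter> \<Phi>) ` U"
    using exact_islimpt[OF assms(1,3), of "\<lambda>t. t \<inter> \<Phi> = s"] by auto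
qed

lemma exact_dense:
  assumes "\<And>x. x \<in> G \<Longrightarrow> \<rho> x \<inter> \<Phi> \<in> U" "\<And>s. s \<in> U \<Longrightarrow> z islimpt {x \<in> G. \<rho> x \<inter> \<Phi> = s}"
  shows "exact \<Phi> \<rho> G z U"
proof -
  have e: "{x \<in> G. \<rho> x \<inter> \<Phi> = s} = {}" if "s \<notin> U" for s using assms(1) that by auto
  have "z islimpt {x \<in> G. \<rho> x \<inter> \<Phi> = s} \<longleftrightarrow> s \<in> U" for s
    using assms(2) by (cases "s \<in> U") (simp_all add: e islimpt_EMPTY)
  then show ?thesis by (simp add: exact_def)
qed

lemma exact_Un: "exact \<Phi> \<rho> G z U \<Longrightarrow> exact \<Phi> \<rho> G' z U' \<Longrightarrow> exact \<Phi> \<rho> (G \<union> G') z (U \<union> U')"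
proof -
  have "{x \<in> G \<union> G'. \<rho> x \<inter> \<Phi> = s} = {x \<in> G. \<rho> x \<inter> \<Phi> = s} \<union> {x \<in> G'. \<rho> x \<inter> \<Phi> = s}" for s
    by auto
  then show "exact \<Phi> \<rho> G z U \<Longrightarrow> exact \<Phi> \<rho> G' z U' \<Longrightarrow> ?thesis"
    by (simp add: exact_def islimpt_Un)
qed

lemma exact_add:
  assumes "exact \<Phi> \<rho> G z U" "\<And>x. x \<in> G' \<Longrightarrow> \<rho> x \<inter> \<Phi> \<in> U"
  shows "exact \<Phi> \<rho> (G \<union> G') z U"
  unfolding exact_def
proof
  fix s
  have *: "{x \<in> G \<union> G'. \<rho> x \<inter> \<Phi> = s} = {x \<in> G. \<rho> x \<inter> \<Phi> = s} \<union> {x \<in> G'. \<rho> x \<inter> \<Phi> = s}"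
    by auto
  have e: "{x \<in> G'. \<rho> x \<inter> \<Phi> = s} = {}" if "s \<notin> U" using assms(2) that by auto
  show "z islimpt {x \<in> G \<union> G'. \<rho> x \<inter> \<Phi> = s} \<longleftrightarrow> s \<in> U"
    using assms(1) unfolding * islimpt_Un exact_def by (cases "s \<in> U") (simp_all add: e islimpt_EMPTY)
qed

text \<open>
  A tangle that fails at the label of \<open>z\<close> fails at \<open>z\<close>: near \<open>z\<close> the witnessing set would have to
  avoid \<open>G - Z\<close>, where truth and labels agree and no label contains the tangle, and inside \<open>Z\<close> some
  member of the tangle does not occur near \<open>z\<close>.
\<close>

lemma good_glue:
  assumes \<Phi>: "fclosed \<Phi>" and "open G" "Z \<subseteq> G" "open (G - Z)" "good \<Phi> \<rho> (G - Z)"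
    and m: "\<And>x. x \<in> G \<Longrightarrow> mcs (\<rho> x)"
    and ex: "\<And>z. z \<in> Z \<Longrightarrow> exact \<Phi> \<rho> G z (Up \<Phi> (\<rho> z))"
    and tang: "\<And>z \<Delta>. z \<in> Z \<Longrightarrow> Tangle \<Delta> \<in> \<Phi> \<Longrightarrow> Tangle \<Delta> \<notin> \<rho> z \<Longrightarrow>
      \<exists>\<delta>\<in>fset \<Delta>. \<exists>N. open N \<and> z \<in> N \<and> (\<forall>y\<in>Z \<inter> N - {z}. \<delta> \<notin> \<rho> y)"
  shows "good \<Phi> \<rho> G"
proof -
  let ?T = "truth_set (asg \<rho>)"
  note fc = fclosedD[OF \<Phi>]
  have out: "x \<in> ?T \<phi> \<longleftrightarrow> \<phi> \<in> \<rho> x" if "x \<in> G - Z" "\<phi> \<in> \<Phi>" for x \<phi>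
    using assms(5) that by (auto simp: good_def)
  have "\<phi> \<in> \<Phi> \<longrightarrow> (\<forall>x\<in>G. x \<in> ?T \<phi> \<longleftrightarrow> \<phi> \<in> \<rho> x)" for \<phi>
  proof (induction \<phi>)
    case (Atom p)
    then show ?case by (auto simp: asg_def)
  next
    case Top
    then show ?case by (auto simp: mcs_Top m)
  next
    case (Neg \<phi>)
    have "\<phi> \<in> \<Phi>" "\<phi> \<in> formulas" if "Neg \<phi> \<in> \<Phi>" using fc(2,3) that by blast+
    then show ?case using Neg by (auto simp: mcs_Neg m)
  next
    case (And \<phi> \<psi>)
    have "\<phi> \<in> \<Phi>" "\<phi> \<in> formulas" "\<psi> \<in> \<Phi>" "\<psi> \<in> formulas" if "And \<phi> \<psi> \<in> \<Phi>"
      using fc(2,4,5) that by blast+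
    then show ?case using And by (auto simp: mcs_And m)
  next
    case (Box \<phi>)
    show ?case
    proof (intro impI ballI)
      fix x assume B: "Box \<phi> \<in> \<Phi>" and x: "x \<in> G"
      show "x \<in> ?T (Box \<phi>) \<longleftrightarrow> Box \<phi> \<in> \<rho> x"
      proof (cases "x \<in> Z")
        case False
        then show ?thesis using out x B by blast
      next
        case True
        have "x islimpt (- ?T \<phi>) \<longleftrightarrow> x islimpt {y \<in> G. \<phi> \<notin> \<rho> y \<inter> \<Phi>}"
          by (rule islimpt_cong_open[OF assms(2) x]) (use Box fc(6)[OF B] in auto)
        also have "\<dots> \<longleftrightarrow> (\<exists>s\<in>Up \<Phi> (\<rho> x). \<phi> \<notin> s)"
          by (rule exact_islimpt[OF fc(1) ex[OF True]])
        also have "\<dots> \<longleftrightarrow> Box \<phi> \<notin> \<rho> x"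
          using mcs_Box[OF m[OF x], of \<phi>] fc(2)[OF fc(6)[OF B]] fc(6)[OF B] by (auto simp: Up_def)
        finally show ?thesis unfolding truth_set_Box_islimpt by blast
      qed
    qed
  next
    case (Tangle \<Delta>)
    let ?\<tau> = "Tangle \<Delta>"
    show ?case
    proof (intro impI ballI)
      fix x assume t: "?\<tau> \<in> \<Phi>" and x: "x \<in> G"
      have IH: "y \<in> ?T \<delta> \<longleftrightarrow> \<delta> \<in> \<rho> y" if "y \<in> G" "\<delta> \<in> fset \<Delta>" for y \<delta>
        using Tangle that fc(7)[OF t] by blast
      show "x \<in> ?T ?\<tau> \<longleftrightarrow> ?\<tau> \<in> \<rho> x"
      proof
        assume x\<tau>: "?\<tau> \<in> \<rho> x"
        \<comment> \<open>The labels containing the tangle form a witness: on \<open>Z\<close>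
          because Fix yields a suitable accumulating type, elsewhere because truth and labels
          already agree.\<close>
        let ?S = "{y \<in> G. ?\<tau> \<in> \<rho> y}"
        have "y islimpt (?T \<delta> \<inter> ?S)" if y: "y \<in> ?S" "\<delta> \<in> fset \<Delta>" for y \<delta>
        proof (cases "y \<in> Z")
          case True
          obtain u where u: "u \<in> succs (\<rho> y)" "\<delta> \<in> u" "?\<tau> \<in> u"
            using mcs_Fix[of "\<rho> y" \<Delta> \<delta>] m y by blast
          have "\<exists>s\<in>Up \<Phi> (\<rho> y). \<delta> \<in> s \<and> ?\<tau> \<in> s"
            using u fc(7)[OF t y(2)] t by (auto simp: Up_def)
          then have "y islimpt {z \<in> G. \<delta> \<in> \<rho> z \<inter> \<Phi> \<and> ?\<tau> \<in> \<rho> z \<inter> \<Phi>}"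
            using exact_islimpt[OF fc(1) ex[OF True], of "\<lambda>s. \<delta> \<in> s \<and> ?\<tau> \<in> s"] by blast
          then show ?thesis by (rule islimpt_subset) (use IH y in auto)
        next
          case False
          then have yo: "y \<in> G - Z" using y by auto
          then have "y \<in> ?T ?\<tau>" using out t y by blast
          then have "y islimpt (?T \<delta> \<inter> ?T ?\<tau>)" using truth_set_Tangle_unfold y(2) by blast
          then have "y islimpt (?T \<delta> \<inter> ?T ?\<tau> \<inter> (G - Z))"
            using islimpt_cong_open[OF assms(4) yo, of "?T \<delta> \<inter> ?T ?\<tau>" "?T \<delta> \<inter> ?T ?\<tau> \<inter> (G - Z)"]
            by blast
          then show ?thesis by (rule islimpt_subset) (use out[OF _ t] in blast)
        qed
        then show "x \<in> ?T ?\<tau>" unfolding truth_set_Tangle_islimpt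
          using x x\<tau> by (intro exI[of _ ?S]) simp
      next
        assume x\<tau>: "x \<in> ?T ?\<tau>"
        show "?\<tau> \<in> \<rho> x"
        proof (rule ccontr)
          assume n: "?\<tau> \<notin> \<rho> x"
          then have xZ: "x \<in> Z" using out x t x\<tau> by blast
          obtain \<delta> N where \<delta>: "\<delta> \<in> fset \<Delta>" and N: "open N" "x \<in> N" "\<forall>y\<in>Z \<inter> N - {x}. \<delta> \<notin> \<rho> y"
            using tang[OF xZ t n] by blast
          obtain M where M: "open M" "x \<in> M"
            "\<And>y. y \<in> G \<Longrightarrow> y \<in> M \<Longrightarrow> y \<noteq> x \<Longrightarrow> \<rho> y \<inter> \<Phi> \<in> Up \<Phi> (\<rho> x)"
            using exact_nhd[OF fc(1) ex[OF xZ]] by blast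
          have "?\<tau> \<notin> s" if "s \<in> Up \<Phi> (\<rho> x)" for s
            using mcs_Tangle_down[OF m[OF x]] n that by (auto simp: Up_def)
          then have no: "?\<tau> \<notin> \<rho> y" if "y \<in> G" "y \<in> M" "y \<noteq> x" for y using M(3)[OF that] t by blast
          have "x islimpt (?T \<delta> \<inter> ?T ?\<tau>)" using truth_set_Tangle_unfold x\<tau> \<delta> by blast
          then obtain y where y: "y \<in> ?T \<delta>" "y \<in> ?T ?\<tau>" "y \<in> N" "y \<in> M" "y \<in> G" "y \<noteq> x"
            using islimptE[of x _ "N \<inter> M \<inter> G"] N M x assms(2) by blast
          then have "y \<in> Z" using no out t by blast
          then show False using y IH[OF y(5) \<delta>] N(3) by blast
        qed
      qed
    qed
  qed
  then show ?thesis unfolding good_def by blast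
qed

text \<open>On a set of points all labelled \<open>b\<close>, a tangle absent from \<open>b\<close>
  is not witnessed, since one of its members occurs at none of them.\<close>

definition tangle_free :: "'v fm set \<Rightarrow> 'v fm set \<Rightarrow> bool" where
  "tangle_free \<Phi> b \<longleftrightarrow> (\<forall>\<Delta>. Tangle \<Delta> \<in> \<Phi> \<longrightarrow> Tangle \<Delta> \<notin> b \<longrightarrow> (\<exists>\<delta>\<in>fset \<Delta>. \<delta> \<notin> b))"

definition fillable :: "'a::topological_space itself \<Rightarrow> 'v fm set \<Rightarrow> 'v fm set set \<Rightarrow> bool" where
  "fillable X \<Phi> U \<longleftrightarrow> (\<forall>G::'a set. open G \<longrightarrow> (\<exists>\<rho>. good \<Phi> \<rho> G \<and>
    (\<forall>x\<in>G. mcs (\<rho> x) \<and> \<rho> x \<inter> \<Phi> \<in> U) \<and> (\<forall>z\<in>closure G - G. exact \<Phi> \<rho> G z U)))"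

text \<open>The boundary set \<open>U\<close> is independent of \<open>Up \<Phi> u\<close>: it may
  be a smaller core seen by \<open>u\<close>. The type of \<open>u\<close> is allowed in addition to
  \<open>Up \<Phi> u\<close>, as \<open>u\<close> need not see its own type.\<close>

definition insertable ::
    "'a::topological_space itself \<Rightarrow> 'v fm set \<Rightarrow> 'v fm set \<Rightarrow> 'v fm set set \<Rightarrow> bool" where
  "insertable X \<Phi> u U \<longleftrightarrow> (\<forall>(G::'a set) y. open G \<longrightarrow> y \<in> G \<longrightarrow> (\<exists>\<rho>. good \<Phi> \<rho> G \<and> \<rho> y = u \<and>
    (\<forall>x\<in>G. mcs (\<rho> x) \<and> \<rho> x \<inter> \<Phi> \<in> insert (u \<inter> \<Phi>) (Up \<Phi> u)) \<and>
    (\<forall>z\<in>closure G - G. exact \<Phi> \<rho> G z U)))"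

text \<open>The point \<open>b\<close> will label borders between shells: it sees exactly
  \<open>U\<close>, its own type does no harm at neighbouring border points, and a border labelled
  by it creates no tangle.\<close>

definition core :: "'a::topological_space itself \<Rightarrow> 'v fm set \<Rightarrow> 'v fm set set \<Rightarrow> bool" where
  "core X \<Phi> U \<longleftrightarrow> fillable X \<Phi> U \<and>
    (\<exists>b. mcs b \<and> Up \<Phi> b = U \<and> b \<inter> \<Phi> \<in> U \<and> tangle_free \<Phi> b)"

lemma closure_Diff_point:
  fixes G :: "'a::{metric_space, perfect_space} set"
  assumes "open G"
  shows "closure (G - {y}) = closure G"
proof
  show "closure (G - {y}) \<subseteq> closure G" by (intro closure_mono) auto
  have "z \<in> closure (G - {y})" if z: "z \<in> G" for z
  proof (cases "z = y")
    case True
    have "y islimpt UNIV" by (rule islimpt_UNIV)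
    then have "y islimpt (G - {y})"
      using islimpt_cong_open[OF assms, of y UNIV "G - {y}"] z True by auto
    then show ?thesis using True by (simp add: closure_def)
  next
    case False
    then show ?thesis using z subsetD[OF closure_subset, of z "G - {y}"] by simp
  qed
  then show "closure G \<subseteq> closure (G - {y})" by (intro closure_minimal) auto
qed

lemma good_insert_point:
  fixes G :: "'a::{metric_space, perfect_space} set"
  assumes \<Phi>: "fclosed \<Phi>" and "open G" "y \<in> G" "good \<Phi> \<rho> (G - {y})"
    and m: "\<And>x. x \<in> G \<Longrightarrow> mcs (\<rho> x)" and ex: "exact \<Phi> \<rho> G y (Up \<Phi> (\<rho> y))"
  shows "good \<Phi> \<rho> G"
proof (rule good_glue[OF \<Phi>, where Z = "{y}"])
  fix z \<Delta> assume "z \<in> {y}" "Tangle \<Delta> \<in> \<Phi>"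
  moreover then obtain \<delta> where "\<delta> \<in> fset \<Delta>" using fclosedD(8)[OF \<Phi>] by metis
  \<comment> \<open>With \<open>Z\<close> reduced to one point nothing else of \<open>Z\<close> is
    near, so any member of the tangle will do.\<close>
  ultimately show "\<exists>\<delta>\<in>fset \<Delta>. \<exists>N. open N \<and> z \<in> N \<and> (\<forall>x\<in>{y} \<inter> N - {z}. \<delta> \<notin> \<rho> x)"
    by (intro bexI[of _ \<delta>] exI[of _ UNIV]) auto
qed (use assms in auto)

lemma insertable_core:
  fixes X :: "'a::{metric_space, perfect_space} itself"
  assumes \<Phi>: "fclosed \<Phi>" and "core X \<Phi> (Up \<Phi> u)" "mcs u"
  shows "insertable X \<Phi> u (Up \<Phi> u)"
  unfolding insertable_def
proof (intro allI impI)
  fix G :: "'a set" and y assume G: "open G" "y \<in> G"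
  have o: "open (G - {y})" using G by (simp add: open_Diff)
  obtain \<rho> where \<rho>: "good \<Phi> \<rho> (G - {y})" "\<And>x. x \<in> G - {y} \<Longrightarrow> mcs (\<rho> x) \<and> \<rho> x \<inter> \<Phi> \<in> Up \<Phi> u"
    "\<And>z. z \<in> closure (G - {y}) - (G - {y}) \<Longrightarrow> exact \<Phi> \<rho> (G - {y}) z (Up \<Phi> u)"
    using assms(2) o unfolding core_def fillable_def by metis
  have ex: "exact \<Phi> (\<rho>(y := u)) G z (Up \<Phi> u)" if "z \<in> closure G - (G - {y})" for z
  proof (rule exact_cong)
    show "exact \<Phi> \<rho> (G - {y}) z (Up \<Phi> u)" using \<rho>(3) that by (simp add: closure_Diff_point G)
    \<comment> \<open>The change of label at \<open>y\<close> is not noticed at \<open>y\<close>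
      itself, and any other point has a neighbourhood avoiding \<open>y\<close>.\<close>
    show "open (if z = y then UNIV else - {y})" by auto
  qed (auto split: if_splits)
  have "good \<Phi> (\<rho>(y := u)) G"
  proof (rule good_insert_point[OF \<Phi> G])
    show "good \<Phi> (\<rho>(y := u)) (G - {y})" by (rule good_cong[OF o _ \<rho>(1)]) auto
    show "mcs ((\<rho>(y := u)) x)" if "x \<in> G" for x using \<rho>(2) assms(3) that by auto
    show "exact \<Phi> (\<rho>(y := u)) G y (Up \<Phi> ((\<rho>(y := u)) y))"
      using ex[of y] G closure_subset by auto
  qed
  then show "\<exists>\<rho>. good \<Phi> \<rho> G \<and> \<rho> y = u \<and>
      (\<forall>x\<in>G. mcs (\<rho> x) \<and> \<rho> x \<inter> \<Phi> \<in> insert (u \<inter> \<Phi>) (Up \<Phi> u)) \<and>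
      (\<forall>z\<in>closure G - G. exact \<Phi> \<rho> G z (Up \<Phi> u))"
    using \<rho>(2) assms(3) ex by (intro exI[of _ "\<rho>(y := u)"]) auto
qed

lemma repeating_enumeration:
  assumes "countable D" "D \<noteq> {}"
  obtains k :: "nat \<Rightarrow> 'b" where "\<And>n. k n \<in> D" "\<And>t. t \<in> D \<Longrightarrow> infinite {n. k n = t}"
proof -
  define k where "k n = from_nat_into D (fst (prod_decode n))" for n
  have "infinite {n. k n = t}" if t: "t \<in> D" for t
  proof -
    obtain i where i: "from_nat_into D i = t" using from_nat_into_surj[OF assms(1) t] by blast
    have "inj (\<lambda>j. prod_encode (i, j))" by (auto intro: injI)
    then have "infinite (range (\<lambda>j. prod_encode (i, j)))" by (simp add: finite_image_iff)
    moreover have "range (\<lambda>j. prod_encode (i, j)) \<subseteq> {n. k n = t}" by (auto simp: k_def i)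
    ultimately show ?thesis using finite_subset by blast
  qed
  moreover have "k n \<in> D" for n using assms by (simp add: k_def from_nat_into)
  ultimately show ?thesis using that by blast
qed

text \<open>Each round of a dissection is devoted to one type, every type recurring infinitely
  often, so all of \<open>U\<close> accumulates at every point outside the cell interiors. A type in
  \<open>B\<close> sits on bare points, where its label sees exactly \<open>U\<close>. A type
  outside \<open>B\<close> needs surroundings of its own and sits at the centre of a cell filled by
  \<open>insertable\<close>; since all of \<open>U\<close> accumulates at the border of the cell
  anyway, any boundary set \<open>V\<close> will do. The remaining points carry labels from
  \<open>B\<close> only, and \<open>tang\<close> refutes absent tangles among them.\<close>

lemma core_cluster:
  fixes X :: "'a::{metric_space, perfect_space} itself"
  assumes \<Phi>: "fclosed \<Phi>" and B: "B \<subseteq> U" "B \<noteq> {}"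
    and m: "\<And>t. t \<in> U \<Longrightarrow> mcs (m t) \<and> m t \<inter> \<Phi> = t"
    and mB: "\<And>t. t \<in> B \<Longrightarrow> Up \<Phi> (m t) = U"
    and mU: "\<And>t. t \<in> U - B \<Longrightarrow> Up \<Phi> (m t) \<subseteq> U \<and> (\<exists>V. insertable X \<Phi> (m t) V)"
    and tang: "\<And>\<Delta>. Tangle \<Delta> \<in> \<Phi> \<Longrightarrow> (\<forall>t\<in>U. Tangle \<Delta> \<notin> t) \<Longrightarrow> \<exists>\<delta>\<in>fset \<Delta>. \<forall>t\<in>B. \<delta> \<notin> t"
  shows "core X \<Phi> U"
  unfolding core_def
proof
  obtain c where c: "c \<in> B" using B by blast
  note fc = fclosedD[OF \<Phi>]
  have tB: "\<exists>\<delta>\<in>fset \<Delta>. \<forall>t\<in>B. \<delta> \<notin> m t" if t: "Tangle \<Delta> \<in> \<Phi>" "Tangle \<Delta> \<notin> m s" "s \<in> B" for \<Delta> s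
  proof -
    have "\<forall>t\<in>Up \<Phi> (m s). Tangle \<Delta> \<notin> t"
      using mcs_Tangle_down[of "m s"] m[of s] t B by (auto simp: Up_def)
    then obtain \<delta> where \<delta>: "\<delta> \<in> fset \<Delta>" "\<forall>t\<in>B. \<delta> \<notin> t" using tang[OF t(1)] mB[OF t(3)] by auto
    then have "\<delta> \<notin> m t" if "t \<in> B" for t using m[of t] that B fc(7)[OF t(1)] by auto
    then show ?thesis using \<delta> by blast
  qed
  have "tangle_free \<Phi> (m c)" unfolding tangle_free_def using tB[OF _ _ c] c by blast
  then show "\<exists>b. mcs b \<and> Up \<Phi> b = U \<and> b \<inter> \<Phi> \<in> U \<and> tangle_free \<Phi> b"
    using m[of c] mB[OF c] c B by auto
  show "fillable X \<Phi> U"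
    unfolding fillable_def
  proof (intro allI impI)
    fix G :: "'a set" assume G: "open G"
    have "U = Up \<Phi> (m c)" using mB c by simp
    then have "countable U" using finite_Up[OF \<Phi>] countable_finite by metis
    then obtain k where k: "\<And>n::nat. k n \<in> U" "\<And>t. t \<in> U \<Longrightarrow> infinite {n. k n = t}"
      using repeating_enumeration[of U] B by blast
    obtain C F where CF:
      "\<And>n x. x \<in> C n \<Longrightarrow> x \<in> F n x \<and> F n x \<subseteq> G"
      "\<And>n x. x \<in> C n \<Longrightarrow> k n \<notin> B \<Longrightarrow> x \<in> interior (F n x)"
      "\<And>n x. x \<in> C n \<Longrightarrow> \<not> k n \<notin> B \<Longrightarrow> F n x = {x}"
      "\<And>n x m y. x \<in> C n \<Longrightarrow> y \<in> C m \<Longrightarrow> F n x \<inter> F m y \<noteq> {} \<Longrightarrow> n = m \<and> x = y"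
      "\<And>z N. z \<in> closure G \<Longrightarrow> (\<And>n x. x \<in> C n \<Longrightarrow> z \<notin> interior (F n x)) \<Longrightarrow> infinite N \<Longrightarrow>
        z islimpt (\<Union>n\<in>N. C n)"
    proof (rule dissection[OF G, of "\<lambda>n. k n \<notin> B"], goal_cases)
      case (1 C F)
      from 1(2-) show ?case by (rule 1(1))
    qed
    have CG: "x \<in> G" if "x \<in> C n" for x n using CF(1)[OF that] by blast
    have "\<forall>n x. \<exists>\<rho>. x \<in> C n \<longrightarrow> k n \<notin> B \<longrightarrow> good \<Phi> \<rho> (interior (F n x)) \<and> \<rho> x = m (k n) \<and>
      (\<forall>z\<in>interior (F n x). mcs (\<rho> z) \<and> \<rho> z \<inter> \<Phi> \<in> U)"
    proof (intro allI)
      fix n x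
      show "\<exists>\<rho>. x \<in> C n \<longrightarrow> k n \<notin> B \<longrightarrow> good \<Phi> \<rho> (interior (F n x)) \<and> \<rho> x = m (k n) \<and>
        (\<forall>z\<in>interior (F n x). mcs (\<rho> z) \<and> \<rho> z \<inter> \<Phi> \<in> U)"
      proof (cases "x \<in> C n \<and> k n \<notin> B")
        case True
        then obtain V where "insertable X \<Phi> (m (k n)) V" and sub: "Up \<Phi> (m (k n)) \<subseteq> U"
          using mU k(1) by blast
        then obtain \<rho> where "good \<Phi> \<rho> (interior (F n x))" "\<rho> x = m (k n)"
          "\<forall>z\<in>interior (F n x). mcs (\<rho> z) \<and> \<rho> z \<inter> \<Phi> \<in> insert (m (k n) \<inter> \<Phi>) (Up \<Phi> (m (k n)))"
          using CF(2) True open_interior unfolding insertable_def by metis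
        then show ?thesis using sub m[OF k(1)[of n]] k(1)[of n] by (intro exI[of _ \<rho>]) auto
      qed blast
    qed
    then obtain r where r: "\<And>n x. x \<in> C n \<Longrightarrow> k n \<notin> B \<Longrightarrow> good \<Phi> (r n x) (interior (F n x)) \<and>
      r n x x = m (k n) \<and> (\<forall>z\<in>interior (F n x). mcs (r n x z) \<and> r n x z \<inter> \<Phi> \<in> U)"
      by metis
    define P where "P z n x \<longleftrightarrow> x \<in> C n \<and> k n \<notin> B \<and> z \<in> interior (F n x)" for z n x
    have uniq: "n' = n \<and> x' = x" if "P z n x" "P z n' x'" for z n x n' x'
      using that CF(4)[of x n x' n'] interior_subset unfolding P_def by blast
    \<comment> \<open>Points that are neither inside a cell nor a centre receive the default label
      \<open>m c\<close> from \<open>B\<close>.\<close>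
    define \<rho> where "\<rho> z = (if \<exists>n x. P z n x then
        (let n = SOME n. \<exists>x. P z n x; x = SOME x. P z n x in r n x z)
      else if \<exists>n. z \<in> C n then m (k (SOME n. z \<in> C n)) else m c)" for z
    have r1: "\<rho> z = r n x z" if "P z n x" for z n x
    proof -
      have "(SOME n. \<exists>x. P z n x) = n" by (rule some_equality) (use that uniq in blast)+
      moreover have "(SOME x. P z n x) = x" by (rule some_equality) (use that uniq in blast)+
      ultimately show ?thesis using that by (auto simp: \<rho>_def Let_def)
    qed
    have notP: "k n \<in> B" if "z \<in> C n" "\<not> (\<exists>n x. P z n x)" for z n
      using that CF(2) by (auto simp: P_def)
    have Cuniq: "n' = n" if "z \<in> C n" "z \<in> C n'" for z n n'
      using CF(4)[OF that(2,1)] CF(1) that by blast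
    have r2: "\<rho> z = m (k n)" if z: "z \<in> C n" for z n
    proof (cases "k n \<in> B")
      case True
      have "\<not> P z n' x'" for n' x'
      proof
        assume P: "P z n' x'"
        then have "z \<in> F n z \<inter> F n' x'" using CF(1)[OF z] interior_subset by (auto simp: P_def)
        then have "n = n'" using CF(4)[OF z, of x' n'] P by (auto simp: P_def)
        then show False using P True by (simp add: P_def)
      qed
      moreover have "(SOME n. z \<in> C n) = n" by (rule some_equality) (use z Cuniq in blast)+
      ultimately show ?thesis using z by (auto simp: \<rho>_def)
    next
      case False
      then have "P z n z" using CF(2) z by (simp add: P_def)
      then show ?thesis using r1 r False z by simp
    qed
    have r3: "\<exists>t\<in>B. \<rho> z = m t" if "\<not> (\<exists>n x. P z n x)" for z
    proof (cases "\<exists>n. z \<in> C n")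
      case True
      then show ?thesis using r2 notP that by blast
    next
      case False
      then show ?thesis using c that by (auto simp: \<rho>_def)
    qed
    have lab: "mcs (\<rho> x) \<and> \<rho> x \<inter> \<Phi> \<in> U" for x
    proof (cases "\<exists>n y. P x n y")
      case True
      then show ?thesis using r1 r by (auto simp: P_def)
    next
      case False
      then show ?thesis using r3 m B by (metis subsetD)
    qed
    have ex: "exact \<Phi> \<rho> G z U" if z: "z \<in> closure G" "\<not> (\<exists>n x. P z n x)" for z
    proof (rule exact_dense)
      fix s assume s: "s \<in> U"
      have ni: "z \<notin> interior (F n x)" if "x \<in> C n" for n x
        using that z(2) CF(3)[of x n] by (cases "k n \<in> B") (auto simp: P_def)
      have "(\<Union>n\<in>{n. k n = s}. C n) \<subseteq> {x \<in> G. \<rho> x \<inter> \<Phi> = s}"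
        using r2 CG m[OF s] by auto
      then show "z islimpt {x \<in> G. \<rho> x \<inter> \<Phi> = s}"
        using CF(5)[OF z(1) ni k(2)[OF s]] islimpt_subset by blast
    qed (use lab in blast)
    let ?Z = "{z \<in> G. \<not> (\<exists>n x. P z n x)}"
    have GZ: "G - ?Z = (\<Union>n. \<Union>x\<in>{x \<in> C n. k n \<notin> B}. interior (F n x))"
      using CF(1) interior_subset by (fastforce simp: P_def)
    have "good \<Phi> \<rho> G"
    proof (rule good_glue[OF \<Phi> G, where Z = ?Z])
      show "open (G - ?Z)" unfolding GZ by auto
      have "good \<Phi> \<rho> (interior (F n x))" if "x \<in> C n" "k n \<notin> B" for n x
      proof (rule good_cong)
        show "good \<Phi> (r n x) (interior (F n x))" using r that by blast
        show "r n x z = \<rho> z" if "z \<in> interior (F n x)" for z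
          using r1[of z n x] that \<open>x \<in> C n\<close> \<open>k n \<notin> B\<close> by (simp add: P_def)
      qed auto
      then show "good \<Phi> \<rho> (G - ?Z)" unfolding GZ good_def by blast
      fix z assume z: "z \<in> ?Z"
      obtain s where s: "s \<in> B" "\<rho> z = m s" using r3 z by blast
      show "exact \<Phi> \<rho> G z (Up \<Phi> (\<rho> z))" using ex[of z] z closure_subset mB s by auto
      fix \<Delta> assume \<Delta>: "Tangle \<Delta> \<in> \<Phi>" "Tangle \<Delta> \<notin> \<rho> z"
      then obtain \<delta> where "\<delta> \<in> fset \<Delta>" "\<forall>t\<in>B. \<delta> \<notin> m t"
        using tB[OF \<Delta>(1) _ s(1)] s(2) by blast
      moreover then have "\<delta> \<notin> \<rho> y" if "y \<in> ?Z" for y using r3[of y] that by auto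
      ultimately show "\<exists>\<delta>\<in>fset \<Delta>. \<exists>N. open N \<and> z \<in> N \<and> (\<forall>y\<in>?Z \<inter> N - {z}. \<delta> \<notin> \<rho> y)"
        by (intro bexI[of _ \<delta>] exI[of _ UNIV]) auto
    qed (use lab in auto)
    moreover have "exact \<Phi> \<rho> G z U" if "z \<in> closure G - G" for z
    proof (rule ex)
      show "\<not> (\<exists>n x. P z n x)" using that CF(1) interior_subset by (fastforce simp: P_def)
    qed (use that in auto)
    ultimately show "\<exists>\<rho>. good \<Phi> \<rho> G \<and> (\<forall>x\<in>G. mcs (\<rho> x) \<and> \<rho> x \<inter> \<Phi> \<in> U) \<and>
      (\<forall>z\<in>closure G - G. exact \<Phi> \<rho> G z U)"
      using lab by blast
  qed
qed

text \<open>The types of the points of \<open>P\<close> seen from a suitable \<open>v\<close> serve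
  as the set \<open>B\<close> of \<open>core_cluster\<close>. To find \<open>v\<close>, the tangles
  absent from \<open>U\<close> are refuted one at a time, each by a move to a point with fewer
  successors; there are finitely many of them.\<close>

lemma core_of_definable:
  fixes X :: "'a::{metric_space, perfect_space} itself"
  assumes \<Phi>: "fclosed \<Phi>" and P: "definable P" and w: "mcs w" "P w"
    and step: "\<And>v. mcs v \<Longrightarrow> P v \<Longrightarrow> Up \<Phi> v = U \<and> (\<exists>u\<in>succs v. P u) \<and>
      (\<forall>u\<in>succs v. \<not> P u \<longrightarrow> (\<exists>V. insertable X \<Phi> u V))"
  shows "core X \<Phi> U"
proof -
  note fc = fclosedD[OF \<Phi>]
  define T where "T = {\<Delta>. Tangle \<Delta> \<in> \<Phi> \<and> (\<forall>t\<in>U. Tangle \<Delta> \<notin> t)}"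
  have "finite (Tangle -` \<Phi>)" using fc(1) by (intro finite_vimageI) (auto intro: injI)
  then have "finite T" by (rule rev_finite_subset) (auto simp: T_def)
  have "\<exists>v. mcs v \<and> P v \<and> (\<forall>\<Delta>\<in>T'. \<exists>\<delta>\<in>fset \<Delta>. \<forall>u\<in>succs v. P u \<longrightarrow> \<delta> \<notin> u)"
    if "finite T'" "T' \<subseteq> T" for T'
    using that
  proof (induction T' rule: finite_induct)
    case empty
    then show ?case using w by auto
  next
    case (insert \<Delta> T')
    then obtain v where v: "mcs v" "P v" "\<forall>\<Delta>\<in>T'. \<exists>\<delta>\<in>fset \<Delta>. \<forall>u\<in>succs v. P u \<longrightarrow> \<delta> \<notin> u" by blast
    have \<Delta>: "Tangle \<Delta> \<in> \<Phi>" "\<forall>t\<in>U. Tangle \<Delta> \<notin> t" using insert.prems by (auto simp: T_def)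
    have "Tangle \<Delta> \<notin> v"
    proof
      assume a: "Tangle \<Delta> \<in> v"
      obtain \<delta> where "\<delta> \<in> fset \<Delta>" using fc(8)[OF \<Delta>(1)] by (rule exE)
      then obtain u where "u \<in> succs v" "Tangle \<Delta> \<in> u" using mcs_Fix[OF v(1) a] by blast
      then have "u \<inter> \<Phi> \<in> U" using step[OF v(1,2)] Up_I by blast
      then show False using \<open>Tangle \<Delta> \<in> u\<close> \<Delta> by blast
    qed
    \<comment> \<open>Contraposition of \<open>mcs_Ind\<close> gives the next point. What it sees is
      already seen from \<open>v\<close>, so earlier refutations persist.\<close>
    then obtain x \<delta> where x: "x \<in> insert v (succs v)" "P x" "\<delta> \<in> fset \<Delta>"
      "\<not> (\<exists>u\<in>succs x. \<delta> \<in> u \<and> P u)"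
      using mcs_Ind[OF P fc(2)[OF \<Delta>(1)] v(1,2)] by blast
    have sub: "succs x \<subseteq> succs v" using x(1) succs_trans[OF v(1)] by auto
    have "mcs x" using x(1) v(1) succs_mcs by auto
    moreover have "\<exists>\<delta>\<in>fset \<Delta>'. \<forall>u\<in>succs x. P u \<longrightarrow> \<delta> \<notin> u" if "\<Delta>' \<in> T'" for \<Delta>'
      using bspec[OF v(3) that] sub by (meson subsetD)
    moreover have "\<exists>\<delta>\<in>fset \<Delta>. \<forall>u\<in>succs x. P u \<longrightarrow> \<delta> \<notin> u"
      using x(3,4) by (intro bexI[of _ \<delta>]) auto
    ultimately show ?case using x(2) by (intro exI[of _ x]) simp
  qed
  from this[OF \<open>finite T\<close> subset_refl] obtain v where v: "mcs v" "P v"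
    "\<forall>\<Delta>\<in>T. \<exists>\<delta>\<in>fset \<Delta>. \<forall>u\<in>succs v. P u \<longrightarrow> \<delta> \<notin> u" by (elim exE conjE)
  have U: "Up \<Phi> v = U" using step v by blast
  define B where "B = (\<lambda>u. u \<inter> \<Phi>) ` {u \<in> succs v. P u}"
  have "\<exists>u. u \<in> succs v \<and> u \<inter> \<Phi> = t \<and> (t \<in> B \<longrightarrow> P u)" if t: "t \<in> U" for t
  proof (cases "t \<in> B")
    case True
    then show ?thesis by (auto simp: B_def)
  next
    case False
    then show ?thesis using t by (auto simp: U[symmetric] Up_def)
  qed
  then obtain m where m: "\<And>t. t \<in> U \<Longrightarrow> m t \<in> succs v \<and> m t \<inter> \<Phi> = t \<and> (t \<in> B \<longrightarrow> P (m t))"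
    by metis
  show ?thesis
  proof (rule core_cluster[OF \<Phi>])
    show BU: "B \<subseteq> U" by (auto simp: B_def U[symmetric] Up_def)
    show "B \<noteq> {}" using step[OF v(1,2)] by (auto simp: B_def)
    show "mcs (m t) \<and> m t \<inter> \<Phi> = t" if "t \<in> U" for t using m[OF that] succs_mcs by blast
    show "Up \<Phi> (m t) = U" if "t \<in> B" for t using m[of t] that BU step succs_mcs by blast
    show "Up \<Phi> (m t) \<subseteq> U \<and> (\<exists>V. insertable X \<Phi> (m t) V)" if t: "t \<in> U - B" for t
    proof
      have mt: "m t \<in> succs v" "m t \<inter> \<Phi> = t" using m t by auto
      show "Up \<Phi> (m t) \<subseteq> U" using Up_mono[OF v(1) mt(1)] U by blast
      have "\<not> P (m t)" using t mt by (auto simp: B_def)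
      then show "\<exists>V. insertable X \<Phi> (m t) V" using step[OF v(1,2)] mt(1) by blast
    qed
    show "\<exists>\<delta>\<in>fset \<Delta>. \<forall>t\<in>B. \<delta> \<notin> t" if \<Delta>: "Tangle \<Delta> \<in> \<Phi>" "\<forall>t\<in>U. Tangle \<Delta> \<notin> t" for \<Delta>
    proof -
      obtain \<delta> where "\<delta> \<in> fset \<Delta>" "\<forall>u\<in>succs v. P u \<longrightarrow> \<delta> \<notin> u"
        using bspec[OF v(3), of \<Delta>] \<Delta> by (auto simp: T_def)
      then show ?thesis by (intro bexI[of _ \<delta>]) (auto simp: B_def)
    qed
  qed
qed

section \<open>Concentric shells\<close>

lemma Up_restrict: "\<Phi> \<subseteq> \<Phi>' \<Longrightarrow> (\<lambda>t. t \<inter> \<Phi>) ` Up \<Phi>' w = Up \<Phi> w"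
  unfolding Up_def image_image by (rule image_cong) auto

text \<open>The open shell \<open>E k\<close> has \<open>u k\<close> at one of its points and
  \<open>U k\<close> at its boundary. The border \<open>W k\<close> to the next shell is labelled
  \<open>b k\<close> throughout, and from both sides it sees exactly \<open>Up (Ph k) (b k)\<close>.
  Correctness is claimed only for the formulas reached at the given depth, as inner shells handle
  more formulas than outer ones. The centre \<open>y\<close> is left out.\<close>

lemma shells:
  fixes X :: "'a::{metric_space, perfect_space} itself" and G :: "'a set"
  assumes G: "open G" "y \<in> G"
    and Ph: "\<And>k. fclosed (Ph k)" "\<And>k. Ph k \<subseteq> Ph (Suc k)"
    and ins: "\<And>k. insertable X (Ph k) (u k) (U k)"
    and b: "\<And>k. mcs (b k)" "\<And>k. Up (Ph k) (b k) = U k \<union> (\<lambda>t. t \<inter> Ph k) ` U (Suc k)"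
      "\<And>k. b k \<inter> Ph k \<in> Up (Ph k) (b k)" "\<And>k. tangle_free (Ph k) (b k)"
  obtains \<rho> V where "V 0 = G" "\<And>k. open (V k)" "\<And>k. y \<in> V k"
    "\<And>N. open N \<Longrightarrow> y \<in> N \<Longrightarrow> \<exists>k. \<forall>j\<ge>k. V j \<subseteq> N"
    "\<And>j k. k \<le> j \<Longrightarrow> V j \<subseteq> V k"
    "\<And>k. good (Ph k) \<rho> (V k - {y})"
    "\<And>k x. x \<in> V k - {y} \<Longrightarrow> mcs (\<rho> x)"
    "\<And>k x. x \<in> V k - {y} \<Longrightarrow>
      \<exists>j\<ge>k. \<rho> x = b j \<or> \<rho> x \<inter> Ph j \<in> insert (u j \<inter> Ph j) (Up (Ph j) (u j))"
    "\<And>k. \<exists>x\<in>V k - {y}. \<rho> x = u k"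
    "\<And>z. z \<in> closure G - G \<Longrightarrow> exact (Ph 0) \<rho> (G - {y}) z (U 0)"
proof -
  obtain V F :: "nat \<Rightarrow> 'a set" where V: "V 0 = G" "\<And>k. open (V k)" "\<And>k. y \<in> V k"
    and F: "\<And>k. closed (F k)" "\<And>k. F k \<subseteq> V k" "\<And>k. V (Suc k) = interior (F k)"
      "\<And>k. F k = closure (V (Suc k))" "\<And>k. V k - F k \<noteq> {}"
    and shrink: "\<And>N. open N \<Longrightarrow> y \<in> N \<Longrightarrow> \<exists>k. \<forall>j\<ge>k. V j \<subseteq> N"
    using nested_neighbourhoods[OF G] by metis
  have VF: "V (Suc k) \<subseteq> F k" for k unfolding F(3) by (rule interior_subset)
  have dec: "V j \<subseteq> V k" if "k \<le> j" for j k
    using that by (induction rule: dec_induct) (use VF F(2) in blast)+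
  have PhM: "Ph k \<subseteq> Ph j" if "k \<le> j" for j k
    using that by (induction rule: dec_induct) (use Ph(2) in blast)+
  define E where "E k = V k - F k" for k
  define W where "W k = F k - V (Suc k)" for k
  have Eo: "open (E k)" for k using V(2) F(1) by (simp add: E_def open_Diff)
  have "\<exists>x. x \<in> E k" for k using F(5)[of k] by (auto simp: E_def)
  then obtain c where c: "\<And>k. c k \<in> E k" by metis
  have "\<exists>r. good (Ph k) r (E k) \<and> r (c k) = u k \<and>
    (\<forall>x\<in>E k. mcs (r x) \<and> r x \<inter> Ph k \<in> insert (u k \<inter> Ph k) (Up (Ph k) (u k))) \<and>
    (\<forall>z\<in>closure (E k) - E k. exact (Ph k) r (E k) z (U k))" for k
    by (rule mp[OF mp[OF spec[OF spec[OF ins[of k, unfolded insertable_def]]] Eo] c])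
  then obtain r where r: "\<And>k. good (Ph k) (r k) (E k)" "\<And>k. r k (c k) = u k"
    "\<And>k x. x \<in> E k \<Longrightarrow> mcs (r k x) \<and> r k x \<inter> Ph k \<in> insert (u k \<inter> Ph k) (Up (Ph k) (u k))"
    "\<And>k z. z \<in> closure (E k) - E k \<Longrightarrow> exact (Ph k) (r k) (E k) z (U k)"
    by metis
  \<comment> \<open>The index of the shell or border containing \<open>x\<close>. No such index
    exists at \<open>x = y\<close>, where the value is arbitrary.\<close>
  define lev where "lev x = (LEAST k. x \<notin> V (Suc k))" for x
  define \<rho> where "\<rho> x = (if x \<in> F (lev x) then b (lev x) else r (lev x) x)" for x
  have lev: "lev x = k" if "x \<in> V k" "x \<notin> V (Suc k)" for x k
    unfolding lev_def
  proof (rule Least_equality)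
    show "k \<le> j" if "x \<notin> V (Suc j)" for j
      using that \<open>x \<in> V k\<close> dec[of "Suc j" k] by (meson not_less_eq_eq subsetD)
  qed (use that in auto)
  have levE: "lev x = k" "\<rho> x = r k x" if "x \<in> E k" for x k
  proof -
    show "lev x = k" using that VF by (intro lev) (auto simp: E_def)
    then show "\<rho> x = r k x" using that by (simp add: \<rho>_def E_def)
  qed
  have levW: "lev x = k" "\<rho> x = b k" if "x \<in> W k" for x k
  proof -
    show "lev x = k" using that F(2) by (intro lev) (auto simp: W_def)
    then show "\<rho> x = b k" using that by (simp add: \<rho>_def W_def)
  qed
  have yE: "y \<notin> E k" "y \<notin> W k" for k using V(3)[of "Suc k"] VF[of k] by (auto simp: E_def W_def)
  have cover: "\<exists>j\<ge>k. x \<in> E j \<or> x \<in> W j" if x: "x \<in> V k - {y}" for x k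
  proof -
    have "open (- {x})" "y \<in> - {x}" using x by auto
    from shrink[OF this] obtain n where "x \<notin> V n" by blast
    then have "x \<notin> V (Suc n)" using dec[of n "Suc n"] by auto
    then have l: "x \<notin> V (Suc (lev x))" unfolding lev_def by (rule LeastI)
    have kl: "k \<le> lev x" using l dec[of "Suc (lev x)" k] x by (meson DiffD1 not_less_eq_eq subsetD)
    have "x \<in> V (lev x)"
    proof (cases "lev x")
      case 0
      then show ?thesis using x dec[of 0 k] by auto
    next
      case (Suc i)
      then show ?thesis using not_less_Least[of i "\<lambda>k. x \<notin> V (Suc k)"] unfolding lev_def by auto
    qed
    then show ?thesis using l kl by (intro exI[of _ "lev x"]) (auto simp: E_def W_def)
  qed
  \<comment> \<open>A border point is approached from outside because it is not interior to
    \<open>F k\<close>, and from inside because \<open>F k\<close> is the closure of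
    \<open>V (Suc k)\<close>.\<close>
  have clE: "z \<in> closure (E k) - E k" "z \<in> closure (E (Suc k)) - E (Suc k)" if z: "z \<in> W k" for z k
  proof -
    have zn: "z \<notin> V (Suc k)" "z \<in> F k" "z \<in> V k" using z F(2) by (auto simp: W_def)
    have "z \<in> closure (- F k)" using zn unfolding F(3) interior_closure by blast
    then have "z \<in> V k \<inter> closure (- F k)" using zn by blast
    then have "z \<in> closure (V k \<inter> - F k)" using open_Int_closure_subset[OF V(2)] by blast
    then show "z \<in> closure (E k) - E k" using zn by (simp add: E_def Diff_eq)
    have "z \<in> - F (Suc k) \<inter> closure (V (Suc k))" using zn F(2)[of "Suc k"] F(4)[of k] by auto
    then have "z \<in> closure (- F (Suc k) \<inter> V (Suc k))"
      using open_Int_closure_subset[of "- F (Suc k)"] F(1) by auto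
    then show "z \<in> closure (E (Suc k)) - E (Suc k)" using zn by (simp add: E_def Diff_eq Int_commute)
  qed
  define N where "N k = V k - F (Suc k)" for k
  have No: "open (N k)" for k using V(2) F(1) by (simp add: N_def open_Diff)
  have WN: "W k \<subseteq> N k" for k using F(2) by (auto simp: W_def N_def)
  have NE: "N k \<subseteq> E k \<union> E (Suc k) \<union> W k" for k by (auto simp: N_def E_def W_def)
  have EWV: "E j \<subseteq> V k - {y}" "W j \<subseteq> V k - {y}" if "k \<le> j" for j k
    using dec[OF that] yE[of j] F(2)[of j] unfolding E_def W_def by blast+
  have exW: "exact (Ph k) \<rho> (V k - {y}) z (Up (Ph k) (\<rho> z))" if z: "z \<in> W j" "k \<le> j" for z j k
  proof -
    have 1: "exact (Ph j) \<rho> (E j) z (U j)"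
      by (rule exact_cong[OF open_UNIV _ _ _ r(4)[OF clE(1)[OF z(1)]]]) (auto simp: levE)
    have "exact (Ph (Suc j)) \<rho> (E (Suc j)) z (U (Suc j))"
      by (rule exact_cong[OF open_UNIV _ _ _ r(4)[OF clE(2)[OF z(1)]]]) (auto simp: levE)
    then have "exact (Ph j) \<rho> (E (Suc j)) z ((\<lambda>t. t \<inter> Ph j) ` U (Suc j))"
      by (rule exact_restrict[OF fclosedD(1)[OF Ph(1)] Ph(2)])
    from exact_Un[OF 1 this] have "exact (Ph j) \<rho> (E j \<union> E (Suc j)) z (Up (Ph j) (b j))"
      using b(2) by simp
    \<comment> \<open>Other points of the same border add no new type, as the type of
      \<open>b j\<close> is already seen.\<close>
    then have "exact (Ph j) \<rho> (E j \<union> E (Suc j) \<union> W j) z (Up (Ph j) (b j))"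
      by (rule exact_add) (use levW b(3) in auto)
    then have "exact (Ph j) \<rho> (V k - {y}) z (Up (Ph j) (b j))"
    proof (rule exact_cong[OF No, rotated -1])
      show "z \<in> N j" using z WN by blast
      show "x \<in> E j \<union> E (Suc j) \<union> W j \<longleftrightarrow> x \<in> V k - {y}" if "x \<in> N j" for x
        using that NE EWV[OF z(2)] EWV(1)[of k "Suc j"] z(2) by auto
    qed simp
    from exact_restrict[OF fclosedD(1)[OF Ph(1)] PhM[OF z(2)] this]
    show ?thesis using levW(2)[OF z(1)] by (simp add: Up_restrict[OF PhM[OF z(2)]])
  qed
  have mc: "mcs (\<rho> x)" if x: "x \<in> V k - {y}" for x k
  proof -
    obtain j where "x \<in> E j \<or> x \<in> W j" using cover[OF x] by blast
    then show ?thesis using levE(2)[of x j] levW(2)[of x j] r(3)[of x j] b(1)[of j] by auto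
  qed
  have gd: "good (Ph k) \<rho> (V k - {y})" for k
  proof (rule good_glue[OF Ph(1), where Z = "\<Union>j\<in>{k..}. W j"])
    show "open (V k - {y})" using V(2) by (simp add: open_Diff)
    show "(\<Union>j\<in>{k..}. W j) \<subseteq> V k - {y}" using EWV(2)[of k] by auto
    have disj: "x \<notin> W j" if "x \<in> E i" for x i j
      using levE(1)[OF that] levW(1)[of x j] that by (auto simp: E_def W_def)
    have eq: "V k - {y} - (\<Union>j\<in>{k..}. W j) = (\<Union>j\<in>{k..}. E j)"
    proof
      show "V k - {y} - (\<Union>j\<in>{k..}. W j) \<subseteq> (\<Union>j\<in>{k..}. E j)" using cover[of _ k] by auto
      show "(\<Union>j\<in>{k..}. E j) \<subseteq> V k - {y} - (\<Union>j\<in>{k..}. W j)" using EWV(1)[of k] disj by auto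
    qed
    show "open (V k - {y} - (\<Union>j\<in>{k..}. W j))" unfolding eq using Eo by auto
    have "good (Ph k) \<rho> (E j)" if "k \<le> j" for j
    proof -
      have "good (Ph j) \<rho> (E j)" by (rule good_cong[OF Eo _ r(1)]) (simp add: levE)
      then show ?thesis by (rule good_subset) (use PhM[OF that] in auto)
    qed
    then show "good (Ph k) \<rho> (V k - {y} - (\<Union>j\<in>{k..}. W j))" unfolding eq good_def by auto
    show "mcs (\<rho> x)" if "x \<in> V k - {y}" for x using mc that by blast
    fix z assume "z \<in> (\<Union>j\<in>{k..}. W j)"
    then obtain j where j: "k \<le> j" "z \<in> W j" by auto
    show "exact (Ph k) \<rho> (V k - {y}) z (Up (Ph k) (\<rho> z))" using exW j by blast
    fix \<Delta> assume \<Delta>: "Tangle \<Delta> \<in> Ph k" "Tangle \<Delta> \<notin> \<rho> z"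
    then have "Tangle \<Delta> \<in> Ph j" "Tangle \<Delta> \<notin> b j" using PhM[OF j(1)] levW(2)[OF j(2)] by auto
    then obtain \<delta> where \<delta>: "\<delta> \<in> fset \<Delta>" "\<delta> \<notin> b j" using b(4)[of j] unfolding tangle_free_def by blast
    have "\<delta> \<notin> \<rho> x" if x: "x \<in> W i" "x \<in> N j" for x i
    proof -
      have "x \<in> W j" using x disj NE[of j] by blast
      then show ?thesis using levW(2) \<delta> by simp
    qed
    then have "\<forall>x\<in>(\<Union>j\<in>{k..}. W j) \<inter> N j - {z}. \<delta> \<notin> \<rho> x" by auto
    then show "\<exists>\<delta>\<in>fset \<Delta>. \<exists>M. open M \<and> z \<in> M \<and> (\<forall>x\<in>(\<Union>j\<in>{k..}. W j) \<inter> M - {z}. \<delta> \<notin> \<rho> x)"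
      using No[of j] subsetD[OF WN j(2)] \<delta>(1) by (intro bexI[of _ \<delta>] exI[of _ "N j"]) simp_all
  qed
  show ?thesis
  proof (rule that[of V \<rho>])
    show "\<exists>j\<ge>k. \<rho> x = b j \<or> \<rho> x \<inter> Ph j \<in> insert (u j \<inter> Ph j) (Up (Ph j) (u j))"
      if x: "x \<in> V k - {y}" for k x
    proof -
      obtain j where j: "k \<le> j" "x \<in> E j \<or> x \<in> W j" using cover[OF x] by blast
      from j(2) have "\<rho> x = b j \<or> \<rho> x \<inter> Ph j \<in> insert (u j \<inter> Ph j) (Up (Ph j) (u j))"
      proof
        assume "x \<in> E j"
        then show ?thesis using levE(2) r(3) by simp
      qed (simp add: levW(2))
      then show ?thesis using j(1) by blast
    qed
    show "\<exists>x\<in>V k - {y}. \<rho> x = u k" for k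
      using c[of k] levE(2)[OF c[of k]] r(2)[of k] EWV(1)[of k k] by auto
    show "exact (Ph 0) \<rho> (G - {y}) z (U 0)" if z: "z \<in> closure G - G" for z
    proof -
      have "z \<in> - F 0 \<inter> closure G" using z F(2)[of 0] V(1) by auto
      then have "z \<in> closure (- F 0 \<inter> G)" using open_Int_closure_subset[of "- F 0"] F(1) by auto
      then have "z \<in> closure (E 0) - E 0" using z V(1) by (simp add: E_def Diff_eq Int_commute)
      from r(4)[OF this] show ?thesis
      proof (rule exact_cong[rotated -1])
        show "open (- F 0)" using F(1) by auto
        show "z \<in> - F 0" using z F(2)[of 0] V(1) by auto
        show "x \<in> E 0 \<longleftrightarrow> x \<in> G - {y}" if "x \<in> - F 0" for x
          using that V(1) V(3)[of 1] VF[of 0] by (auto simp: E_def)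
      qed (simp add: levE)
    qed
  qed (use V shrink dec gd mc in auto)
qed

text \<open>The paths are run through one after the other. A state is a path together with a
  position on it; positive lengths ensure that each path has a first edge.\<close>

lemma concat_paths:
  assumes "\<And>n. (g n, g (Suc n)) \<in> E\<^sup>+"
  obtains f :: "nat \<Rightarrow> 'b" where "f 0 = g 0" "\<And>i. (f i, f (Suc i)) \<in> E" "\<And>n. \<exists>i\<ge>n. f i = g n"
proof -
  have "\<forall>n. \<exists>m h. 0 < m \<and> h 0 = g n \<and> h m = g (Suc n) \<and> (\<forall>i<m. (h i, h (Suc i)) \<in> E)"
  proof
    fix n
    obtain m where "0 < m" "(g n, g (Suc n)) \<in> E ^^ m" using assms[of n] trancl_power by blast
    then show "\<exists>m h. 0 < m \<and> h 0 = g n \<and> h m = g (Suc n) \<and> (\<forall>i<m. (h i, h (Suc i)) \<in> E)"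
      unfolding relpow_fun_conv by blast
  qed
  then obtain m h where m: "\<And>n. 0 < (m n :: nat)" and h: "\<And>n. h n 0 = g n" "\<And>n. h n (m n) = g (Suc n)"
    "\<And>n i. i < m n \<Longrightarrow> (h n i, h n (Suc i)) \<in> E"
    by metis
  define st where "st = rec_nat (0::nat, 0::nat)
    (\<lambda>_ (n, j). if Suc j < m n then (n, Suc j) else (Suc n, 0))"
  define f where "f i = h (fst (st i)) (snd (st i))" for i
  have st0: "st 0 = (0, 0)" by (simp add: st_def)
  have stS: "st (Suc i) = (if Suc (snd (st i)) < m (fst (st i)) then (fst (st i), Suc (snd (st i)))
    else (Suc (fst (st i)), 0))" for i
    by (simp add: st_def split: prod.split)
  have inv: "snd (st i) < m (fst (st i))" for i
    by (induction i) (auto simp: st0 stS m)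
  have step: "(f i, f (Suc i)) \<in> E" for i
  proof (cases "Suc (snd (st i)) < m (fst (st i))")
    case True
    then show ?thesis using h(3)[OF inv[of i]] by (simp add: f_def stS)
  next
    case False
    then have "Suc (snd (st i)) = m (fst (st i))" using inv[of i] by simp
    then show ?thesis using h(3)[OF inv[of i]] h(1,2) by (simp add: f_def stS)
  qed
  have run: "j < m n \<Longrightarrow> st i = (n, 0) \<Longrightarrow> st (i + j) = (n, j)" for i j n
    by (induction j) (auto simp: stS)
  have "\<exists>i\<ge>n. st i = (n, 0)" for n
  proof (induction n)
    case 0
    then show ?case using st0 by blast
  next
    case (Suc n)
    then obtain i where i: "n \<le> i" "st i = (n, 0)" by blast
    obtain j where j: "m n = Suc j" using m[of n] by (cases "m n") auto
    then have "st (i + j) = (n, j)" using run i by simp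
    then have "st (Suc (i + j)) = (Suc n, 0)" using j by (simp add: stS)
    then show ?case using i by (intro exI[of _ "Suc (i + j)"]) auto
  qed
  then have "\<exists>i\<ge>n. f i = g n" for n using h(1) by (metis f_def fst_conv snd_conv)
  then show ?thesis using that[of f] step h(1) by (simp add: f_def st0)
qed

definition Up2 :: "'v fm set \<Rightarrow> 'v fm set \<Rightarrow> 'v fm set set set" where
  "Up2 \<Phi> w = Up \<Phi> ` succs w"

text \<open>The cores that can lie around a point labelled \<open>u\<close>: what \<open>u\<close>
  sees if this is a core, and any visible core otherwise.\<close>

definition bases ::
    "'a::topological_space itself \<Rightarrow> 'v fm set \<Rightarrow> 'v fm set \<Rightarrow> 'v fm set set set" where
  "bases X \<Phi> u = (if core X \<Phi> (Up \<Phi> u) then {Up \<Phi> u} else {U \<in> Up2 \<Phi> u. core X \<Phi> U})"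

text \<open>Chains of comparable cores. The bound \<open>M\<close> keeps every type used along a
  chain among those that may accumulate at the centre.\<close>

definition conn :: "'a::topological_space itself \<Rightarrow> 'v fm set \<Rightarrow> 'v fm set set \<Rightarrow>
    ('v fm set set \<times> 'v fm set set) set" where
  "conn X \<Phi> M =
    {(U, V). core X \<Phi> U \<and> core X \<Phi> V \<and> U \<subseteq> M \<and> V \<subseteq> M \<and> (U \<subseteq> V \<or> V \<subseteq> U)}\<^sup>*"

lemma conn_mono: "M \<subseteq> M' \<Longrightarrow> conn X \<Phi> M \<subseteq> conn X \<Phi> M'"
  unfolding conn_def by (rule rtrancl_mono) auto

lemma conn_trans: "(U, V) \<in> conn X \<Phi> M \<Longrightarrow> (V, W) \<in> conn X \<Phi> M \<Longrightarrow> (U, W) \<in> conn X \<Phi> M"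
  unfolding conn_def by (rule rtrancl_trans)

lemma conn_refl: "(U, U) \<in> conn X \<Phi> M"
  unfolding conn_def by (rule rtrancl_refl)

lemma Up2_succs: "mcs w \<Longrightarrow> u \<in> succs w \<Longrightarrow> insert (Up \<Phi> u) (Up2 \<Phi> u) \<subseteq> Up2 \<Phi> w"
  by (auto simp: Up2_def dest: succs_trans)

lemma Up2_subset: "mcs w \<Longrightarrow> U \<in> Up2 \<Phi> w \<Longrightarrow> U \<subseteq> Up \<Phi> w"
  using Up_mono[of w] by (auto simp: Up2_def)

lemma bases_subset: "bases X \<Phi> u \<subseteq> {U \<in> insert (Up \<Phi> u) (Up2 \<Phi> u). core X \<Phi> U}"
  by (auto simp: bases_def)

text \<open>The shells follow an infinite path through pairs of a label and a core that starts at
  \<open>U0\<close>, passes through each label in \<open>D\<close> infinitely often and climbs to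
  every level \<open>Ph n\<close>. Hence every type of \<open>Up (Ph n) w\<close>, and no other,
  accumulates at \<open>y\<close>. The label \<open>z\<close> of the centre need not be
  \<open>w\<close>; it only has to see the same types.\<close>

lemma walk:
  fixes X :: "'a::{metric_space, perfect_space} itself" and G :: "'a set"
  assumes w: "mcs w" "mcs z" "\<And>n. Up (Ph n) z = Up (Ph n) w"
    and Ph: "\<And>n. fclosed (Ph n)" "\<And>n. Ph n \<subseteq> Ph (Suc n)"
    and D: "D \<subseteq> succs w" "countable D" "\<And>n t. t \<in> Up (Ph n) w \<Longrightarrow> \<exists>u\<in>D. u \<inter> Ph n = t"
    and con: "\<And>n U V. U \<in> Up2 (Ph n) w \<Longrightarrow> V \<in> Up2 (Ph n) w \<Longrightarrow> core X (Ph n) U \<Longrightarrow>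
      core X (Ph n) V \<Longrightarrow> (U, V) \<in> conn X (Ph n) (Up (Ph n) w)"
    and bas: "\<And>n u. u \<in> succs w \<Longrightarrow> bases X (Ph n) u \<noteq> {}"
      "\<And>n u U. u \<in> succs w \<Longrightarrow> U \<in> bases X (Ph n) u \<Longrightarrow> insertable X (Ph n) u U"
    and U0: "core X (Ph 0) U0" "U0 \<subseteq> Up (Ph 0) w" "U1 \<in> Up2 (Ph 0) w" "core X (Ph 0) U1"
      "(U0, U1) \<in> conn X (Ph 0) (Up (Ph 0) w)"
    and G: "open G" "y \<in> G"
  obtains \<rho> where "\<rho> y = z" "\<And>n. \<exists>V. y \<in> V \<and> good (Ph n) \<rho> V" "good (Ph 0) \<rho> G"
    "\<And>x. x \<in> G \<Longrightarrow> mcs (\<rho> x) \<and> \<rho> x \<inter> Ph 0 \<in> insert (z \<inter> Ph 0) (Up (Ph 0) z)"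
    "\<And>x. x \<in> closure G - G \<Longrightarrow> exact (Ph 0) \<rho> G x U0"
proof -
  have PhM: "Ph k \<subseteq> Ph j" if "k \<le> j" for j k
    using that by (induction rule: dec_induct) (use Ph(2) in blast)+
  let ?M = "\<lambda>n. Up (Ph n) w"
  have "\<forall>n U. \<exists>b. core X (Ph n) U \<longrightarrow>
    mcs b \<and> Up (Ph n) b = U \<and> b \<inter> Ph n \<in> U \<and> tangle_free (Ph n) b"
    unfolding core_def by blast
  then obtain \<beta> where \<beta>: "\<And>n U. core X (Ph n) U \<Longrightarrow>
    mcs (\<beta> n U) \<and> Up (Ph n) (\<beta> n U) = U \<and> \<beta> n U \<inter> Ph n \<in> U \<and> tangle_free (Ph n) (\<beta> n U)"
    by metis
  \<comment> \<open>A shell at level \<open>n\<close> with inserted label \<open>u\<close> and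
    boundary core \<open>U\<close>, all of whose types are seen by \<open>w\<close>.\<close>
  define node where "node = (\<lambda>(n, u, U). core X (Ph n) U \<and> U \<subseteq> ?M n \<and> mcs u \<and>
    insertable X (Ph n) u U \<and> insert (u \<inter> Ph n) (Up (Ph n) u) \<subseteq> ?M n)"
  define E where "E = {((n, u, U), (n', u', U')). node (n, u, U) \<and> node (n', u', U') \<and>
    (n' = n \<and> (U \<subseteq> U' \<or> U' \<subseteq> U) \<or> n' = Suc n \<and> U \<subseteq> (\<lambda>t. t \<inter> Ph n) ` U')}"
  have core_node: "node (n, \<beta> n U, U)" if "core X (Ph n) U" "U \<subseteq> ?M n" for n U
    using that \<beta>[OF that(1)] insertable_core[OF Ph(1), of X n "\<beta> n U"] by (auto simp: node_def)
  have baseD: "core X (Ph n) U" "U \<in> Up2 (Ph n) w" "U \<subseteq> Up (Ph n) u"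
    if "u \<in> succs w" "U \<in> bases X (Ph n) u" for n u U
  proof -
    have "U \<in> insert (Up (Ph n) u) (Up2 (Ph n) u)" "core X (Ph n) U"
      using bases_subset that(2) by blast+
    then show "core X (Ph n) U" "U \<in> Up2 (Ph n) w" "U \<subseteq> Up (Ph n) u"
      using Up2_succs[OF w(1) that(1)] Up2_subset[OF succs_mcs[OF that(1)]] by blast+
  qed
  have succ_node: "node (n, u, U)" if u: "u \<in> succs w" and U: "U \<in> bases X (Ph n) u" for n u U
    using baseD[OF u U] bas(2)[OF u U] succs_mcs[OF u] Up_mono[OF w(1) u, of "Ph n"]
      Up_I[OF u, of "Ph n"] Up2_subset[OF w(1)] by (auto simp: node_def)
  have conn_E: "((n, \<beta> n U, U), (n, \<beta> n V, V)) \<in> E\<^sup>*" if "(U, V) \<in> conn X (Ph n) (?M n)" for n U V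
    using that unfolding conn_def
  proof (induction rule: rtrancl_induct)
    case (step V W)
    then have "((n, \<beta> n V, V), (n, \<beta> n W, W)) \<in> E" using core_node by (auto simp: E_def)
    then show ?case using step.IH by simp
  qed simp
  \<comment> \<open>\<open>U'\<close> is what some successor \<open>x\<close> sees at the next
    level. A core \<open>W\<close> around \<open>x\<close> at the present level lies in the
    restriction of \<open>U'\<close>, so the path goes to \<open>W\<close> along comparable cores
    and then climbs.\<close>
  have advance: "((n, u, U), (Suc n, u', U')) \<in> E\<^sup>+"
    if nd: "node (n, u, U)" and V: "V \<in> Up2 (Ph n) w" "core X (Ph n) V" "(U, V) \<in> conn X (Ph n) (?M n)"
      and u': "u' \<in> succs w" "U' \<in> bases X (Ph (Suc n)) u'" for n u U V u' U'
  proof -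
    have "U' \<in> Up2 (Ph (Suc n)) w" using baseD[OF u'] by blast
    then obtain x where x: "x \<in> succs w" "U' = Up (Ph (Suc n)) x" by (auto simp: Up2_def)
    obtain W where W: "W \<in> bases X (Ph n) x" using bas(1)[OF x(1)] by blast
    note Wb = baseD[OF x(1) W]
    have WM: "W \<subseteq> ?M n" using Up2_subset[OF w(1) Wb(2)] .
    have "(V, W) \<in> conn X (Ph n) (?M n)" using con V Wb by blast
    then have "(U, W) \<in> conn X (Ph n) (?M n)" using V(3) conn_trans by blast
    then have p: "((n, \<beta> n U, U), (n, \<beta> n W, W)) \<in> E\<^sup>*" by (rule conn_E)
    have U: "core X (Ph n) U" "U \<subseteq> ?M n" using nd by (auto simp: node_def)
    have "((n, u, U), (n, \<beta> n U, U)) \<in> E" using nd core_node[OF U] by (simp add: E_def)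
    moreover have "W \<subseteq> (\<lambda>t. t \<inter> Ph n) ` U'" using Wb(3) x(2) by (simp add: Up_restrict Ph(2))
    then have "((n, \<beta> n W, W), (Suc n, u', U')) \<in> E"
      using core_node[OF Wb(1) WM] succ_node[OF u'] by (simp add: E_def)
    ultimately show ?thesis using p by (meson r_into_rtrancl rtrancl_into_trancl1 rtrancl_trans)
  qed
  have "D \<noteq> {}" using D(3)[of _ 0] succs_nonempty[OF w(1)] by (fastforce simp: Up_def)
  then obtain e where e: "\<And>n::nat. e n \<in> D" "\<And>t. t \<in> D \<Longrightarrow> infinite {n. e n = t}"
    using repeating_enumeration[OF D(2)] by metis
  have eS: "e n \<in> succs w" for n using e(1) D(1) by blast
  define B where "B n = (SOME U. U \<in> bases X (Ph (Suc n)) (e n))" for n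
  have B: "B n \<in> bases X (Ph (Suc n)) (e n)" for n
    unfolding B_def using bas(1)[OF eS, of "Suc n" n] by (simp add: some_in_eq)
  define g where "g n = (case n of 0 \<Rightarrow> (0, \<beta> 0 U0, U0) | Suc m \<Rightarrow> (Suc m, e m, B m))" for n
  have "(g n, g (Suc n)) \<in> E\<^sup>+" for n
  proof (cases n)
    case 0
    then show ?thesis
      using advance[OF core_node[OF U0(1,2)] U0(3,4,5) eS B] by (simp add: g_def)
  next
    case (Suc m)
    then show ?thesis
      using advance[OF succ_node[OF eS B] _ _ conn_refl eS B] baseD[OF eS B, of m] by (simp add: g_def)
  qed
  then obtain f where f: "f 0 = g 0" "\<And>i. (f i, f (Suc i)) \<in> E" "\<And>n. \<exists>i\<ge>n. f i = g n"
    using concat_paths[of g E] by blast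
  define st where "st i = fst (f i)" for i
  define u where "u i = fst (snd (f i))" for i
  define U where "U i = snd (snd (f i))" for i
  have fe: "f i = (st i, u i, U i)" for i by (simp add: st_def u_def U_def)
  have nd: "node (st i, u i, U i)" for i using f(2)[of i] unfolding fe by (auto simp: E_def)
  have lk: "st (Suc i) = st i \<and> (U i \<subseteq> U (Suc i) \<or> U (Suc i) \<subseteq> U i) \<or>
    st (Suc i) = Suc (st i) \<and> U i \<subseteq> (\<lambda>t. t \<inter> Ph (st i)) ` U (Suc i)" for i
    using f(2)[of i] unfolding fe by (auto simp: E_def)
  have stM: "Ph (st i) \<subseteq> Ph (st (Suc i))" for i using lk[of i] Ph(2)[of "st i"] by auto
  have stm: "st i \<le> st j" if "i \<le> j" for i j
    using that by (induction rule: dec_induct) (use lk in \<open>auto intro: le_trans\<close>, metis le_SucI order_refl le_trans)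
  have ndD: "core X (Ph (st i)) (U i)" "U i \<subseteq> ?M (st i)" "mcs (u i)"
    "insertable X (Ph (st i)) (u i) (U i)"
    "insert (u i \<inter> Ph (st i)) (Up (Ph (st i)) (u i)) \<subseteq> ?M (st i)" for i
    using nd[of i] by (auto simp: node_def)
  \<comment> \<open>In both kinds of steps one of the two sets contains the other, so the point of
    the larger core can label the border. When the level rises, the larger one is the inner
    core.\<close>
  have "\<exists>b. mcs b \<and> Up (Ph (st i)) b = U i \<union> (\<lambda>t. t \<inter> Ph (st i)) ` U (Suc i) \<and>
    b \<inter> Ph (st i) \<in> Up (Ph (st i)) b \<and> tangle_free (Ph (st i)) b" for i
  proof (cases "st (Suc i) = st i")
    case True
    have "t \<inter> Ph (st i) = t" if "t \<in> U (Suc i)" for t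
      using ndD(2)[of "Suc i"] Up_Pow[of "Ph (st i)" w] that True by auto
    then have r: "(\<lambda>t. t \<inter> Ph (st i)) ` U (Suc i) = U (Suc i)" by auto
    have c: "core X (Ph (st i)) (U i)" "core X (Ph (st i)) (U (Suc i))"
      using ndD(1)[of i] ndD(1)[of "Suc i"] True by auto
    have "U i \<union> U (Suc i) = U i \<or> U i \<union> U (Suc i) = U (Suc i)" using lk[of i] True by auto
    then show ?thesis unfolding r using \<beta>[OF c(1)] \<beta>[OF c(2)] by metis
  next
    case False
    then have s: "st (Suc i) = Suc (st i)" and sub: "U i \<subseteq> (\<lambda>t. t \<inter> Ph (st i)) ` U (Suc i)"
      using lk[of i] by auto
    let ?b = "\<beta> (st (Suc i)) (U (Suc i))"
    have b: "mcs ?b" "Up (Ph (st (Suc i))) ?b = U (Suc i)" "?b \<inter> Ph (st (Suc i)) \<in> U (Suc i)"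
      "tangle_free (Ph (st (Suc i))) ?b"
      using \<beta>[OF ndD(1)[of "Suc i"]] by auto
    have "Up (Ph (st i)) ?b = (\<lambda>t. t \<inter> Ph (st i)) ` U (Suc i)"
      using Up_restrict[OF stM[of i], of ?b] b(2) by simp
    moreover have "?b \<inter> Ph (st i) = ?b \<inter> Ph (st (Suc i)) \<inter> Ph (st i)" using stM[of i] by auto
    then have "?b \<inter> Ph (st i) \<in> (\<lambda>t. t \<inter> Ph (st i)) ` U (Suc i)" using b(3) by blast
    moreover have "tangle_free (Ph (st i)) ?b"
      using b(4) stM[of i] unfolding tangle_free_def by blast
    ultimately show ?thesis using b(1) sub by (intro exI[of _ ?b]) auto
  qed
  then obtain b where b: "\<And>i. mcs (b i)"
    "\<And>i. Up (Ph (st i)) (b i) = U i \<union> (\<lambda>t. t \<inter> Ph (st i)) ` U (Suc i)"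
    "\<And>i. b i \<inter> Ph (st i) \<in> Up (Ph (st i)) (b i)" "\<And>i. tangle_free (Ph (st i)) (b i)"
    by metis
  obtain \<rho>0 V where V: "V 0 = G" "\<And>k. open (V k)" "\<And>k. y \<in> V k"
    "\<And>N. open N \<Longrightarrow> y \<in> N \<Longrightarrow> \<exists>k. \<forall>j\<ge>k. V j \<subseteq> N" "\<And>j k. k \<le> j \<Longrightarrow> V j \<subseteq> V k"
    and \<rho>0: "\<And>k. good (Ph (st k)) \<rho>0 (V k - {y})" "\<And>k x. x \<in> V k - {y} \<Longrightarrow> mcs (\<rho>0 x)"
    "\<And>k x. x \<in> V k - {y} \<Longrightarrow> \<exists>j\<ge>k. \<rho>0 x = b j \<or>
      \<rho>0 x \<inter> Ph (st j) \<in> insert (u j \<inter> Ph (st j)) (Up (Ph (st j)) (u j))"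
    "\<And>k. \<exists>x\<in>V k - {y}. \<rho>0 x = u k"
    "\<And>x. x \<in> closure G - G \<Longrightarrow> exact (Ph (st 0)) \<rho>0 (G - {y}) x (U 0)"
  proof (rule shells[OF G, of "\<lambda>k. Ph (st k)" X u U b], goal_cases)
    case (8 \<rho> V)
    from 8(2-) show ?case by (rule 8(1))
  qed (use Ph(1) stM ndD(4) b in auto)
  define \<rho> where "\<rho> = \<rho>0(y := z)"
  have f0: "st 0 = 0" "U 0 = U0" using f(1) by (simp_all add: st_def U_def g_def)
  have lab: "\<rho>0 x \<inter> Ph (st k) \<in> ?M (st k)" if x: "x \<in> V k - {y}" for x k
  proof -
    obtain j where j: "k \<le> j" "\<rho>0 x = b j \<or>
      \<rho>0 x \<inter> Ph (st j) \<in> insert (u j \<inter> Ph (st j)) (Up (Ph (st j)) (u j))"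
      using \<rho>0(3)[OF x] by blast
    have "(\<lambda>t. t \<inter> Ph (st j)) ` U (Suc j) \<subseteq> ?M (st j)"
      using image_mono[OF ndD(2)[of "Suc j"], of "\<lambda>t. t \<inter> Ph (st j)"] Up_restrict[OF stM[of j]]
      by simp
    then have "Up (Ph (st j)) (b j) \<subseteq> ?M (st j)" using b(2)[of j] ndD(2)[of j] by simp
    then have "\<rho>0 x \<inter> Ph (st j) \<in> ?M (st j)" using j(2) b(3)[of j] ndD(5)[of j] by auto
    then have "\<rho>0 x \<inter> Ph (st j) \<inter> Ph (st k) \<in> (\<lambda>t. t \<inter> Ph (st k)) ` ?M (st j)" by blast
    moreover have P: "Ph (st k) \<subseteq> Ph (st j)" using PhM stm j(1) by blast
    then have "\<rho>0 x \<inter> Ph (st j) \<inter> Ph (st k) = \<rho>0 x \<inter> Ph (st k)" by auto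
    ultimately show ?thesis by (simp add: Up_restrict[OF P])
  qed
  \<comment> \<open>Each label of \<open>D\<close> is inserted in infinitely many shells, hence
    arbitrarily close to \<open>y\<close>.\<close>
  have hit: "y islimpt {x \<in> V k - {y}. \<rho>0 x = t}" if t: "t \<in> D" for t k
  proof (rule islimptI)
    fix N assume N: "y \<in> N" "open N"
    then obtain i where i: "\<forall>j\<ge>i. V j \<subseteq> N" using V(4) by blast
    obtain m where m: "e m = t" "max i k < m"
      using e(2)[OF t] unfolding infinite_nat_iff_unbounded by blast
    obtain j where j: "Suc m \<le> j" "f j = g (Suc m)" using f(3) by blast
    then have "u j = t" using m by (simp add: u_def g_def)
    moreover obtain x where "x \<in> V j - {y}" "\<rho>0 x = u j" using \<rho>0(4) by blast
    moreover have "V j \<subseteq> N" "V j \<subseteq> V k" using i V(5) m j(1) by auto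
    ultimately show "\<exists>x\<in>{x \<in> V k - {y}. \<rho>0 x = t}. x \<in> N \<and> x \<noteq> y" by blast
  qed
  have gd: "good (Ph (st k)) \<rho> (V k)" for k
  proof (rule good_insert_point[OF Ph(1) V(2,3)])
    show "good (Ph (st k)) \<rho> (V k - {y})"
      by (rule good_cong[OF _ _ \<rho>0(1)]) (auto simp: \<rho>_def V(2) open_Diff)
    show "mcs (\<rho> x)" if "x \<in> V k" for x using \<rho>0(2)[of x k] that w(2) by (auto simp: \<rho>_def)
    have "exact (Ph (st k)) \<rho>0 (V k - {y}) y (?M (st k))"
    proof (rule exact_dense)
      fix s assume "s \<in> ?M (st k)"
      then obtain t where "t \<in> D" "t \<inter> Ph (st k) = s" using D(3) by blast
      then show "y islimpt {x \<in> V k - {y}. \<rho>0 x \<inter> Ph (st k) = s}"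
        using hit[of t k] by (auto elim!: islimpt_subset)
    qed (use lab in blast)
    then have "exact (Ph (st k)) \<rho> (V k) y (?M (st k))"
      by (rule exact_cong[OF open_UNIV, rotated -1]) (auto simp: \<rho>_def)
    then show "exact (Ph (st k)) \<rho> (V k) y (Up (Ph (st k)) (\<rho> y))" using w(3) by (simp add: \<rho>_def)
  qed
  show ?thesis
  proof (rule that[of \<rho>])
    show "\<rho> y = z" by (simp add: \<rho>_def)
    show "\<exists>V. y \<in> V \<and> good (Ph n) \<rho> V" for n
    proof -
      obtain i where "f i = g n" using f(3) by blast
      then have "st i = n" by (simp add: st_def g_def split: nat.split)
      then show ?thesis using gd[of i] V(3) by auto
    qed
    show "good (Ph 0) \<rho> G" using gd[of 0] f0 V(1) by simp
    show "mcs (\<rho> x) \<and> \<rho> x \<inter> Ph 0 \<in> insert (z \<inter> Ph 0) (Up (Ph 0) z)" if "x \<in> G" for x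
      using \<rho>0(2)[of x 0] lab[of x 0] that w(2,3) f0(1) V(1) by (auto simp: \<rho>_def)
    show "exact (Ph 0) \<rho> G x U0" if x: "x \<in> closure G - G" for x
    proof (rule exact_cong)
      show "exact (Ph 0) \<rho>0 (G - {y}) x U0" using \<rho>0(5)[OF x] f0 by simp
      show "open (- {y})" "x \<in> - {y}" using x G by auto
    qed (auto simp: \<rho>_def)
  qed
qed

section \<open>Realizing canonical points\<close>

lemma definable_type:
  assumes "fclosed \<Phi>"
  shows "definable (\<lambda>w. w \<inter> \<Phi> = t)"
proof -
  have "definable (\<lambda>w. t \<subseteq> \<Phi> \<and> (\<forall>\<phi>\<in>\<Phi>. \<phi> \<in> w \<longleftrightarrow> \<phi> \<in> t))"
    by (intro definable_conj definable_const definable_all definable_iff_const definable_formula)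
      (use fclosedD(1,2)[OF assms] in auto)
  moreover have "w \<inter> \<Phi> = t \<longleftrightarrow> t \<subseteq> \<Phi> \<and> (\<forall>\<phi>\<in>\<Phi>. \<phi> \<in> w \<longleftrightarrow> \<phi> \<in> t)" for w by blast
  ultimately show ?thesis by simp
qed

lemma definable_Up: "fclosed \<Phi> \<Longrightarrow> definable (\<lambda>w. Up \<Phi> w = U)"
  unfolding Up_def
  by (rule definable_image_eq[of "Pow \<Phi>"]) (auto simp: fclosedD(1) definable_type)

lemma definable_Up2: "fclosed \<Phi> \<Longrightarrow> definable (\<lambda>w. Up2 \<Phi> w = Y)"
  unfolding Up2_def
  by (rule definable_image_eq[of "Pow (Pow \<Phi>)"]) (use Up_Pow in \<open>auto simp: fclosedD(1) definable_Up\<close>)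

lemma definable_Up_Up2:
  assumes \<Phi>: "fclosed \<Phi>"
  shows "definable (\<lambda>w. Q (Up \<Phi> w) (Up2 \<Phi> w))"
proof -
  have "Up2 \<Phi> w \<subseteq> Pow (Pow \<Phi>)" for w using Up_Pow by (auto simp: Up2_def)
  then have a: "(Up \<Phi> w, Up2 \<Phi> w) \<in> Pow (Pow \<Phi>) \<times> Pow (Pow (Pow \<Phi>))" for w
    using Up_Pow by blast
  have d: "definable (\<lambda>w. (Up \<Phi> w, Up2 \<Phi> w) = a)" for a
    unfolding prod_eq_iff fst_conv snd_conv
    by (intro definable_conj definable_Up[OF \<Phi>] definable_Up2[OF \<Phi>])
  have "finite (Pow (Pow \<Phi>) \<times> Pow (Pow (Pow \<Phi>)))" by (simp add: fclosedD(1)[OF \<Phi>])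
  from definable_of_finite[OF this d a, of "case_prod Q"] show ?thesis by simp
qed

text \<open>What \<open>walk\<close> asks for: the first two clauses at the successors of its point
  \<open>w\<close>, the third at \<open>w\<close> itself. The set \<open>Up \<Phi> z\<close> is
  included in the third so that the components of a point and of its successors can be
  compared.\<close>

definition realizable :: "'a::topological_space itself \<Rightarrow> 'v fm set \<Rightarrow> 'v fm set \<Rightarrow> bool" where
  "realizable X \<Phi> z \<longleftrightarrow> bases X \<Phi> z \<noteq> {} \<and> (\<forall>U\<in>bases X \<Phi> z. insertable X \<Phi> z U) \<and>
    (\<forall>U\<in>insert (Up \<Phi> z) (Up2 \<Phi> z). \<forall>V\<in>insert (Up \<Phi> z) (Up2 \<Phi> z).
      core X \<Phi> U \<longrightarrow> core X \<Phi> V \<longrightarrow> (U, V) \<in> conn X \<Phi> (Up \<Phi> z))"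

lemma realizable_core:
  fixes X :: "'a::{metric_space, perfect_space} itself"
  assumes "fclosed \<Phi>" "mcs z" "core X \<Phi> (Up \<Phi> z)"
  shows "realizable X \<Phi> z"
proof -
  have "(U, V) \<in> conn X \<Phi> (Up \<Phi> z)"
    if U: "U \<in> insert (Up \<Phi> z) (Up2 \<Phi> z)" "core X \<Phi> U"
      and V: "V \<in> insert (Up \<Phi> z) (Up2 \<Phi> z)" "core X \<Phi> V" for U V
  proof -
    have "U \<subseteq> Up \<Phi> z" "V \<subseteq> Up \<Phi> z" using U V Up2_subset[OF assms(2)] by auto
    then have "(U, Up \<Phi> z) \<in> conn X \<Phi> (Up \<Phi> z)" "(Up \<Phi> z, V) \<in> conn X \<Phi> (Up \<Phi> z)"
      using U V assms(3) unfolding conn_def by (auto intro!: r_into_rtrancl)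
    then show ?thesis by (rule conn_trans)
  qed
  then show ?thesis
    using assms insertable_core[OF assms(1,3,2)] by (auto simp: realizable_def bases_def)
qed

text \<open>
  If \<open>U\<close> is not a core, definable classes of points \<open>w\<close> with \<open>Up \<Phi> w = U\<close> in which every point sees
  another one would make it a core, by \<open>core_of_definable\<close>.  Applied to three such classes this
  yields in turn that cores are visible, that each component of cores is the one surrounding some
  point \<open>v\<close> seeing only smaller sets, and, with \<open>mcs_G1\<close>, that only one component is visible.
\<close>

lemma realizable_step:
  fixes X :: "'a::{metric_space, perfect_space} itself"
  assumes \<Phi>: "fclosed \<Phi>" and nc: "\<not> core X \<Phi> U"
    and IH: "\<And>u. mcs u \<Longrightarrow> Up \<Phi> u \<subset> U \<Longrightarrow> realizable X \<Phi> u"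
    and z: "mcs z" "Up \<Phi> z = U"
  shows "realizable X \<Phi> z"
proof -
  define K where "K w = {V \<in> Up2 \<Phi> w. core X \<Phi> V}" for w
  define single where "single w \<longleftrightarrow> K w \<noteq> {} \<and> (\<forall>V\<in>K w. \<forall>V'\<in>K w. (V, V') \<in> conn X \<Phi> U)" for w
  have Kmono: "K u \<subseteq> K w" if "mcs w" "u \<in> succs w" for u w
    using Up2_succs[OF that, of \<Phi>] by (auto simp: K_def)
  have up: "Up \<Phi> u = U \<or> Up \<Phi> u \<subset> U" if "mcs w" "Up \<Phi> w = U" "u \<in> succs w" for u w
    using Up_mono[OF that(1,3), of \<Phi>] that(2) by auto
  have basK: "bases X \<Phi> u \<subseteq> K w" if "mcs w" "u \<in> succs w" for u w
    using bases_subset[of X \<Phi> u] Up2_succs[OF that, of \<Phi>] unfolding K_def by blast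
  have below: "\<exists>V. insertable X \<Phi> u V" "bases X \<Phi> u \<noteq> {}" if "mcs u" "Up \<Phi> u \<subset> U" for u
    using IH[OF that] unfolding realizable_def by auto
  have Kne: "K w \<noteq> {}" if w: "mcs w" "Up \<Phi> w = U" for w
  proof
    assume e: "K w = {}"
    let ?P = "\<lambda>w. Up \<Phi> w = U \<and> {V \<in> Up2 \<Phi> w. core X \<Phi> V} = {}"
    have "core X \<Phi> U"
    proof (rule core_of_definable[OF \<Phi>, of ?P w])
      show "definable ?P"
        by (rule definable_Up_Up2[OF \<Phi>, of "\<lambda>A B. A = U \<and> {V \<in> B. core X \<Phi> V} = {}"])
      show "mcs w" "?P w" using w e by (auto simp: K_def)
      \<comment> \<open>All successors of such a point are in the class: one with smaller
        \<open>Up\<close> would show a core by \<open>IH\<close>. Seriality provides one.\<close>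
      fix v assume v: "mcs v" "?P v"
      then have "K v = {}" by (simp add: K_def)
      then have "bases X \<Phi> u = {}" "K u = {}" if "u \<in> succs v" for u
        using basK[OF v(1) that] Kmono[OF v(1) that] by auto
      then have "?P u" if "u \<in> succs v" for u
        using that up[OF v(1) _ that] v(2) below(2)[OF succs_mcs[OF that]] unfolding K_def by blast
      then show "Up \<Phi> v = U \<and> (\<exists>u\<in>succs v. ?P u) \<and>
          (\<forall>u\<in>succs v. \<not> ?P u \<longrightarrow> (\<exists>V. insertable X \<Phi> u V))"
        using v(2) succs_nonempty[OF v(1)] by (meson all_not_in_conv)
    qed
    then show False using nc by simp
  qed
  have ins: "insertable X \<Phi> z V" if z: "mcs z" "Up \<Phi> z = U" "single z" and V: "V \<in> K z" for z V
  proof -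
    \<comment> \<open>If every point of this class saw another one, \<open>U\<close> would be a
      core. So some \<open>v\<close> in it sees none, and then every successor \<open>u\<close> of
      \<open>v\<close> has \<open>Up \<Phi> u \<subset> U\<close>, where \<open>IH\<close>
      applies.\<close>
    define P where "P w \<longleftrightarrow> Up \<Phi> w = U \<and> single w \<and> (\<exists>V'\<in>K w. (V, V') \<in> conn X \<Phi> U)" for w
    have dP: "definable P"
      unfolding P_def single_def K_def
      by (rule definable_Up_Up2[OF \<Phi>, of "\<lambda>A B. A = U \<and> ({V \<in> B. core X \<Phi> V} \<noteq> {} \<and>
        (\<forall>V\<in>{V \<in> B. core X \<Phi> V}. \<forall>V'\<in>{V \<in> B. core X \<Phi> V}. (V, V') \<in> conn X \<Phi> U)) \<and>
        (\<exists>V'\<in>{V \<in> B. core X \<Phi> V}. (V, V') \<in> conn X \<Phi> U)"])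
    have sub: "Up \<Phi> u \<subset> U" if v: "mcs v" "P v" "u \<in> succs v" "\<not> P u" for u v
    proof (rule ccontr)
      assume "\<not> Up \<Phi> u \<subset> U"
      then have Uu: "Up \<Phi> u = U" using up v unfolding P_def by blast
      then obtain W where W: "W \<in> K u" using Kne[OF succs_mcs[OF v(3)]] by blast
      have KK: "K u \<subseteq> K v" using Kmono v by blast
      obtain V' where V': "V' \<in> K v" "(V, V') \<in> conn X \<Phi> U" using v(2) unfolding P_def by blast
      have "single u" using v(2) KK W unfolding P_def single_def by blast
      moreover have "(V', W) \<in> conn X \<Phi> U" using v(2) KK W V' unfolding P_def single_def by blast
      ultimately have "P u" unfolding P_def using Uu W conn_trans[OF V'(2)] by blast
      then show False using v by simp
    qed
    have "P z" unfolding P_def using z V conn_refl by blast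
    then have "\<not> (\<forall>v. mcs v \<longrightarrow> P v \<longrightarrow> (\<exists>u\<in>succs v. P u))"
      using core_of_definable[OF \<Phi> dP z(1), of U X] nc sub below(1)[OF succs_mcs]
      unfolding P_def[of _] by (smt (verit) P_def)
    then obtain v where v: "mcs v" "P v" "\<And>u. u \<in> succs v \<Longrightarrow> \<not> P u" by blast
    have vU: "Up \<Phi> v = U" and vs: "single v" using v(2) by (auto simp: P_def)
    obtain V1 where V1: "V1 \<in> K v" "(V, V1) \<in> conn X \<Phi> U" using v(2) by (auto simp: P_def)
    have small: "realizable X \<Phi> u" if "u \<in> succs v" for u
      using IH[OF succs_mcs[OF that] sub[OF v(1,2) that v(3)[OF that]]] .
    have "\<exists>u. u \<in> succs v \<and> u \<inter> \<Phi> = t" if "t \<in> Up \<Phi> v" for t using that by (auto simp: Up_def)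
    then obtain m where m: "\<And>t. t \<in> Up \<Phi> v \<Longrightarrow> m t \<in> succs v \<and> m t \<inter> \<Phi> = t" by metis
    show ?thesis
      unfolding insertable_def
    proof (intro allI impI)
      fix G :: "'a set" and y assume G: "open G" "y \<in> G"
      obtain \<rho> where "\<rho> y = z" "good \<Phi> \<rho> G"
        "\<And>x. x \<in> G \<Longrightarrow> mcs (\<rho> x) \<and> \<rho> x \<inter> \<Phi> \<in> insert (z \<inter> \<Phi>) (Up \<Phi> z)"
        "\<And>x. x \<in> closure G - G \<Longrightarrow> exact \<Phi> \<rho> G x V"
      \<comment> \<open>The shells are steered by \<open>v\<close>, whose successors are all
        realizable, while the centre is labelled \<open>z\<close>, which sees the same set
        \<open>U\<close>.\<close>
      proof (rule walk[where Ph = "\<lambda>_. \<Phi>" and w = v and z = z and D = "m ` Up \<Phi> v" and X = X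
            and ?U0.0 = V and ?U1.0 = V1 and G = G and y = y], goal_cases)
        case (19 \<rho>)
        from 19(2,4-) show ?case by (rule 19(1))
      next
        case (9 n U V)
        then show ?case using vs vU by (auto simp: single_def K_def)
      next
        case (8 n t)
        then show ?case using m by blast
      next
        case (10 n u)
        then show ?case using small by (auto simp: realizable_def)
      next
        case (11 n u U)
        then show ?case using small by (auto simp: realizable_def)
      next
        case 13
        then show ?case using V Up2_subset[OF z(1)] z(2) vU by (auto simp: K_def)
      qed (use v(1) z vU \<Phi> m finite_Up[OF \<Phi>] V V1 G in \<open>auto simp: K_def intro: countable_finite\<close>)
      then show "\<exists>\<rho>. good \<Phi> \<rho> G \<and> \<rho> y = z \<and>
        (\<forall>x\<in>G. mcs (\<rho> x) \<and> \<rho> x \<inter> \<Phi> \<in> insert (z \<inter> \<Phi>) (Up \<Phi> z)) \<and>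
        (\<forall>z\<in>closure G - G. exact \<Phi> \<rho> G z V)"
        by (intro exI[of _ \<rho>]) simp
    qed
  qed
  have sg: "single w" if w: "mcs w" "Up \<Phi> w = U" for w
  proof (rule ccontr)
    assume ns: "\<not> single w"
    define P where "P w \<longleftrightarrow> Up \<Phi> w = U \<and> \<not> single w" for w
    have dP: "definable P"
      unfolding P_def single_def K_def
      by (rule definable_Up_Up2[OF \<Phi>, of "\<lambda>A B. A = U \<and> \<not> ({V \<in> B. core X \<Phi> V} \<noteq> {} \<and>
        (\<forall>V\<in>{V \<in> B. core X \<Phi> V}. \<forall>V'\<in>{V \<in> B. core X \<Phi> V}. (V, V') \<in> conn X \<Phi> U))"])
    have "core X \<Phi> U"
    proof (rule core_of_definable[OF \<Phi> dP w(1)])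
      show "P w" using w ns by (simp add: P_def)
      fix v assume v: "mcs v" "P v"
      have vU: "Up \<Phi> v = U" using v by (simp add: P_def)
      have others: "Up \<Phi> u \<subset> U \<or> Up \<Phi> u = U \<and> single u" if "u \<in> succs v" "\<not> P u" for u
        using up[OF v(1) vU that(1)] that(2) by (auto simp: P_def)
      have "\<exists>V. insertable X \<Phi> u V" if u: "u \<in> succs v" "\<not> P u" for u
        using others[OF u] below(1)[OF succs_mcs[OF u(1)]] ins[OF succs_mcs[OF u(1)]]
          Kne[OF succs_mcs[OF u(1)]] by blast
      moreover have "\<exists>u\<in>succs v. P u"
      proof (rule ccontr)
        assume n: "\<not> (\<exists>u\<in>succs v. P u)"
        define L where "L u = {V \<in> insert (Up \<Phi> u) (Up2 \<Phi> u). core X \<Phi> V}" for u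
        have Lc: "(V, V') \<in> conn X \<Phi> U" if u: "u \<in> succs v" and V: "V \<in> L u" "V' \<in> L u" for u V V'
        proof -
          have "\<not> P u" using n u by blast
          from others[OF u this] show ?thesis
          proof
            assume a: "Up \<Phi> u \<subset> U"
            then have "(V, V') \<in> conn X \<Phi> (Up \<Phi> u)"
              using IH[OF succs_mcs[OF u]] V unfolding realizable_def L_def by blast
            then show ?thesis using conn_mono[of "Up \<Phi> u" U X \<Phi>] a by blast
          next
            assume a: "Up \<Phi> u = U \<and> single u"
            then have "L u = K u" using nc by (auto simp: L_def K_def)
            then show ?thesis using a V unfolding single_def by blast
          qed
        qed
        have Lne: "L u \<noteq> {}" if u: "u \<in> succs v" for u
          using up[OF v(1) vU u]
        proof
          assume "Up \<Phi> u = U"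
          then show ?thesis using Kne[OF succs_mcs[OF u]] by (auto simp: L_def K_def)
        next
          assume "Up \<Phi> u \<subset> U"
          then show ?thesis using below(2)[OF succs_mcs[OF u]] bases_subset[of X \<Phi> u]
            unfolding L_def by blast
        qed
        obtain V1 V2 where V12: "V1 \<in> K v" "V2 \<in> K v" "(V1, V2) \<notin> conn X \<Phi> U"
          using Kne[OF v(1) vU] v(2) unfolding P_def single_def by blast
        obtain a b where ab: "a \<in> succs v" "V1 = Up \<Phi> a" "b \<in> succs v" "V2 = Up \<Phi> b"
          using V12 by (auto simp: K_def Up2_def)
        \<comment> \<open>Does \<open>u\<close> see, or determine by its own \<open>Up\<close>, a
          core in the component of \<open>V1\<close>? G1 yields an edge along which the answer
          changes. This is impossible: the cores at the upper end are among those at the lower end,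
          and the latter form one component.\<close>
        define A where "A u \<longleftrightarrow> (\<exists>V\<in>L u. (V1, V) \<in> conn X \<Phi> U)" for u
        have "definable A"
          unfolding A_def L_def
          by (rule definable_Up_Up2[OF \<Phi>, of "\<lambda>Y Z. \<exists>V\<in>{V \<in> insert Y Z. core X \<Phi> V}. (V1, V) \<in> conn X \<Phi> U"])
        moreover have "V1 \<in> L a" "V2 \<in> L b" using V12 ab by (auto simp: L_def K_def)
        then have "A a" "\<not> A b"
          using conn_refl V12(3) Lc[OF ab(3)] conn_trans unfolding A_def by blast+
        ultimately obtain u u' where u: "u \<in> succs v" "u' \<in> succs u" "A u \<noteq> A u'"
          using mcs_G1[of A v a b] v(1) ab by blast
        have LL: "L u' \<subseteq> L u" using Up2_succs[OF succs_mcs[OF u(1)] u(2), of \<Phi>] by (auto simp: L_def)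
        have u': "u' \<in> succs v" using succs_trans[OF v(1) u(1,2)] .
        obtain W where W: "W \<in> L u'" using Lne[OF u'] by blast
        have "A u \<longleftrightarrow> A u'"
          using LL W Lc[OF u(1)] conn_trans unfolding A_def by blast
        then show False using u(3) by simp
      qed
      ultimately show "Up \<Phi> v = U \<and> (\<exists>u\<in>succs v. P u) \<and>
          (\<forall>u\<in>succs v. \<not> P u \<longrightarrow> (\<exists>V. insertable X \<Phi> u V))"
        using vU by blast
    qed
    then show False using nc by simp
  qed
  have "bases X \<Phi> z = K z" using nc z(2) by (auto simp: bases_def K_def)
  moreover have "V \<in> K z" if "V \<in> insert (Up \<Phi> z) (Up2 \<Phi> z)" "core X \<Phi> V" for V
    using that nc z(2) by (auto simp: K_def)
  ultimately show ?thesis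
    using Kne[OF z] sg[OF z] ins[OF z] z(2) unfolding realizable_def single_def by simp
qed

lemma realizable:
  fixes X :: "'a::{metric_space, perfect_space} itself"
  assumes "fclosed \<Phi>" "mcs z"
  shows "realizable X \<Phi> z"
  using assms(2)
proof (induction "card (Up \<Phi> z)" arbitrary: z rule: less_induct)
  case less
  show ?case
  proof (cases "core X \<Phi> (Up \<Phi> z)")
    case True
    then show ?thesis using realizable_core assms(1) less.prems by blast
  next
    case False
    show ?thesis
    proof (rule realizable_step[OF assms(1) False _ less.prems refl])
      fix u assume u: "mcs u" "Up \<Phi> u \<subset> Up \<Phi> z"
      then have "card (Up \<Phi> u) < card (Up \<Phi> z)" by (intro psubset_card_mono finite_Up assms(1))
      then show "realizable X \<Phi> u" using less.hyps u(1) by blast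
    qed
  qed
qed

section \<open>Strong completeness\<close>

lemma fclosed_UN: "finite I \<Longrightarrow> (\<And>i. i \<in> I \<Longrightarrow> fclosed (\<Phi> i)) \<Longrightarrow> fclosed (\<Union>i\<in>I. \<Phi> i)"
  unfolding fclosed_def by (intro conjI finite_UN_I) blast+

lemma finite_parts: "finite (parts \<phi>)"
  by (cases \<phi>) auto

lemma fclosed_of_parts:
  assumes "\<phi> \<in> formulas" "\<And>\<eta>. \<eta> \<in> parts \<phi> \<Longrightarrow> \<exists>\<Phi>. fclosed \<Phi> \<and> \<eta> \<in> \<Phi>"
  shows "\<exists>\<Phi>. fclosed \<Phi> \<and> \<phi> \<in> \<Phi>"
proof -
  obtain f where f: "\<And>\<eta>. \<eta> \<in> parts \<phi> \<Longrightarrow> fclosed (f \<eta>) \<and> \<eta> \<in> f \<eta>" using assms(2) by metis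
  let ?S = "\<Union>\<eta>\<in>parts \<phi>. f \<eta>"
  have "fclosed ?S" using f by (intro fclosed_UN finite_parts) blast
  moreover have "parts \<phi> \<subseteq> ?S" using f by blast
  ultimately have "fclosed (insert \<phi> ?S)" using assms(1) unfolding fclosed_def by blast
  then show ?thesis by blast
qed

lemma fclosed_exists: "\<phi> \<in> formulas \<Longrightarrow> \<exists>\<Phi>. fclosed \<Phi> \<and> \<phi> \<in> \<Phi>"
  by (induction rule: formulas.induct; rule fclosed_of_parts) auto

lemma satisfiable_of_consistent:
  fixes X :: "'a::{metric_space, perfect_space} itself" and \<Gamma> :: "'v fm set"
  assumes "\<Gamma> \<subseteq> formulas" "countable \<Gamma>" "consistent KD4G1t \<Gamma>"
  shows "satisfiable_in X \<Gamma>"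
proof -
  obtain w where w: "mcs w" "\<Gamma> \<subseteq> w" using lindenbaum assms by blast
  obtain \<gamma> :: "nat \<Rightarrow> 'v fm" where \<gamma>: "\<And>n. \<gamma> n \<in> insert Top \<Gamma>"
    "\<And>\<phi>. \<phi> \<in> insert Top \<Gamma> \<Longrightarrow> infinite {n. \<gamma> n = \<phi>}"
    using repeating_enumeration[of "insert Top \<Gamma>"] assms(2) by (metis countable_insert insert_not_empty)
  have "\<exists>\<Phi>. fclosed \<Phi> \<and> \<gamma> n \<in> \<Phi>" for n
    using \<gamma>(1)[of n] assms(1) by (intro fclosed_exists) auto
  then obtain S where S: "\<And>n. fclosed (S n)" "\<And>n. \<gamma> n \<in> S n" by metis
  define Ph where "Ph n = (\<Union>i\<in>{..n}. S i)" for n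
  have Ph: "fclosed (Ph n)" "Ph n \<subseteq> Ph (Suc n)" for n
  proof -
    show "fclosed (Ph n)" using fclosed_UN[of "{..n}" S] S(1) by (simp add: Ph_def)
    show "Ph n \<subseteq> Ph (Suc n)" unfolding Ph_def by (intro UN_mono) auto
  qed
  define m where "m n t = (SOME u. u \<in> succs w \<and> u \<inter> Ph n = t)" for n t
  have m: "m n t \<in> succs w \<and> m n t \<inter> Ph n = t" if "t \<in> Up (Ph n) w" for n t
    unfolding m_def by (rule someI_ex) (use that in \<open>auto simp: Up_def\<close>)
  \<comment> \<open>One representative for each level and type. Every level has finitely many types,
    so this set is countable.\<close>
  let ?D = "\<Union>n. m n ` Up (Ph n) w"
  have rw: "realizable X (Ph n) w" for n by (rule realizable[OF Ph(1) w(1)])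
  have ru: "realizable X (Ph n) u" if "u \<in> succs w" for n u
    by (rule realizable[OF Ph(1) succs_mcs[OF that]])
  obtain u where u: "u \<in> succs w" using succs_nonempty[OF w(1)] by blast
  then obtain U0 where "U0 \<in> bases X (Ph 0) u" using ru[OF u, of 0] by (auto simp: realizable_def)
  then have U0: "U0 \<in> Up2 (Ph 0) w" "core X (Ph 0) U0"
    using bases_subset[of X "Ph 0" u] Up2_succs[OF w(1) u, of "Ph 0"] by auto
  obtain y :: 'a where "y \<in> UNIV" by blast
  \<comment> \<open>The whole space has no boundary, so the walk may start at any visible core. Its
    levels exhaust \<open>\<Gamma>\<close>, and truth is obtained at \<open>y\<close>, for each
    formula on a neighbourhood of its own.\<close>
  obtain \<rho> :: "'a \<Rightarrow> 'v fm set" where \<rho>: "\<rho> y = w" "\<And>n. \<exists>V. y \<in> V \<and> good (Ph n) \<rho> V"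
  proof (rule walk[where Ph = Ph and w = w and z = w and D = ?D and X = X
        and ?U0.0 = U0 and ?U1.0 = U0 and G = UNIV and y = y], goal_cases)
    case (19 \<rho>)
    from 19(2,3) show ?case by (rule 19(1))
  next
    case (8 n t)
    then have "m n t \<in> ?D" "m n t \<inter> Ph n = t" using m[of t n] by auto
    then show ?case by (rule bexI[rotated])
  next
    case (9 n U V)
    then show ?case using rw[of n] by (auto simp: realizable_def)
  next
    case (10 n u)
    then show ?case using ru[of u n] by (auto simp: realizable_def)
  next
    case (11 n u U)
    then show ?case using ru[of u n] by (auto simp: realizable_def)
  next
    case 7
    show ?case by (intro countable_UN countable_image countable_finite[OF finite_Up[OF Ph(1)]]) simp
  next
    case 13
    show ?case using Up2_subset[OF w(1) U0(1)] .
  qed (use w(1) Ph m U0 conn_refl in auto)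
  have "y \<in> truth_set (asg \<rho>) \<phi>" if \<phi>: "\<phi> \<in> \<Gamma>" for \<phi>
  proof -
    have "{n. \<gamma> n = \<phi>} \<noteq> {}" using \<gamma>(2)[of \<phi>] \<phi> by (metis finite.emptyI insertI2)
    then obtain n where "\<gamma> n = \<phi>" by blast
    then have "\<phi> \<in> Ph n" using S(2)[of n] by (auto simp: Ph_def)
    then show ?thesis using \<rho> w(2) \<phi> unfolding good_def by blast
  qed
  then show ?thesis unfolding satisfiable_in_def by blast
qed

section \<open>Soundness\<close>

lemma truth_set_derived_simps:
  "truth_set h (Imp \<phi> \<psi>) = - truth_set h \<phi> \<union> truth_set h \<psi>"
  "truth_set h (Dia \<phi>) = derived (truth_set h \<phi>)"
  by (auto simp: Imp_def Dia_def derived_def islimpt_def)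

lemma truth_set_psubst:
  "x \<in> truth_set h (psubst \<sigma> \<alpha>) \<longleftrightarrow> peval (\<lambda>n. x \<in> truth_set h (\<sigma> n)) \<alpha>"
  by (induction \<alpha>) auto

lemma truth_set_Conj: "truth_set h (Conj l) = (\<Inter>\<phi>\<in>set l. truth_set h \<phi>)"
  by (induction l) auto

lemma soundness:
  fixes h :: "'v \<Rightarrow> 'a::{metric_space, perfect_space} set"
  assumes G1: "scheme_valid_in TYPE('a) (G1 :: 'v fm set)" and "\<phi> \<in> KD4G1t"
  shows "truth_set h \<phi> = UNIV"
  using assms(2)
proof (induction rule: KD4G1t.induct)
  case (Taut \<phi>)
  then show ?case by (auto simp: taut_instances_def truth_set_psubst)
next
  case (K \<phi> \<psi>)
  have "x \<in> truth_set h (Box \<psi>)"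
    if x: "x \<in> truth_set h (Box (Imp \<phi> \<psi>))" "x \<in> truth_set h (Box \<phi>)" for x
  proof (rule ccontr)
    assume "x \<notin> truth_set h (Box \<psi>)"
    then have "x islimpt - truth_set h \<psi>" by (simp add: truth_set_Box_islimpt del: truth_set.simps)
    moreover have "- truth_set h \<psi> \<subseteq> - truth_set h (Imp \<phi> \<psi>) \<union> - truth_set h \<phi>"
      by (auto simp: truth_set_derived_simps)
    ultimately have "x islimpt - truth_set h (Imp \<phi> \<psi>) \<union> - truth_set h \<phi>" by (rule islimpt_subset)
    then show False using x unfolding truth_set_Box_islimpt islimpt_Un by blast
  qed
  then show ?case unfolding truth_set_derived_simps by blast
next
  case D
  show ?case by (simp add: truth_set_derived_simps derived_def islimpt_UNIV)
next
  case (Four \<phi>)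
  have "x \<in> truth_set h (Box (Box \<phi>))" if x: "x \<in> truth_set h (Box \<phi>)" for x
  proof -
    obtain U where U: "open U" "x \<in> U" "\<forall>y\<in>U - {x}. y \<in> truth_set h \<phi>" using x by auto
    \<comment> \<open>The neighbourhood \<open>U - {x}\<close> of \<open>y\<close> is open because
      points are closed.\<close>
    have "y \<in> truth_set h (Box \<phi>)" if "y \<in> U - {x}" for y
      using U that by (auto intro!: exI[of _ "U - {x}"] open_Diff)
    then show ?thesis using U by (auto simp del: truth_set.simps(5) simp: truth_set.simps(5)[of h "Box \<phi>"])
  qed
  then show ?case unfolding truth_set_derived_simps by blast
next
  case (G1 \<phi>)
  then show ?case using assms(1) unfolding scheme_valid_in_def valid_in_def by blast
next
  case (Fix \<Gamma> \<gamma>)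
  have "x \<in> derived (truth_set h (And \<gamma> (Tangle \<Gamma>)))" if "x \<in> truth_set h (Tangle \<Gamma>)" for x
    using truth_set_Tangle_unfold[OF that Fix(2)] by (simp add: derived_def)
  then show ?case unfolding truth_set_derived_simps by blast
next
  case (Ind \<Gamma> \<phi> l)
  let ?\<psi> = "Imp \<phi> (Conj (map (\<lambda>\<gamma>. Dia (And \<gamma> \<phi>)) l))"
  have "x \<in> truth_set h (Tangle \<Gamma>)" if x: "x \<in> truth_set h (BoxStar ?\<psi>)" "x \<in> truth_set h \<phi>" for x
  proof -
    have x1: "x \<in> truth_set h ?\<psi>" "x \<in> truth_set h (Box ?\<psi>)" using x by (auto simp: BoxStar_def)
    then obtain U where U: "open U" "x \<in> U" "\<And>y. y \<in> U \<Longrightarrow> y \<in> truth_set h ?\<psi>" by auto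
    \<comment> \<open>\<open>\<phi>\<close> reproduces itself only where \<open>?\<psi>\<close>
      holds, so the witness is cut down to \<open>U\<close>.\<close>
    let ?S = "truth_set h \<phi> \<inter> U"
    have "y islimpt (truth_set h \<gamma> \<inter> ?S)" if y: "y \<in> ?S" "\<gamma> \<in> fset \<Gamma>" for y \<gamma>
    proof -
      have "y islimpt (truth_set h \<gamma> \<inter> truth_set h \<phi>)"
        using U(3)[of y] y Ind(3) by (auto simp: truth_set_derived_simps truth_set_Conj derived_def)
      then show ?thesis
        using islimpt_cong_open[OF U(1), of y "truth_set h \<gamma> \<inter> truth_set h \<phi>" "truth_set h \<gamma> \<inter> ?S"] y
        by blast
    qed
    then show ?thesis unfolding truth_set_Tangle_islimpt using x(2) U(2) by (intro exI[of _ ?S]) simp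
  qed
  then show ?case unfolding truth_set_derived_simps by blast
next
  case (MP \<phi> \<psi>)
  then show ?case by (auto simp: truth_set_derived_simps)
next
  case (Gen \<phi>)
  then show ?case by auto
qed

theorem theorem10p1:
  shows "strongly_complete_over TYPE('a::{metric_space, perfect_space})
           (formulas :: 'v fm set) KD4G1t \<and>
         (scheme_valid_in TYPE('a) (G1 :: 'v fm set) \<longrightarrow>
           sound_over TYPE('a) (KD4G1t :: 'v fm set))"
  unfolding strongly_complete_over_def sound_over_def valid_in_def
  using satisfiable_of_consistent soundness by blast

end
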